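(* Let $G$ be a connected generalized block graph on $[n]$. Then $J_G$ is unmixed if and only if the following conditions hold: (a) for every $t$ and every $t$-minimal cut set $A$ of $G$, we have $|A|=t-1$; (b) if there are some minimal cut sets $A_1,\ldots,A_s$ of $G$ whose union is (the vertex set of) a maximal clique of $G$, then $|A_i|=1$ for some $i\in\{1,\ldots,s\}$.
   Context: Graphs are finite simple graphs, $K$ is a field. The binomial edge ideal of a graph $G$ on $[n]$ is $J_G=(x_iy_j-x_jy_i : i<j,\ \{i,j\}\in E(G))\subset S=K[x_1,\ldots,x_n,y_1,\ldots,y_n]$. A generalized block graph is a connected chordal graph $G$ such that for every three maximal cliques of $G$ with vertex sets $F_i,F_j,F_k$, if $F_i\cap F_j\cap F_k\neq\emptyset$, then $F_i\cap F_j=F_i\cap F_k=F_j\cap F_k$. A cut set of $G$ is a set of vertices whose deletion increases the number of connected components of $G$; a minimal cut set is a cut set minimal under inclusion. In a generalized block graph, a set $A$ of vertices is a minimal cut set if and only if there are maximal cliques (with vertex sets) $F_{i_1},\ldots,F_{i_t}$ of $G$ with $\bigcap_{j=1}^t F_{i_j}=A$ and $F\cap A=\emptyset$ for all other maximal cliques $F$ of $G$; in this case $A$ is called a $t$-minimal cut set (so $t$ is the number of maximal cliques containing $A$). *)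

theory Defs
  imports
    "Graph_Theory.Digraph_Component"
    "HOL-Algebra.Ideal"
    "HOL-Library.Poly_Mapping"
    "HOL-Library.Extended_Nat"
begin

section \<open>Heights and unmixed ideals\<close>

definition prime_chain :: "('a, 'm) ring_scheme \<Rightarrow> nat \<Rightarrow> (nat \<Rightarrow> 'a set) \<Rightarrow> bool" where
  "prime_chain R k C \<longleftrightarrow>
     (\<forall>i\<le>k. primeideal (C i) R) \<and> (\<forall>i<k. C i \<subset> C (Suc i))"

definition ideal_height :: "('a, 'm) ring_scheme \<Rightarrow> 'a set \<Rightarrow> enat" where
  "ideal_height R P = Sup {enat k | k. \<exists>C. prime_chain R k C \<and> C k = P}"

text \<open>Associated primes of the ring modulo \<open>I\<close>: the prime ideals of the form \<open>I : a\<close>.\<close>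

definition associated_prime :: "('a, 'm) ring_scheme \<Rightarrow> 'a set \<Rightarrow> 'a set \<Rightarrow> bool" where
  "associated_prime R I P \<longleftrightarrow>
     primeideal P R \<and> (\<exists>a\<in>carrier R. P = {r \<in> carrier R. r \<otimes>\<^bsub>R\<^esub> a \<in> I})"

definition unmixed :: "('a, 'm) ring_scheme \<Rightarrow> 'a set \<Rightarrow> bool" where
  "unmixed R I \<longleftrightarrow>
     (\<forall>P Q. associated_prime R I P \<longrightarrow> associated_prime R I Q \<longrightarrow>
        ideal_height R P = ideal_height R Q)"


section \<open>Binomial edge ideals\<close>

datatype xyvar = X nat | Y nat

text \<open>
  Polynomials with coefficients in \<open>'k\<close>: finitely supported maps from monomials
  (exponent vectors) to coefficients, with the convolution product of
  \<open>Poly_Mapping\<close>.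
\<close>

type_synonym 'k xypoly = "(xyvar \<Rightarrow>\<^sub>0 nat) \<Rightarrow>\<^sub>0 'k"

definition pvar :: "xyvar \<Rightarrow> 'k::field xypoly" where
  "pvar v = Poly_Mapping.single (Poly_Mapping.single v 1) 1"

text \<open>
  The ring \<open>K[x\<^sub>1,\<dots>,x\<^sub>n,y\<^sub>1,\<dots>,y\<^sub>n]\<close>. The type \<open>'k xypoly\<close> has infinitely
  many variables; the carrier keeps the polynomials in the first \<open>n\<close> pairs.
\<close>

definition xy_ring :: "nat \<Rightarrow> 'k::field xypoly ring" where
  "xy_ring n =
     (let V = X ` {1..n} \<union> Y ` {1..n}
      in \<lparr>carrier = {p. \<forall>m\<in>Poly_Mapping.keys p. Poly_Mapping.keys m \<subseteq> V},
          monoid.mult = (*), one = 1, ring.zero = 0, add = (+)\<rparr>)"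

lemma cring_of_closed_set:
  fixes C :: "'a::comm_ring_1 set"
  assumes add: "\<And>p q. p \<in> C \<Longrightarrow> q \<in> C \<Longrightarrow> p + q \<in> C"
    and mult: "\<And>p q. p \<in> C \<Longrightarrow> q \<in> C \<Longrightarrow> p * q \<in> C"
    and neg: "\<And>p. p \<in> C \<Longrightarrow> - p \<in> C"
    and zero_one: "0 \<in> C" "1 \<in> C"
  shows "cring \<lparr>carrier = C, monoid.mult = (*), one = 1, ring.zero = 0, add = (+)\<rparr>"
    (is "cring ?R")
proof (rule cringI)
  show "abelian_group ?R"
  proof (rule abelian_groupI)
    fix x assume "x \<in> carrier ?R"
    then show "\<exists>y\<in>carrier ?R. y \<oplus>\<^bsub>?R\<^esub> x = \<zero>\<^bsub>?R\<^esub>"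
      using neg by (intro bexI[of _ "- x"]) simp_all
  qed (simp_all add: add zero_one algebra_simps)
  show "comm_monoid ?R"
    by (rule comm_monoidI) (simp_all add: mult zero_one algebra_simps)
qed (simp add: algebra_simps)

lemma cring_xy_ring: "cring (xy_ring n :: 'k::field xypoly ring)"
proof -
  let ?V = "X ` {1..n} \<union> Y ` {1..n}"
  let ?C = "{p :: 'k xypoly. \<forall>m\<in>Poly_Mapping.keys p. Poly_Mapping.keys m \<subseteq> ?V}"
  have add: "p + q \<in> ?C" if "p \<in> ?C" "q \<in> ?C" for p q
    using that keys_add[of p q] by blast
  have mult: "p * q \<in> ?C" if pq: "p \<in> ?C" "q \<in> ?C" for p q
  proof (rule CollectI, rule ballI)
    fix m assume "m \<in> Poly_Mapping.keys (p * q)"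
    then obtain a b where ab: "m = a + b" "a \<in> Poly_Mapping.keys p" "b \<in> Poly_Mapping.keys q"
      using keys_mult[of p q] by blast
    show "Poly_Mapping.keys m \<subseteq> ?V"
      using ab pq keys_add[of a b] by blast
  qed
  have neg: "- p \<in> ?C" if "p \<in> ?C" for p
    using that by simp
  have zero_one: "0 \<in> ?C" "1 \<in> ?C"
    by simp_all
  show ?thesis
    unfolding xy_ring_def Let_def
    by (rule cring_of_closed_set) (fact add mult neg zero_one)+
qed

definition binomial_edge_ideal :: "nat \<Rightarrow> nat pair_pre_digraph \<Rightarrow> 'k::field xypoly set" where
  "binomial_edge_ideal n G = Idl\<^bsub>xy_ring n\<^esub>
     {pvar (X i) * pvar (Y j) - pvar (X j) * pvar (Y i) | i j. i < j \<and> (i, j) \<in> parcs G}"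


section \<open>Generalized block graphs and minimal cut sets\<close>

text \<open>
  A finite simple graph is a \<open>pair_graph\<close>: a finite loopless symmetric relation, so that
  the edge between \<open>u\<close> and \<open>v\<close> is the pair of arcs \<open>(u, v)\<close>, \<open>(v, u)\<close>.
\<close>

definition max_clique :: "'a pair_pre_digraph \<Rightarrow> 'a set \<Rightarrow> bool" where
  "max_clique G F \<longleftrightarrow>
     (let clique = (\<lambda>C. C \<subseteq> pverts G \<and> (\<forall>u\<in>C. \<forall>v\<in>C. u \<noteq> v \<longrightarrow> (u, v) \<in> parcs G))
      in clique F \<and> (\<forall>F'. clique F' \<and> F \<subseteq> F' \<longrightarrow> F' = F))"

text \<open>
  Every cycle of length at least 4 has a chord. A library cycle is the list of its arcs
  in one direction; the degenerate cycles \<open>u, v, u\<close> it allows have length 2.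
\<close>

definition chordal :: "'a pair_pre_digraph \<Rightarrow> bool" where
  "chordal G \<longleftrightarrow>
     (\<forall>p. pre_digraph.cycle (with_proj G) p \<and> length p \<ge> 4 \<longrightarrow>
        (\<exists>u\<in>fst ` set p. \<exists>v\<in>fst ` set p.
           (u, v) \<in> parcs G \<and> (u, v) \<notin> set p \<and> (v, u) \<notin> set p))"

definition generalized_block_graph :: "'a pair_pre_digraph \<Rightarrow> bool" where
  "generalized_block_graph G \<longleftrightarrow>
     pair_graph G \<and> Digraph_Component.connected (with_proj G) \<and> chordal G \<and>
     (\<forall>F1 F2 F3. max_clique G F1 \<and> max_clique G F2 \<and> max_clique G F3 \<and>
        F1 \<noteq> F2 \<and> F1 \<noteq> F3 \<and> F2 \<noteq> F3 \<and> F1 \<inter> F2 \<inter> F3 \<noteq> {} \<longrightarrow>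
        F1 \<inter> F2 = F1 \<inter> F3 \<and> F1 \<inter> F3 = F2 \<inter> F3)"

text \<open>
  On a symmetric digraph the strongly connected components are the connected components.
\<close>

definition num_components :: "('a, 'b) pre_digraph \<Rightarrow> nat" where
  "num_components H = card (pre_digraph.sccs_verts H)"

definition cut_set :: "'a pair_pre_digraph \<Rightarrow> 'a set \<Rightarrow> bool" where
  "cut_set G A \<longleftrightarrow> A \<subseteq> pverts G \<and>
     num_components (with_proj G \<restriction> (pverts G - A)) > num_components (with_proj G)"

definition minimal_cut_set :: "'a pair_pre_digraph \<Rightarrow> 'a set \<Rightarrow> bool" where
  "minimal_cut_set G A \<longleftrightarrow> cut_set G A \<and> (\<forall>B. B \<subset> A \<longrightarrow> \<not> cut_set G B)"

definition t_minimal_cut_set :: "'a pair_pre_digraph \<Rightarrow> nat \<Rightarrow> 'a set \<Rightarrow> bool" where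
  "t_minimal_cut_set G t A \<longleftrightarrow> minimal_cut_set G A \<and>
     (\<exists>\<F>. \<F> \<subseteq> {F. max_clique G F} \<and> card \<F> = t \<and> \<F> \<noteq> {} \<and> \<Inter>\<F> = A \<and>
        (\<forall>F. max_clique G F \<and> F \<notin> \<F> \<longrightarrow> F \<inter> A = {}))"

end

theory Submission
  imports Defs "Graph_Theory.Vertex_Walk"
begin

text \<open>
  For \<open>T \<subseteq> [n]\<close> let \<open>c(T)\<close> be the number of components of \<open>G - T\<close> and \<open>P\<^sub>T\<close> the ideal generated by
  \<open>x\<^sub>i, y\<^sub>i\<close> for \<open>i \<in> T\<close> and all minors \<open>x\<^sub>i y\<^sub>j - x\<^sub>j y\<^sub>i\<close> with \<open>i, j\<close> in a common component of \<open>G - T\<close>.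
  Each \<open>P\<^sub>T\<close> is the kernel of a monomial substitution, hence prime, and \<open>J\<^sub>G\<close> is the intersection of
  all \<open>P\<^sub>T\<close> by induction on the number of non-edges: for a non-simplicial vertex \<open>v\<close> the ideal is
  the intersection of the ideal with the neighbourhood of \<open>v\<close> completed and the ideal with \<open>v\<close>
  deleted. So the associated primes are the minimal \<open>P\<^sub>T\<close>, which are those where every \<open>v \<in> T\<close> has
  neighbours in two components of \<open>G - T\<close>. As \<open>P\<^sub>T\<close> has height \<open>n + |T| - c(T)\<close> and \<open>P\<^sub>\<emptyset>\<close> is
  minimal, \<open>J\<^sub>G\<close> is unmixed iff \<open>c(T) = |T| + 1\<close> for all these \<open>T\<close>.

  In a generalized block graph such a \<open>T\<close> is a disjoint union of minimal cut sets \<open>A\<close>, and if \<open>A\<close>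
  lies in \<open>t\<^sub>A\<close> maximal cliques, then \<open>c(T) = 1 + \<Sum>\<^sub>A (t\<^sub>A - 1) - m\<close>, where \<open>m\<close> counts the maximal
  cliques contained in \<open>T\<close>.
\<close>

text \<open>Heights are the obstacle: an upper bound must control all prime chains. A chain of
  length \<open>k\<close> yields about \<open>d ^ k\<close> linearly independent polynomials whose
  exponents grow linearly in \<open>d\<close>, but only about \<open>d ^ (2 * n)\<close> monomials
  are available, so \<open>k \<le> 2 * n\<close>. On a chain of length exactly \<open>2 * n\<close>
  the position of a prime is therefore its height. The substitutions provide such chains, since they
  are composed of moves that each enlarge the kernel. They need no new variables: once the column of
  \<open>b\<close> is replaced, \<open>x_b\<close> is free to serve as its proportionality factor.

  Condition (b) governs \<open>m\<close>. Under (a) the count reads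
  \<open>c(T) = 1 + |T| - m\<close>, so (b) has to exclude maximal cliques inside the relevant
  \<open>T\<close>. A maximal clique that is a union of minimal cut sets of size at least 2 has
  \<open>t \<ge> 3\<close> at each of them, hence two further cliques at every vertex, and is itself
  a relevant \<open>T\<close> with \<open>m = 1\<close>. A one-vertex cut set has
  \<open>t = 2\<close> and leaves only one further clique, too few to reach two components.\<close>

section \<open>Evaluation homomorphisms of polynomials\<close>

text \<open>A linear order on the variables turns the exponent vectors into a linearly ordered
  monoid. The polynomials then have no zero divisors, on which primality of kernels rests.\<close>

instantiation xyvar :: linorder
begin

fun var_code :: "xyvar \<Rightarrow> nat" where
  "var_code (X n) = 2 * n"
| "var_code (Y n) = 2 * n + 1"

definition less_eq_xyvar :: "xyvar \<Rightarrow> xyvar \<Rightarrow> bool" where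
  "less_eq_xyvar a b \<longleftrightarrow> var_code a \<le> var_code b"

definition less_xyvar :: "xyvar \<Rightarrow> xyvar \<Rightarrow> bool" where
  "less_xyvar a b \<longleftrightarrow> var_code a < var_code b"

instance
proof
  fix x y :: xyvar
  assume "x \<le> y" "y \<le> x"
  then show "x = y"
    unfolding less_eq_xyvar_def by (cases x; cases y; simp; presburger)
qed (auto simp: less_eq_xyvar_def less_xyvar_def)

end

abbreviation monom :: "(xyvar \<Rightarrow>\<^sub>0 nat) \<Rightarrow> 'k::field xypoly" where
  "monom m \<equiv> Poly_Mapping.single m 1"

abbreviation const :: "'k::field \<Rightarrow> 'k xypoly" where
  "const c \<equiv> Poly_Mapping.single 0 c"

lemma poly_as_sum_of_terms:
  fixes p :: "'a \<Rightarrow>\<^sub>0 'b::comm_monoid_add"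
  assumes "finite A" "Poly_Mapping.keys p \<subseteq> A"
  shows "p = (\<Sum>m\<in>A. Poly_Mapping.single m (Poly_Mapping.lookup p m))"
proof (rule poly_mapping_eqI)
  fix k
  show "Poly_Mapping.lookup p k =
      Poly_Mapping.lookup (\<Sum>m\<in>A. Poly_Mapping.single m (Poly_Mapping.lookup p m)) k"
    using assms by (auto simp: lookup_sum lookup_single when_def in_keys_iff)
qed

lemma single_as_const_mult: "Poly_Mapping.single m c = const c * monom m"
  by (simp add: mult_single)

lemma mono_add: "monom (a + b) = monom a * monom b"
  by (simp add: mult_single)

definition subst_mono :: "(xyvar \<Rightarrow> 'k::field xypoly) \<Rightarrow> (xyvar \<Rightarrow>\<^sub>0 nat) \<Rightarrow> 'k xypoly" where
  "subst_mono F m = (\<Prod>v\<in>Poly_Mapping.keys m. F v ^ Poly_Mapping.lookup m v)"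

definition subst :: "(xyvar \<Rightarrow> 'k::field xypoly) \<Rightarrow> 'k xypoly \<Rightarrow> 'k xypoly" where
  "subst F p = (\<Sum>m\<in>Poly_Mapping.keys p. const (Poly_Mapping.lookup p m) * subst_mono F m)"

lemma subst_mono_superset:
  assumes "finite A" "Poly_Mapping.keys m \<subseteq> A"
  shows "subst_mono F m = (\<Prod>v\<in>A. F v ^ Poly_Mapping.lookup m v)"
  unfolding subst_mono_def
  by (rule prod.mono_neutral_left) (use assms in \<open>auto simp: in_keys_iff\<close>)

lemma subst_superset:
  assumes "finite A" "Poly_Mapping.keys p \<subseteq> A"
  shows "subst F p = (\<Sum>m\<in>A. const (Poly_Mapping.lookup p m) * subst_mono F m)"
  unfolding subst_def
  by (rule sum.mono_neutral_left) (use assms in \<open>auto simp: in_keys_iff\<close>)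

lemma subst_mono_add: "subst_mono F (a + b) = subst_mono F a * subst_mono F b"
proof -
  let ?A = "Poly_Mapping.keys a \<union> Poly_Mapping.keys b"
  have "subst_mono F (a + b) = (\<Prod>v\<in>?A. F v ^ Poly_Mapping.lookup (a + b) v)"
    using keys_add[of a b] by (intro subst_mono_superset) auto
  also have "\<dots> = (\<Prod>v\<in>?A. F v ^ Poly_Mapping.lookup a v) * (\<Prod>v\<in>?A. F v ^ Poly_Mapping.lookup b v)"
    by (simp add: lookup_add power_add prod.distrib)
  also have "\<dots> = subst_mono F a * subst_mono F b"
    by (simp add: subst_mono_superset[symmetric])
  finally show ?thesis .
qed

lemma subst_add: "subst F (p + q) = subst F p + subst F q"
proof -
  let ?A = "Poly_Mapping.keys p \<union> Poly_Mapping.keys q"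
  have "subst F (p + q) = (\<Sum>m\<in>?A. const (Poly_Mapping.lookup (p + q) m) * subst_mono F m)"
    using keys_add[of p q] by (intro subst_superset) auto
  also have "\<dots> = (\<Sum>m\<in>?A. const (Poly_Mapping.lookup p m) * subst_mono F m)
      + (\<Sum>m\<in>?A. const (Poly_Mapping.lookup q m) * subst_mono F m)"
    by (simp add: lookup_add single_add distrib_right sum.distrib)
  also have "\<dots> = subst F p + subst F q"
    by (simp add: subst_superset[symmetric])
  finally show ?thesis .
qed

lemma subst_zero [simp]: "subst F 0 = 0"
  by (simp add: subst_def)

lemma subst_single: "subst F (Poly_Mapping.single m c) = const c * subst_mono F m"
  by (subst subst_superset[of "{m}"]) auto

lemma subst_const [simp]: "subst F (const c) = const c"
  by (simp add: subst_single subst_mono_def)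

lemma subst_one [simp]: "subst F 1 = 1"
  using subst_const[of F 1] by simp

lemma subst_pvar [simp]: "subst F (pvar v) = F v"
  by (simp add: pvar_def subst_single subst_mono_def)

lemma subst_sum: "subst F (sum f A) = (\<Sum>a\<in>A. subst F (f a))"
  by (induction A rule: infinite_finite_induct) (auto simp: subst_add)

lemma subst_mult: "subst F (p * q) = subst F p * subst F q"
proof -
  let ?t = "\<lambda>r m. Poly_Mapping.single m (Poly_Mapping.lookup r m)"
  let ?P = "Poly_Mapping.keys p" and ?Q = "Poly_Mapping.keys q"
  have p: "p = (\<Sum>m\<in>?P. ?t p m)" and q: "q = (\<Sum>m\<in>?Q. ?t q m)"
    by (rule poly_as_sum_of_terms; simp)+
  have "subst F (p * q) = subst F (\<Sum>a\<in>?P. \<Sum>b\<in>?Q. ?t p a * ?t q b)"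
    by (subst p, subst q) (simp add: sum_product)
  also have "\<dots> = (\<Sum>a\<in>?P. \<Sum>b\<in>?Q. subst F (?t p a) * subst F (?t q b))"
  proof -
    have "const (c * d) = const c * const d" for c d :: 'a
      by (simp add: mult_single)
    then show ?thesis
      by (simp add: subst_sum mult_single[of _ _ "_ :: xyvar \<Rightarrow>\<^sub>0 nat"] subst_single subst_mono_add ac_simps)
  qed
  also have "\<dots> = subst F (\<Sum>m\<in>?P. ?t p m) * subst F (\<Sum>m\<in>?Q. ?t q m)"
    by (simp add: subst_sum sum_product)
  also have "\<dots> = subst F p * subst F q"
    using p q by simp
  finally show ?thesis .
qed

lemma subst_uminus: "subst F (- p) = - subst F p"
  using subst_add[of F p "- p"] by (simp add: eq_neg_iff_add_eq_0 add.commute)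

lemma subst_diff: "subst F (p - q) = subst F p - subst F q"
  using subst_add[of F p "- q"] by (simp add: subst_uminus)

lemma subst_power: "subst F (p ^ k) = subst F p ^ k"
  by (induction k) (auto simp: subst_mult)

lemmas subst_hom = subst_add subst_mult subst_uminus subst_diff subst_power

lemma pvar_power: "pvar v ^ k = monom (Poly_Mapping.single v k)"
  by (induction k) (auto simp: pvar_def mult_single single_add[symmetric])

lemma prod_monom: "(\<Prod>a\<in>A. monom (f a)) = monom (\<Sum>a\<in>A. f a)"
  by (induction A rule: infinite_finite_induct) (auto simp: mult_single)

lemma mono_as_prod: "monom m = (\<Prod>v\<in>Poly_Mapping.keys m. pvar v ^ Poly_Mapping.lookup m v)"
  unfolding pvar_power prod_monom using poly_as_sum_of_terms[of "Poly_Mapping.keys m" m] by simp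

text \<open>Identities between homomorphisms and many ideal memberships thereby reduce to constants
  and variables; \<open>W\<close> limits the variables to be checked.\<close>

lemma polys_induct [consumes 1, case_names const pvar add mult]:
  fixes p :: "'k::field xypoly"
  assumes p: "\<forall>m\<in>Poly_Mapping.keys p. Poly_Mapping.keys m \<subseteq> W"
    and const: "\<And>c. P (const c)"
    and pvar: "\<And>v. v \<in> W \<Longrightarrow> P (pvar v)"
    and add: "\<And>p q. P p \<Longrightarrow> P q \<Longrightarrow> P (p + q)"
    and mult: "\<And>p q. P p \<Longrightarrow> P q \<Longrightarrow> P (p * q)"
  shows "P p"
proof -
  have pow: "P (pvar v ^ k)" if "v \<in> W" for v k
    using that const[of 1] by (induction k) (auto intro: pvar mult)
  have mon: "P (\<Prod>v\<in>A. pvar v ^ f v)" if "A \<subseteq> W" for A and f :: "xyvar \<Rightarrow> nat"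
    using that const[of 1] by (induction A rule: infinite_finite_induct) (auto intro: pow mult)
  have sum: "P (\<Sum>a\<in>A. f a)" if "\<And>a. a \<in> A \<Longrightarrow> P (f a)" for A and f :: "_ \<Rightarrow> 'k xypoly"
    using that const[of 0] by (induction A rule: infinite_finite_induct) (auto intro: add)
  have "P (\<Sum>m\<in>Poly_Mapping.keys p. Poly_Mapping.single m (Poly_Mapping.lookup p m))"
  proof (rule sum)
    fix m assume "m \<in> Poly_Mapping.keys p"
    then have "P (monom m)"
      using p mon unfolding mono_as_prod by blast
    then show "P (Poly_Mapping.single m (Poly_Mapping.lookup p m))"
      unfolding single_as_const_mult[of m "Poly_Mapping.lookup p m"] by (intro mult const)
  qed
  then show ?thesis
    using poly_as_sum_of_terms[of "Poly_Mapping.keys p" p] by simp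
qed

lemma subst_subst: "subst F (subst H p) = subst (\<lambda>v. subst F (H v)) p"
proof -
  have "\<forall>m\<in>Poly_Mapping.keys p. Poly_Mapping.keys m \<subseteq> UNIV" by simp
  then show ?thesis
    by (induction p rule: polys_induct) (auto simp: subst_hom)
qed

lemma subst_pvar_id: "subst pvar p = p"
proof -
  have "\<forall>m\<in>Poly_Mapping.keys p. Poly_Mapping.keys m \<subseteq> UNIV" by simp
  then show ?thesis
    by (induction p rule: polys_induct) (auto simp: subst_hom)
qed

section \<open>The ring of polynomials in the first pairs of variables\<close>

definition vars :: "nat \<Rightarrow> xyvar set" where
  "vars n = X ` {1..n} \<union> Y ` {1..n}"

lemma X_in_vars [simp]: "X i \<in> vars n \<longleftrightarrow> i \<in> {1..n}"
  and Y_in_vars [simp]: "Y i \<in> vars n \<longleftrightarrow> i \<in> {1..n}"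
  by (auto simp: vars_def)

lemma finite_vars [simp]: "finite (vars n)"
  by (simp add: vars_def)

lemma card_vars: "card (vars n) = 2 * n"
proof -
  have "card (vars n) = card (X ` {1..n}) + card (Y ` {1..n})"
    unfolding vars_def by (rule card_Un_disjoint) auto
  also have "\<dots> = 2 * n"
    by (simp add: card_image inj_on_def)
  finally show ?thesis .
qed

lemma xy_ring_simps [simp]:
  "monoid.mult (xy_ring n) = (*)" "one (xy_ring n) = 1"
  "ring.zero (xy_ring n) = 0" "add (xy_ring n) = (+)"
  by (simp_all add: xy_ring_def Let_def)

abbreviation polys :: "nat \<Rightarrow> 'k::field xypoly set" where
  "polys n \<equiv> carrier (xy_ring n)"

lemma in_polys_iff: "p \<in> polys n \<longleftrightarrow> (\<forall>m\<in>Poly_Mapping.keys p. Poly_Mapping.keys m \<subseteq> vars n)"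
  by (simp add: xy_ring_def Let_def vars_def)

lemma polys_add [intro]: "p \<in> polys n \<Longrightarrow> q \<in> polys n \<Longrightarrow> p + q \<in> polys n"
  and polys_mult [intro]: "p \<in> polys n \<Longrightarrow> q \<in> polys n \<Longrightarrow> p * q \<in> polys n"
  and polys_zero [simp]: "0 \<in> polys n"
  and polys_one [simp]: "1 \<in> polys n"
proof -
  interpret cring "xy_ring n :: 'a xypoly ring" by (rule cring_xy_ring)
  show "p \<in> polys n \<Longrightarrow> q \<in> polys n \<Longrightarrow> p + q \<in> polys n" for p q :: "'a xypoly"
    using a_closed[of p q] by simp
  show "p \<in> polys n \<Longrightarrow> q \<in> polys n \<Longrightarrow> p * q \<in> polys n" for p q :: "'a xypoly"
    using m_closed[of p q] by simp
  show "0 \<in> polys n" "1 \<in> polys n"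
    by (simp_all add: in_polys_iff)
qed

lemma polys_const [simp]: "const c \<in> polys n"
  by (auto simp: in_polys_iff)

lemma polys_uminus [intro]: "p \<in> polys n \<Longrightarrow> - p \<in> polys n"
  by (auto simp: in_polys_iff)

lemma polys_diff [intro]: "p \<in> polys n \<Longrightarrow> q \<in> polys n \<Longrightarrow> p - q \<in> polys n"
  using polys_add[of p n "- q"] polys_uminus[of q n] by simp

lemma polys_pvar [simp]: "(pvar v :: 'k::field xypoly) \<in> polys n \<longleftrightarrow> v \<in> vars n"
  by (auto simp: in_polys_iff pvar_def)

lemma polys_mono [simp]: "(monom m :: 'k::field xypoly) \<in> polys n \<longleftrightarrow> Poly_Mapping.keys m \<subseteq> vars n"
  by (auto simp: in_polys_iff)

lemma polys_power [intro]: "p \<in> polys n \<Longrightarrow> p ^ k \<in> polys n"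
  by (induction k) auto

lemma polys_sum [intro]: "(\<And>a. a \<in> A \<Longrightarrow> f a \<in> polys n) \<Longrightarrow> sum f A \<in> polys n"
  by (induction A rule: infinite_finite_induct) auto

lemma polys_carrier_induct [consumes 1, case_names const pvar add mult]:
  assumes "p \<in> polys n"
    and "\<And>c. P (const c)" "\<And>v. v \<in> vars n \<Longrightarrow> P (pvar v)"
    and "\<And>p q. P p \<Longrightarrow> P q \<Longrightarrow> P (p + q)" "\<And>p q. P p \<Longrightarrow> P q \<Longrightarrow> P (p * q)"
  shows "P p"
  using assms polys_induct[of p "vars n" P] by (simp add: in_polys_iff)

lemma subst_in_polys:
  assumes "p \<in> polys n" "\<And>v. v \<in> vars n \<Longrightarrow> F v \<in> polys n"
  shows "subst F p \<in> polys n"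
  using assms(1) by (induction rule: polys_carrier_induct) (auto simp: subst_hom assms(2))

text \<open>Additive inverses come for free, as multiples by the constant -1.\<close>

lemma ideal_xy_ring_iff:
  "ideal I (xy_ring n) \<longleftrightarrow> I \<subseteq> polys n \<and> 0 \<in> I \<and> (\<forall>a\<in>I. \<forall>b\<in>I. a + b \<in> I) \<and>
     (\<forall>a\<in>I. \<forall>c\<in>polys n. c * a \<in> I)" (is "_ \<longleftrightarrow> ?R")
  for I :: "'k::field xypoly set"
proof
  assume "ideal I (xy_ring n)"
  then interpret ideal I "xy_ring n" .
  show ?R
    using a_subset I_l_closed additive_subgroup.zero_closed[OF is_additive_subgroup]
      additive_subgroup.a_closed[OF is_additive_subgroup] by auto
next
  interpret cring "xy_ring n :: 'k xypoly ring" by (rule cring_xy_ring)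
  assume R: ?R
  have minus: "\<ominus>\<^bsub>xy_ring n\<^esub> a = - a" if "a \<in> polys n" for a :: "'k xypoly"
  proof -
    have "- a \<oplus>\<^bsub>xy_ring n\<^esub> a = \<zero>\<^bsub>xy_ring n\<^esub>" by simp
    then show ?thesis using that minus_equality[of "- a" a] polys_uminus[OF that] by simp
  qed
  have neg: "- a \<in> I" if "a \<in> I" for a
  proof -
    have "const (- 1) * a \<in> I" using R that polys_const by blast
    then show ?thesis by (simp add: single_uminus)
  qed
  show "ideal I (xy_ring n)"
  proof (rule idealI)
    show "subgroup I (add_monoid (xy_ring n))"
    proof (rule group.subgroupI)
      show "Group.group (add_monoid (xy_ring n :: 'k xypoly ring))" by (rule a_group)
      show "inv\<^bsub>add_monoid (xy_ring n)\<^esub> a \<in> I" if "a \<in> I" for a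
        using neg[OF that] minus[of a] R that by (auto simp: a_inv_def)
    qed (use R in auto)
    show "x \<otimes>\<^bsub>xy_ring n\<^esub> a \<in> I" if "a \<in> I" "x \<in> polys n" for a x
      using R that by simp
    show "a \<otimes>\<^bsub>xy_ring n\<^esub> x \<in> I" if "a \<in> I" "x \<in> polys n" for a x
      using R that by (simp add: mult.commute)
  qed (rule ring_axioms)
qed

context
  fixes I :: "'k::field xypoly set" and n :: nat
  assumes I: "ideal I (xy_ring n)"
begin

lemma ideal_subset: "a \<in> I \<Longrightarrow> a \<in> polys n"
  and ideal_zero: "0 \<in> I"
  and ideal_add: "a \<in> I \<Longrightarrow> b \<in> I \<Longrightarrow> a + b \<in> I"
  and ideal_mult: "a \<in> I \<Longrightarrow> c \<in> polys n \<Longrightarrow> c * a \<in> I"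
  using I unfolding ideal_xy_ring_iff by blast+

lemma ideal_uminus: "a \<in> I \<Longrightarrow> - a \<in> I"
  using ideal_mult[of a "const (- 1)", OF _ polys_const] by (simp add: single_uminus)

lemma ideal_diff: "a \<in> I \<Longrightarrow> b \<in> I \<Longrightarrow> a - b \<in> I"
  using ideal_add[of a "- b"] ideal_uminus by simp

lemma ideal_add_cancel: "a \<in> I \<Longrightarrow> a + b \<in> I \<Longrightarrow> b \<in> I"
  using ideal_diff[of "a + b" a] by simp

end

lemma primeideal_xy_ring_iff:
  "primeideal P (xy_ring n) \<longleftrightarrow> ideal P (xy_ring n) \<and> 1 \<notin> P \<and>
     (\<forall>a\<in>polys n. \<forall>b\<in>polys n. a * b \<in> P \<longrightarrow> a \<in> P \<or> b \<in> P)"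
  for P :: "'k::field xypoly set"
proof
  assume "primeideal P (xy_ring n)"
  then interpret primeideal P "xy_ring n" .
  have "1 \<notin> P"
    using I_notcarr one_imp_carrier by auto
  then show "ideal P (xy_ring n) \<and> 1 \<notin> P \<and>
     (\<forall>a\<in>polys n. \<forall>b\<in>polys n. a * b \<in> P \<longrightarrow> a \<in> P \<or> b \<in> P)"
    using I_prime is_ideal by auto
next
  assume "ideal P (xy_ring n) \<and> 1 \<notin> P \<and>
     (\<forall>a\<in>polys n. \<forall>b\<in>polys n. a * b \<in> P \<longrightarrow> a \<in> P \<or> b \<in> P)"
  then show "primeideal P (xy_ring n)"
    by (intro primeidealI cring_xy_ring) (auto dest: arg_cong[of _ _ "\<lambda>S. 1 \<in> S"])
qed

definition subst_ker :: "nat \<Rightarrow> (xyvar \<Rightarrow> 'k::field xypoly) \<Rightarrow> 'k xypoly set" where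
  "subst_ker n F = {p \<in> polys n. subst F p = 0}"

text \<open>The substitution takes values in a domain and fixes 1.\<close>

lemma primeideal_subst_ker: "primeideal (subst_ker n F) (xy_ring n)"
  by (auto simp: primeideal_xy_ring_iff ideal_xy_ring_iff subst_ker_def subst_hom)

section \<open>Heights of prime ideals\<close>

text \<open>Each exponent is bounded separately instead of the total degree, so that counting is
  counting points of a box in dimension \<open>2 * n\<close>.\<close>

definition bounded_expos :: "nat \<Rightarrow> nat \<Rightarrow> (xyvar \<Rightarrow>\<^sub>0 nat) set" where
  "bounded_expos n d = {m. Poly_Mapping.keys m \<subseteq> vars n \<and> (\<forall>v. Poly_Mapping.lookup m v \<le> d)}"

definition bounded_polys :: "nat \<Rightarrow> nat \<Rightarrow> 'k::field xypoly set" where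
  "bounded_polys n d = {p. Poly_Mapping.keys p \<subseteq> bounded_expos n d}"

lemma card_bounded_expos: "finite (bounded_expos n d) \<and> card (bounded_expos n d) \<le> (d + 1) ^ (2 * n)"
proof -
  let ?f = "\<lambda>m. restrict (Poly_Mapping.lookup m) (vars n)"
  let ?E = "PiE (vars n) (\<lambda>_. {..d})"
  have inj: "inj_on ?f (bounded_expos n d)"
  proof (rule inj_onI)
    fix a b assume ab: "a \<in> bounded_expos n d" "b \<in> bounded_expos n d" "?f a = ?f b"
    show "a = b"
    proof (rule poly_mapping_eqI)
      fix v
      show "Poly_Mapping.lookup a v = Poly_Mapping.lookup b v"
      proof (cases "v \<in> vars n")
        case True
        then show ?thesis using fun_cong[OF ab(3), of v] by simp
      next
        case False
        then have "v \<notin> Poly_Mapping.keys a" "v \<notin> Poly_Mapping.keys b"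
          using ab by (auto simp: bounded_expos_def)
        then show ?thesis by (simp add: in_keys_iff)
      qed
    qed
  qed
  have sub: "?f ` bounded_expos n d \<subseteq> ?E"
    by (auto simp: bounded_expos_def)
  have fin: "finite ?E"
    by (intro finite_PiE) auto
  have "card (bounded_expos n d) \<le> card ?E"
    using inj sub fin by (rule card_inj_on_le)
  moreover have "card ?E = (d + 1) ^ (2 * n)"
    by (simp add: card_PiE card_vars)
  ultimately show ?thesis
    using inj_on_finite[OF inj sub fin] by simp
qed

lemma bounded_polys_mult:
  assumes "p \<in> bounded_polys n d" "q \<in> bounded_polys n e"
  shows "p * q \<in> bounded_polys n (d + e)"
  unfolding bounded_polys_def
proof (intro CollectI subsetI)
  fix m assume "m \<in> Poly_Mapping.keys (p * q)"
  then obtain a b where m: "m = a + b" and "a \<in> Poly_Mapping.keys p" "b \<in> Poly_Mapping.keys q"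
    using keys_mult[of p q] by blast
  then have "a \<in> bounded_expos n d" "b \<in> bounded_expos n e"
    using assms by (auto simp: bounded_polys_def)
  then show "m \<in> bounded_expos n (d + e)"
    using keys_add[of a b] by (auto simp: bounded_expos_def m lookup_add intro: add_mono)
qed

lemma bounded_polys_one: "1 \<in> bounded_polys n d"
  by (auto simp: bounded_polys_def bounded_expos_def)

lemma bounded_polys_power:
  assumes "p \<in> bounded_polys n d"
  shows "p ^ k \<in> bounded_polys n (d * k)"
  by (induction k) (auto simp: bounded_polys_one intro!: bounded_polys_mult assms)

lemma bounded_polys_mono: "d \<le> e \<Longrightarrow> bounded_polys n d \<subseteq> bounded_polys n e"
  unfolding bounded_polys_def bounded_expos_def by (auto intro: order_trans)

lemma bounded_polys_subset: "p \<in> bounded_polys n d \<Longrightarrow> p \<in> polys n"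
  by (auto simp: bounded_polys_def bounded_expos_def in_polys_iff)

lemma bounded_polys_exists:
  assumes "p \<in> polys n"
  obtains d where "p \<in> bounded_polys n d"
proof -
  have "finite (\<Union>m\<in>Poly_Mapping.keys p. Poly_Mapping.lookup m ` UNIV)"
    using finite_range by (auto simp: Poly_Mapping.range.rep_eq)
  then obtain d where "\<forall>x\<in>(\<Union>m\<in>Poly_Mapping.keys p. Poly_Mapping.lookup m ` UNIV). x \<le> d"
    unfolding finite_nat_set_iff_bounded_le by blast
  then have "p \<in> bounded_polys n d"
    using assms by (auto simp: bounded_polys_def bounded_expos_def in_polys_iff)
  then show ?thesis by (rule that)
qed

text \<open>Linear independence over the field in the quotient by \<open>P\<close>, for a family
  instead of a set: exponent lists will be the indices, and a repeated member counts as a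
  dependence.\<close>

definition indep_mod :: "'k::field xypoly set \<Rightarrow> 'i set \<Rightarrow> ('i \<Rightarrow> 'k xypoly) \<Rightarrow> bool" where
  "indep_mod P I b \<longleftrightarrow> (\<forall>c. (\<Sum>i\<in>I. const (c i) * b i) \<in> P \<longrightarrow> (\<forall>i\<in>I. c i = 0))"

text \<open>The family lies in the span of the monomials from the box, whose number bounds every
  independent set.\<close>

lemma card_indep_bounded_polys:
  fixes b :: "'i \<Rightarrow> 'k::field xypoly"
  assumes I: "finite I" and b: "\<And>i. i \<in> I \<Longrightarrow> b i \<in> bounded_polys n d"
    and indep: "indep_mod {0} I b"
  shows "card I \<le> (d + 1) ^ (2 * n)"
proof -
  interpret vector_space "\<lambda>c (p::'k xypoly). const c * p"
  proof
    fix a b :: 'k and x y :: "'k xypoly"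
    show "const a * (x + y) = const a * x + const a * y" by (simp add: distrib_left)
    show "const (a + b) * x = const a * x + const b * x" by (simp add: single_add distrib_right)
    have "const a * const b = const (a * b)" by (simp add: mult_single)
    then show "const a * (const b * x) = const (a * b) * x" by (simp add: mult.assoc[symmetric])
    show "const 1 * x = x" by simp
  qed
  have inj: "inj_on b I"
  proof (rule inj_onI, rule ccontr)
    fix i j assume ij: "i \<in> I" "j \<in> I" "b i = b j" "i \<noteq> j"
    define c where "c = (\<lambda>k. if k = i then 1 else if k = j then - 1 else (0::'k))"
    have "(\<Sum>k\<in>I. const (c k) * b k) = (\<Sum>k\<in>{i, j}. const (c k) * b k)"
      using ij I by (intro sum.mono_neutral_right) (auto simp: c_def)
    also have "\<dots> = 0"
      using ij by (simp add: c_def single_uminus)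
    finally have "c i = 0"
      using indep ij by (simp add: indep_mod_def)
    then show False by (simp add: c_def)
  qed
  have "independent (b ` I)"
  proof
    assume "dependent (b ` I)"
    then obtain u v where uv: "v \<in> b ` I" "u v \<noteq> 0" "(\<Sum>v\<in>b ` I. const (u v) * v) = 0"
      using dependent_finite[of "b ` I"] I by auto
    then have sum: "(\<Sum>i\<in>I. const (u (b i)) * b i) \<in> {0}"
      by (simp add: sum.reindex[OF inj])
    from indep[unfolded indep_mod_def]
    have "(\<Sum>i\<in>I. const (u (b i)) * b i) \<in> {0} \<longrightarrow> (\<forall>i\<in>I. u (b i) = 0)"
      by (rule spec[where x = "\<lambda>i. u (b i)"])
    then have "\<forall>i\<in>I. u (b i) = 0"
      using sum by (rule mp)
    then show False using uv(1,2) by blast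
  qed
  moreover have "b ` I \<subseteq> span (monom ` bounded_expos n d)"
  proof
    fix p assume "p \<in> b ` I"
    then have p: "Poly_Mapping.keys p \<subseteq> bounded_expos n d"
      using b by (auto simp: bounded_polys_def)
    have "(\<Sum>m\<in>Poly_Mapping.keys p. const (Poly_Mapping.lookup p m) * monom m) \<in> span (monom ` bounded_expos n d)"
    proof (rule span_sum)
      fix m assume "m \<in> Poly_Mapping.keys p"
      then have "monom m \<in> span (monom ` bounded_expos n d)"
        using p by (intro span_base imageI) blast
      then show "const (Poly_Mapping.lookup p m) * monom m \<in> span (monom ` bounded_expos n d)"
        by (rule span_scale)
    qed
    then show "p \<in> span (monom ` bounded_expos n d)"
      using poly_as_sum_of_terms[of "Poly_Mapping.keys p" p] by (simp add: mult_single)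
  qed
  ultimately have "card (b ` I) \<le> card (monom ` bounded_expos n d :: 'k xypoly set)"
    using independent_span_bound[of "monom ` bounded_expos n d" "b ` I"] card_bounded_expos by simp
  also have "\<dots> \<le> card (bounded_expos n d)"
    using card_bounded_expos by (intro card_image_le) blast
  also have "\<dots> \<le> (d + 1) ^ (2 * n)"
    using card_bounded_expos by blast
  finally show ?thesis
    by (simp add: card_image[OF inj])
qed

text \<open>
  Powers of an element of \<open>P - Q\<close> are linearly independent modulo \<open>Q\<close> over any set of
  representatives that meets \<open>P\<close> only in \<open>0\<close>. This is what makes the transcendence degree drop
  along a chain of primes.
\<close>

lemma coeffs_zero_of_sum_powers_in_prime:
  fixes P Q :: "'k::field xypoly set"
  assumes P: "ideal P (xy_ring n)" and Q: "primeideal Q (xy_ring n)"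
    and QP: "Q \<subseteq> P" and f: "f \<in> P" "f \<notin> Q"
  shows "(\<Sum>a\<le>m. g a * f ^ a) \<in> Q \<Longrightarrow> (\<And>a. a \<le> m \<Longrightarrow> g a \<in> polys n) \<Longrightarrow>
    (\<And>a. a \<le> m \<Longrightarrow> g a \<in> P \<Longrightarrow> g a = 0) \<Longrightarrow> a \<le> m \<Longrightarrow> g a = 0"
proof (induction m arbitrary: g a)
  case 0
  then show ?case using QP by auto
next
  case (Suc m)
  have f_poly: "f \<in> polys n" using ideal_subset[OF P] f by blast
  define h where "h = (\<Sum>a\<le>m. g (Suc a) * f ^ a)"
  have h: "h \<in> polys n"
    unfolding h_def by (intro polys_sum polys_mult polys_power f_poly Suc.prems(2)) auto
  have eq: "(\<Sum>a\<le>Suc m. g a * f ^ a) = g 0 + f * h"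
    unfolding sum.atMost_Suc_shift h_def by (simp add: sum_distrib_left ac_simps)
  \<comment> \<open>All summands but \<open>g 0\<close> carry the factor \<open>f\<close> from
    \<open>P\<close>, so \<open>g 0\<close> lies in \<open>P\<close> and vanishes; then
    \<open>f\<close> cancels modulo the prime \<open>Q\<close> and \<open>h\<close> is a shorter
    sum.\<close>
  have "h * f + g 0 \<in> P" using Suc.prems(1) QP unfolding eq by (auto simp: ac_simps)
  then have "g 0 \<in> P"
    using ideal_add_cancel[OF P ideal_mult[OF P f(1) h]] by simp
  then have g0: "g 0 = 0" using Suc.prems(3) by simp
  then have "f * h \<in> Q" using Suc.prems(1) unfolding eq by simp
  then have "h \<in> Q" using Q f f_poly h by (auto simp: primeideal_xy_ring_iff)
  then have "g (Suc a) = 0" if "a \<le> m" for a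
    using Suc.IH[of "\<lambda>a. g (Suc a)" a] Suc.prems that unfolding h_def by simp
  then show ?case using g0 Suc.prems(4) by (cases a) auto
qed

text \<open>Descending from the top, each strict inclusion contributes one element of the larger
  prime outside the smaller. The products of powers of the first \<open>j\<close> of them are
  indexed by their exponent lists, and \<open>D\<close> adds up their degree bounds.\<close>

lemma prime_chain_indep:
  fixes C :: "nat \<Rightarrow> 'k::field xypoly set"
  assumes C: "prime_chain (xy_ring n) k C"
  shows "j \<le> k \<Longrightarrow> \<exists>D. \<forall>m. \<exists>b. (\<forall>l. b l \<in> bounded_polys n (D * m)) \<and>
    indep_mod (C (k - j)) {l. set l \<subseteq> {..m} \<and> length l = j} b"
proof (induction j)
  case 0
  have one: "1 \<notin> C k" and Ck: "ideal (C k) (xy_ring n)"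
    using C by (auto simp: prime_chain_def primeideal_xy_ring_iff)
  \<comment> \<open>A nonzero constant is a unit, so the one-member family \<open>1\<close> is
    independent modulo a proper ideal.\<close>
  have const: "c = 0" if "const c \<in> C k" for c
  proof (rule ccontr)
    assume "c \<noteq> 0"
    then show False
      using one ideal_mult[OF Ck that polys_const, of "1 / c"] by (simp add: mult_single)
  qed
  have "{l. set l \<subseteq> {..m} \<and> length l = 0} = {[]}" for m :: nat
    by auto
  then have "indep_mod (C (k - 0)) {l. set l \<subseteq> {..m} \<and> length l = 0} (\<lambda>_. 1)" for m :: nat
    unfolding indep_mod_def using const by simp
  then show ?case
    using bounded_polys_one by (intro exI[of _ 0] allI exI[of _ "\<lambda>_. 1"]) auto
next
  case (Suc j)
  then obtain D where D: "\<And>m. \<exists>b. (\<forall>l. b l \<in> bounded_polys n (D * m)) \<and>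
    indep_mod (C (k - j)) {l. set l \<subseteq> {..m} \<and> length l = j} b" by auto
  define P Q where "P = C (k - j)" and "Q = C (k - Suc j)"
  have P: "ideal P (xy_ring n)" and Q: "primeideal Q (xy_ring n)" and QP: "Q \<subset> P"
  proof -
    have "Suc (k - Suc j) = k - j" "k - Suc j < k"
      using Suc.prems by auto
    then show "Q \<subset> P" "primeideal Q (xy_ring n)"
      using C unfolding P_def Q_def prime_chain_def by (metis, metis less_imp_le)
    show "ideal P (xy_ring n)"
      using C unfolding P_def prime_chain_def by (metis diff_le_self primeideal_xy_ring_iff)
  qed
  obtain f where f: "f \<in> P" "f \<notin> Q" using QP by blast
  obtain e where e: "f \<in> bounded_polys n e"
    using bounded_polys_exists ideal_subset[OF P f(1)] by blast
  have "\<exists>b. (\<forall>l. b l \<in> bounded_polys n ((D + e) * m)) \<and>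
      indep_mod Q {l. set l \<subseteq> {..m} \<and> length l = Suc j} b" for m
  proof -
    let ?L = "\<lambda>j. {l. set l \<subseteq> {..m} \<and> length l = j}"
    obtain b where b: "\<And>l. b l \<in> bounded_polys n (D * m)" and indep: "indep_mod P (?L j) b"
      using D[of m] unfolding P_def by blast
    \<comment> \<open>The cap \<open>min m\<close> is invisible on the index set; it keeps the
      degree bound valid for every list, also those with a larger head.\<close>
    define b' where "b' l = b (tl l) * f ^ (min m (hd l))" for l
    have "b' l \<in> bounded_polys n ((D + e) * m)" for l
    proof -
      have "b' l \<in> bounded_polys n (D * m + e * min m (hd l))"
        unfolding b'_def by (intro bounded_polys_mult b bounded_polys_power e)
      moreover have "D * m + e * min m (hd l) \<le> (D + e) * m"
        by (simp add: distrib_right)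
      ultimately show ?thesis using bounded_polys_mono by blast
    qed
    moreover have "indep_mod Q (?L (Suc j)) b'"
      unfolding indep_mod_def
    proof (intro allI impI ballI)
      fix c l assume c: "(\<Sum>l\<in>?L (Suc j). const (c l) * b' l) \<in> Q" and l: "l \<in> ?L (Suc j)"
      \<comment> \<open>The coefficient of \<open>f ^ a\<close>. As a combination of the old family
        it lies in \<open>P\<close> only if all its scalars vanish.\<close>
      define g where "g a = (\<Sum>l\<in>?L j. const (c (a # l)) * b l)" for a
      have L: "?L (Suc j) = (\<lambda>(a, l). a # l) ` ({..m} \<times> ?L j)"
        by (auto simp: length_Suc_conv image_iff)
      have inj: "inj_on (\<lambda>(a, l). a # l) ({..m} \<times> ?L j)"
        by (auto simp: inj_on_def)
      have "(\<Sum>l\<in>?L (Suc j). const (c l) * b' l)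
          = (\<Sum>(a, l)\<in>{..m} \<times> ?L j. const (c (a # l)) * b l * f ^ a)"
        unfolding L sum.reindex[OF inj] by (rule sum.cong) (auto simp: b'_def min_def ac_simps)
      also have "\<dots> = (\<Sum>a\<le>m. g a * f ^ a)"
        by (simp add: sum.cartesian_product[symmetric] g_def sum_distrib_right)
      finally have "(\<Sum>l\<in>?L (Suc j). const (c l) * b' l) = (\<Sum>a\<le>m. g a * f ^ a)" .
      then have sum: "(\<Sum>a\<le>m. g a * f ^ a) \<in> Q" using c by simp
      have g_poly: "g a \<in> polys n" for a
        unfolding g_def by (intro polys_sum polys_mult polys_const bounded_polys_subset[OF b])
      have g_P: "\<forall>l\<in>?L j. c (a # l) = 0" if "g a \<in> P" for a
        using that indep[unfolded indep_mod_def, THEN spec, of "\<lambda>l. c (a # l)"]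
        unfolding g_def by (rule rev_mp)
      then have g_P': "g a = 0" if "g a \<in> P" for a
        using that unfolding g_def by (intro sum.neutral) auto
      obtain a l' where l': "l = a # l'" "a \<le> m" "l' \<in> ?L j"
        using l unfolding L by auto
      have "g a = 0"
        using coeffs_zero_of_sum_powers_in_prime[OF P Q _ f sum] QP g_poly g_P' l'(2) by blast
      then show "c l = 0"
        using g_P[of a] l' ideal_zero[OF P] by simp
    qed
    ultimately show ?thesis by blast
  qed
  then show ?case unfolding Q_def by blast
qed

text \<open>For \<open>k > 2 * n\<close> the \<open>(m + 1) ^ k\<close> independent products outgrow
  the \<open>(D * m + 1) ^ (2 * n)\<close> monomials that could span them.\<close>

lemma prime_chain_length_le:
  fixes C :: "nat \<Rightarrow> 'k::field xypoly set"
  assumes C: "prime_chain (xy_ring n) k C"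
  shows "k \<le> 2 * n"
proof (rule ccontr)
  assume "\<not> k \<le> 2 * n"
  then have k: "2 * n + 1 \<le> k" by simp
  obtain D where D: "\<And>m. \<exists>b. (\<forall>l. b l \<in> bounded_polys n (D * m)) \<and>
      indep_mod (C 0) {l. set l \<subseteq> {..m} \<and> length l = k} b"
    using prime_chain_indep[OF C, of k] by auto
  \<comment> \<open>Exactly the factor lost in estimating \<open>D * m + 1\<close> by
    \<open>(D + 1) * (m + 1)\<close>; a single extra power of \<open>m + 1\<close> then exceeds
    it.\<close>
  define m where "m = (D + 1) ^ (2 * n)"
  obtain b where b: "\<And>l. b l \<in> bounded_polys n (D * m)"
      "indep_mod (C 0) {l. set l \<subseteq> {..m} \<and> length l = k} b"
    using D by blast
  have "0 \<in> C 0"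
    using C ideal_zero by (auto simp: prime_chain_def primeideal_xy_ring_iff)
  then have "indep_mod {0} {l. set l \<subseteq> {..m} \<and> length l = k} b"
    using b(2) by (simp add: indep_mod_def)
  then have "card {l. set l \<subseteq> {..m} \<and> length l = k} \<le> (D * m + 1) ^ (2 * n)"
    using b(1) by (intro card_indep_bounded_polys finite_lists_length_eq) auto
  then have "(m + 1) ^ k \<le> (D * m + 1) ^ (2 * n)"
    by (simp add: card_lists_length_eq)
  also have "\<dots> \<le> ((D + 1) * (m + 1)) ^ (2 * n)"
    by (intro power_mono) auto
  also have "\<dots> = m * (m + 1) ^ (2 * n)"
    unfolding power_mult_distrib m_def[symmetric] ..
  also have "\<dots> < (m + 1) ^ (2 * n + 1)"
    by simp
  also have "\<dots> \<le> (m + 1) ^ k"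
    using k by (intro power_increasing) auto
  finally show False by simp
qed

text \<open>Chains with both ends visible and the intermediate primes hidden, so that segments can
  be concatenated.\<close>

inductive prime_steps :: "('a, 'm) ring_scheme \<Rightarrow> nat \<Rightarrow> 'a set \<Rightarrow> 'a set \<Rightarrow> bool" for R where
  prime_steps_refl: "primeideal P R \<Longrightarrow> prime_steps R 0 P P"
| prime_steps_step: "prime_steps R k P Q \<Longrightarrow> primeideal Q' R \<Longrightarrow> Q \<subset> Q' \<Longrightarrow> prime_steps R (Suc k) P Q'"

lemma prime_steps_trans:
  "prime_steps R l Q Q' \<Longrightarrow> prime_steps R k P Q \<Longrightarrow> prime_steps R (k + l) P Q'"
  by (induction rule: prime_steps.induct) (auto intro: prime_steps_step)

lemma prime_chain_prime_steps:
  "prime_steps R l P Q \<Longrightarrow> prime_chain R k C \<Longrightarrow> C k = P \<Longrightarrow>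
    \<exists>C'. prime_chain R (k + l) C' \<and> C' (k + l) = Q"
proof (induction arbitrary: C rule: prime_steps.induct)
  case (prime_steps_refl P)
  then show ?case by auto
next
  case (prime_steps_step l P Q Q')
  then obtain C' where C': "prime_chain R (k + l) C'" "C' (k + l) = Q" by blast
  have "prime_chain R (k + Suc l) (C'(k + Suc l := Q'))"
    using C' prime_steps_step.hyps by (auto simp: prime_chain_def less_Suc_eq le_Suc_eq)
  then show ?case by (intro exI[of _ "C'(k + Suc l := Q')"] conjI) (simp_all del: add_Suc_right fun_upd_apply add: fun_upd_same)
qed

lemma prime_steps_imp_prime_chain:
  assumes "prime_steps R k P Q"
  shows "\<exists>C. prime_chain R k C \<and> C k = Q"
proof -
  have "primeideal P R"
    using assms by (induction rule: prime_steps.induct) auto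
  then have "prime_chain R 0 (\<lambda>_. P)"
    by (simp add: prime_chain_def)
  from prime_chain_prime_steps[OF assms this] show ?thesis by simp
qed

text \<open>A chain to \<open>P\<close> longer than \<open>h\<close>, continued by the
  \<open>d\<close> steps above \<open>P\<close>, would exceed the maximal length
  \<open>2 * n\<close>.\<close>

lemma ideal_height_eqI:
  fixes P :: "'k::field xypoly set"
  assumes lower: "prime_steps (xy_ring n) h P0 P" and upper: "prime_steps (xy_ring n) d P P1"
    and hd: "h + d = 2 * n"
  shows "ideal_height (xy_ring n) P = enat h"
proof (rule antisym)
  show "ideal_height (xy_ring n) P \<le> enat h"
    unfolding ideal_height_def
  proof (rule Sup_least, clarify)
    fix k C assume "prime_chain (xy_ring n) k C" "P = C k"
    then have "k + d \<le> 2 * n"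
      using prime_chain_prime_steps[OF upper] prime_chain_length_le by metis
    then show "enat k \<le> enat h" using hd by simp
  qed
  show "enat h \<le> ideal_height (xy_ring n) P"
    unfolding ideal_height_def
    using prime_steps_imp_prime_chain[OF lower] by (intro Sup_upper) auto
qed

section \<open>Ideals of cluster graphs are prime\<close>

definition minor :: "nat \<Rightarrow> nat \<Rightarrow> 'k::field xypoly" where
  "minor i j = pvar (X i) * pvar (Y j) - pvar (X j) * pvar (Y i)"

lemma pvar_nonzero [simp]: "pvar v \<noteq> (0 :: 'k::field xypoly)"
  unfolding pvar_def by (metis lookup_single_eq lookup_zero zero_neq_one)

text \<open>The last two identities expand a vanishing 3 by 3 determinant with a repeated row. They
  are what Ohtani's lemma needs for the edges added by filling.\<close>

lemma minor_same [simp]: "minor i i = 0"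
  and minor_swap: "minor j i = - minor i j"
  and X_mult_minor: "pvar (X v) * minor i j = pvar (X i) * minor v j - pvar (X j) * minor v i"
  and Y_mult_minor: "pvar (Y v) * minor i j = pvar (Y i) * minor v j - pvar (Y j) * minor v i"
  by (simp_all add: minor_def algebra_simps)

text \<open>\<open>E\<close> may be an edge relation or a whole equivalence: diagonal pairs
  contribute 0 and reversed pairs only a sign.\<close>

definition gens :: "nat set \<Rightarrow> nat rel \<Rightarrow> 'k::field xypoly set" where
  "gens T E = {pvar (X i) | i. i \<in> T} \<union> {pvar (Y i) | i. i \<in> T} \<union> {minor i j | i j. (i, j) \<in> E}"

definition edge_ideal :: "nat \<Rightarrow> nat set \<Rightarrow> nat rel \<Rightarrow> 'k::field xypoly set" where
  "edge_ideal n T E = Idl\<^bsub>xy_ring n\<^esub> (gens T E)"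

lemma gens_subset_iff:
  "gens T E \<subseteq> I \<longleftrightarrow> (\<forall>i\<in>T. pvar (X i) \<in> I \<and> pvar (Y i) \<in> I) \<and> (\<forall>(i, j)\<in>E. minor i j \<in> I)"
  unfolding gens_def by auto blast

lemma minor_in_polys: "i \<in> {1..n} \<Longrightarrow> j \<in> {1..n} \<Longrightarrow> minor i j \<in> polys n"
  unfolding minor_def by (intro polys_diff polys_mult) auto

lemma gens_subset_polys:
  assumes "T \<subseteq> {1..n}" "E \<subseteq> Id \<union> {1..n} \<times> {1..n}"
  shows "gens T E \<subseteq> polys n"
proof -
  have "minor i j \<in> polys n" if "(i, j) \<in> E" for i j
    using assms(2) that minor_in_polys[of i n j] by (cases "i = j") auto
  then show ?thesis
    using assms(1) unfolding gens_subset_iff by auto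
qed

lemma ideal_edge_ideal:
  assumes "T \<subseteq> {1..n}" "E \<subseteq> Id \<union> {1..n} \<times> {1..n}"
  shows "ideal (edge_ideal n T E) (xy_ring n)"
  unfolding edge_ideal_def
  by (intro ring.genideal_ideal cring.axioms(1) cring_xy_ring gens_subset_polys assms)

lemma gens_in_edge_ideal:
  assumes "T \<subseteq> {1..n}" "E \<subseteq> Id \<union> {1..n} \<times> {1..n}"
  shows "gens T E \<subseteq> edge_ideal n T E"
  unfolding edge_ideal_def
  by (intro ring.genideal_self cring.axioms(1) cring_xy_ring gens_subset_polys assms)

lemma edge_ideal_minimal:
  assumes "ideal I (xy_ring n)" "gens T E \<subseteq> I"
  shows "edge_ideal n T E \<subseteq> I"
  unfolding edge_ideal_def
  by (intro ring.genideal_minimal cring.axioms(1) cring_xy_ring assms)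

text \<open>
  The ideal of a cluster graph is a kernel: a vertex \<open>b\<close> outside \<open>T\<close> with root \<open>r \<noteq> b\<close> gets the column
  \<open>x\<^sub>b \<cdot> (x\<^sub>r, y\<^sub>r)\<close>, so that the columns of a class become proportional, and the variables of
  the vertices in \<open>T\<close> are sent to \<open>0\<close>.
\<close>

definition root :: "nat rel \<Rightarrow> nat \<Rightarrow> nat" where
  "root R v = (LEAST a. (v, a) \<in> R)"

definition merge :: "nat rel \<Rightarrow> nat set \<Rightarrow> xyvar \<Rightarrow> 'k::field xypoly" where
  "merge R M v = (case v of
     X b \<Rightarrow> if b \<in> M then pvar (X b) * pvar (X (root R b)) else pvar (X b)
   | Y b \<Rightarrow> if b \<in> M then pvar (X b) * pvar (Y (root R b)) else pvar (Y b))"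

definition kill :: "xyvar set \<Rightarrow> xyvar \<Rightarrow> 'k::field xypoly" where
  "kill D v = (if v \<in> D then 0 else pvar v)"

text \<open>\<open>M\<close> and \<open>D\<close> are free so that the kernels for partial merging
  and partial killing can form the chain that determines the height.\<close>

definition cluster_map :: "nat rel \<Rightarrow> nat set \<Rightarrow> xyvar set \<Rightarrow> xyvar \<Rightarrow> 'k::field xypoly" where
  "cluster_map R M D v = subst (kill D) (merge R M v)"

definition nonroots :: "nat rel \<Rightarrow> nat set" where
  "nonroots R = {b. root R b \<noteq> b}"

definition cluster_prime :: "nat \<Rightarrow> nat set \<Rightarrow> nat rel \<Rightarrow> 'k::field xypoly set" where
  "cluster_prime n T R = subst_ker n (cluster_map R (nonroots R) (X ` T \<union> Y ` T))"

text \<open>The equivalence lives on all natural numbers; vertices of \<open>T\<close> and numbers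
  outside \<open>{1..n}\<close> form singleton classes.\<close>

definition cluster :: "nat \<Rightarrow> nat set \<Rightarrow> nat rel \<Rightarrow> bool" where
  "cluster n T R \<longleftrightarrow> equiv UNIV R \<and> T \<subseteq> {1..n} \<and> R \<subseteq> Id \<union> ({1..n} - T) \<times> ({1..n} - T)"

lemma primeideal_cluster_prime: "primeideal (cluster_prime n T R) (xy_ring n)"
  by (simp add: cluster_prime_def primeideal_subst_ker)

lemma root_rel: "equiv UNIV R \<Longrightarrow> (v, root R v) \<in> R"
  unfolding root_def by (rule LeastI[of _ v]) (auto simp: equiv_def refl_on_def)

lemma root_eq_iff: "equiv UNIV R \<Longrightarrow> root R v = root R w \<longleftrightarrow> (v, w) \<in> R"
proof
  assume R: "equiv UNIV R" and eq: "root R v = root R w"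
  then have "(v, root R v) \<in> R" "(root R v, w) \<in> R"
    using root_rel[OF R, of v] root_rel[OF R, of w] by (auto simp: equiv_def sym_def)
  then show "(v, w) \<in> R" using R by (meson equiv_def transE)
next
  assume R: "equiv UNIV R" and "(v, w) \<in> R"
  then have "(v, a) \<in> R \<longleftrightarrow> (w, a) \<in> R" for a
    by (meson equiv_def symE transE)
  then show "root R v = root R w" by (simp add: root_def)
qed

lemma root_idem [simp]: "equiv UNIV R \<Longrightarrow> root R (root R v) = root R v"
  using root_rel root_eq_iff by (metis equiv_def symE)

context
  fixes n :: nat and T :: "nat set" and R :: "nat rel"
  assumes cl: "cluster n T R"
begin

lemma cluster_equiv: "equiv UNIV R" and cluster_T: "T \<subseteq> {1..n}"
  using cl by (auto simp: cluster_def)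

lemma cluster_rel: "(i, j) \<in> R \<Longrightarrow> i = j \<or> i \<in> {1..n} - T \<and> j \<in> {1..n} - T"
  using cl by (auto simp: cluster_def)

lemma cluster_ideal: "ideal (edge_ideal n T R) (xy_ring n)"
  and cluster_gens: "gens T R \<subseteq> edge_ideal n T R"
  using ideal_edge_ideal[of T n R] gens_in_edge_ideal[of T n R] cl
  by (auto simp: cluster_def)

lemma root_in: "b \<in> {1..n} - T \<Longrightarrow> root R b \<in> {1..n} - T"
  using cluster_rel[OF root_rel[OF cluster_equiv]] by metis

lemma cluster_map_simps:
  "cluster_map R (nonroots R) (X ` T \<union> Y ` T) (X b) = (if b \<in> T then 0 else
     if root R b = b then pvar (X b) else pvar (X b) * pvar (X (root R b)))"
  "cluster_map R (nonroots R) (X ` T \<union> Y ` T) (Y b) = (if b \<in> T then 0 else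
     if root R b = b then pvar (Y b) else pvar (X b) * pvar (Y (root R b)))"
proof -
  have "root R b \<notin> T" if "b \<notin> T"
    using that cluster_rel[OF root_rel[OF cluster_equiv], of b] by auto
  then show "cluster_map R (nonroots R) (X ` T \<union> Y ` T) (X b) = (if b \<in> T then 0 else
     if root R b = b then pvar (X b) else pvar (X b) * pvar (X (root R b)))"
  "cluster_map R (nonroots R) (X ` T \<union> Y ` T) (Y b) = (if b \<in> T then 0 else
     if root R b = b then pvar (Y b) else pvar (X b) * pvar (Y (root R b)))"
    by (auto simp: cluster_map_def merge_def nonroots_def kill_def subst_hom)
qed

lemma gens_subset_cluster_prime: "gens T R \<subseteq> cluster_prime n T R"
  unfolding gens_subset_iff
proof (intro conjI ballI, goal_cases)
  case (1 i) then show ?case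
    using cluster_T by (auto simp: cluster_prime_def subst_ker_def cluster_map_simps)
next
  case (2 i) then show ?case
    using cluster_T by (auto simp: cluster_prime_def subst_ker_def cluster_map_simps)
next
  case (3 e)
  obtain i j where e: "e = (i, j)" by force
  then have "i = j \<or> i \<in> {1..n} - T \<and> j \<in> {1..n} - T"
    using 3 cluster_rel by blast
  then have "minor i j \<in> polys n"
    using minor_in_polys by (cases "i = j") auto
  moreover have "root R i = root R j"
    using 3 root_eq_iff[OF cluster_equiv] by (auto simp: e)
  then have "subst (cluster_map R (nonroots R) (X ` T \<union> Y ` T)) (minor i j) = 0"
    by (auto simp: minor_def subst_hom cluster_map_simps)
  ultimately show ?case by (simp add: e cluster_prime_def subst_ker_def)
qed

lemma edge_ideal_subset_cluster_prime: "edge_ideal n T R \<subseteq> cluster_prime n T R"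
  using primeideal_cluster_prime gens_subset_cluster_prime
  by (intro edge_ideal_minimal) (auto simp: primeideal_xy_ring_iff)

text \<open>
  Replacing a factor \<open>x\<^sub>i y\<^sub>j\<close> by \<open>x\<^sub>j y\<^sub>i\<close> with \<open>i\<close>, \<open>j\<close> in the same class moves \<open>m\<close>
  closer to \<open>m'\<close> and does not leave the residue class modulo the ideal.
\<close>

lemma mono_cong_edge_ideal:
  assumes "Poly_Mapping.keys m \<subseteq> X ` ({1..n} - T) \<union> Y ` ({1..n} - T)"
    and "Poly_Mapping.keys m' \<subseteq> X ` ({1..n} - T) \<union> Y ` ({1..n} - T)"
    and "\<And>b. b \<in> {1..n} - T \<Longrightarrow> Poly_Mapping.lookup m (X b) + Poly_Mapping.lookup m (Y b)
          = Poly_Mapping.lookup m' (X b) + Poly_Mapping.lookup m' (Y b)"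
    and "\<And>r. (\<Sum>b | b \<in> {1..n} - T \<and> root R b = r. Poly_Mapping.lookup m (X b))
          = (\<Sum>b | b \<in> {1..n} - T \<and> root R b = r. Poly_Mapping.lookup m' (X b))"
  shows "(monom m :: 'k::field xypoly) - monom m' \<in> edge_ideal n T R"
  using assms
\<comment> \<open>Subtraction is truncated, so the measure is the total surplus of the x-exponents
  of \<open>m\<close> over those of \<open>m'\<close>.\<close>
proof (induction "\<Sum>b\<in>{1..n} - T. Poly_Mapping.lookup m (X b) - Poly_Mapping.lookup m' (X b)"
    arbitrary: m rule: less_induct)
  case less
  let ?W = "{1..n} - T"
  let ?a = "\<lambda>b. Poly_Mapping.lookup m (X b)" and ?a' = "\<lambda>b. Poly_Mapping.lookup m' (X b)"
  let ?c = "\<lambda>b. Poly_Mapping.lookup m (Y b)" and ?c' = "\<lambda>b. Poly_Mapping.lookup m' (Y b)"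
  show ?case
  proof (cases "\<forall>b\<in>?W. ?a b = ?a' b")
    case True
    have "m = m'"
    proof (rule poly_mapping_eqI)
      fix v
      show "Poly_Mapping.lookup m v = Poly_Mapping.lookup m' v"
      proof (cases "v \<in> X ` ?W \<union> Y ` ?W")
        case True
        then show ?thesis using \<open>\<forall>b\<in>?W. ?a b = ?a' b\<close> less.prems(3) by fastforce
      next
        case False
        then have "v \<notin> Poly_Mapping.keys m" "v \<notin> Poly_Mapping.keys m'"
          using less.prems(1,2) by blast+
        then show ?thesis by (simp add: in_keys_iff)
      qed
    qed
    then show ?thesis using ideal_zero[OF cluster_ideal] by simp
  next
    case False
    then obtain b where b: "b \<in> ?W" "?a b \<noteq> ?a' b" by blast
    let ?C = "{b'. b' \<in> ?W \<and> root R b' = root R b}"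
    have sums: "sum ?a ?C = sum ?a' ?C" using less.prems(4) .
    \<comment> \<open>The class totals agree although the exponents differ at \<open>b\<close>, so
      the class contains both a surplus and a deficit.\<close>
    have "\<exists>i\<in>?C. ?a i > ?a' i"
    proof (rule ccontr)
      assume "\<not> ?thesis"
      then have "\<And>i. i \<in> ?C \<Longrightarrow> ?a i \<le> ?a' i" by (auto simp: not_less)
      from sum_mono_inv[OF sums this, of b] b show False by auto
    qed
    then obtain i where i: "i \<in> ?W" "root R i = root R b" "?a i > ?a' i" by auto
    have "\<exists>j\<in>?C. ?a' j > ?a j"
    proof (rule ccontr)
      assume "\<not> ?thesis"
      then have "\<And>i. i \<in> ?C \<Longrightarrow> ?a' i \<le> ?a i" by (auto simp: not_less)
      from sum_mono_inv[OF sums[symmetric] this, of b] b show False by auto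
    qed
    then obtain j where j: "j \<in> ?W" "root R j = root R b" "?a' j > ?a j" by auto
    have ij: "i \<noteq> j" using i j by auto
    \<comment> \<open>With equal column degrees, a deficit of \<open>x_j\<close> in \<open>m\<close>
      means a surplus of \<open>y_j\<close>; hence \<open>x_i y_j\<close> divides
      \<open>m\<close>.\<close>
    have cj: "?c j > 0" using less.prems(3)[OF j(1)] j(3) by linarith
    define u where "u = m - (Poly_Mapping.single (X i) 1 + Poly_Mapping.single (Y j) 1)"
    define m2 where "m2 = u + (Poly_Mapping.single (X j) 1 + Poly_Mapping.single (Y i) 1)"
    have m: "m = u + (Poly_Mapping.single (X i) 1 + Poly_Mapping.single (Y j) 1)"
      by (rule poly_mapping_eqI) (use i(3) cj in \<open>auto simp: u_def lookup_add lookup_minus lookup_single when_def\<close>)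
    have a2: "Poly_Mapping.lookup m2 (X k) = (if k = i then ?a i - 1 else if k = j then ?a j + 1 else ?a k)" for k
      using ij by (auto simp: m2_def u_def lookup_add lookup_minus lookup_single when_def)
    have c2: "Poly_Mapping.lookup m2 (Y k) = (if k = i then ?c i + 1 else if k = j then ?c j - 1 else ?c k)" for k
      using ij by (auto simp: m2_def u_def lookup_add lookup_minus lookup_single when_def)
    have keys2: "Poly_Mapping.keys m2 \<subseteq> X ` ?W \<union> Y ` ?W"
    proof
      fix v assume v: "v \<in> Poly_Mapping.keys m2"
      show "v \<in> X ` ?W \<union> Y ` ?W"
      proof (cases v)
        case (X k)
        then have "k = i \<or> k = j \<or> v \<in> Poly_Mapping.keys m"
          using v a2[of k] by (auto simp: in_keys_iff split: if_splits)
        then show ?thesis using X i(1) j(1) less.prems(1) by blast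
      next
        case (Y k)
        then have "k = i \<or> k = j \<or> v \<in> Poly_Mapping.keys m"
          using v c2[of k] by (auto simp: in_keys_iff split: if_splits)
        then show ?thesis using Y i(1) j(1) less.prems(1) by blast
      qed
    qed
    have "(monom m2 :: 'k xypoly) - monom m' \<in> edge_ideal n T R"
    proof (rule less.hyps)
      show "(\<Sum>b\<in>?W. Poly_Mapping.lookup m2 (X b) - ?a' b) < (\<Sum>b\<in>?W. ?a b - ?a' b)"
        using i j ij by (intro sum_strict_mono_ex1) (auto simp: a2 intro!: bexI[of _ i])
      show "Poly_Mapping.keys m2 \<subseteq> X ` ?W \<union> Y ` ?W" by (fact keys2)
      show "Poly_Mapping.keys m' \<subseteq> X ` ?W \<union> Y ` ?W" by (fact less.prems(2))
      show "Poly_Mapping.lookup m2 (X b) + Poly_Mapping.lookup m2 (Y b) = ?a' b + ?c' b"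
        if "b \<in> ?W" for b
        using less.prems(3)[OF that] i(3) cj ij by (auto simp: a2 c2)
      show "(\<Sum>b | b \<in> ?W \<and> root R b = r. Poly_Mapping.lookup m2 (X b))
          = (\<Sum>b | b \<in> ?W \<and> root R b = r. ?a' b)" for r
      proof (cases "r = root R b")
        case True
        have "sum (\<lambda>b. Poly_Mapping.lookup m2 (X b)) ?C
            = (?a i - 1) + (?a j + 1) + sum ?a (?C - {i} - {j})"
          using i j ij by (subst sum.remove[of _ i], simp, simp, subst sum.remove[of _ j]) (auto simp: a2 intro!: sum.cong)
        also have "\<dots> = ?a i + ?a j + sum ?a (?C - {i} - {j})"
          using i(3) by simp
        also have "\<dots> = sum ?a ?C"
          using i j ij by (subst (2) sum.remove[of _ i], simp, simp, subst sum.remove[of "?C - {i}" j]) auto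
        finally show ?thesis using sums True by simp
      next
        case False
        have "(\<Sum>b | b \<in> ?W \<and> root R b = r. Poly_Mapping.lookup m2 (X b))
          = (\<Sum>b | b \<in> ?W \<and> root R b = r. ?a b)"
          using False i(2) j(2) by (intro sum.cong) (auto simp: a2)
        then show ?thesis using less.prems(4) by simp
      qed
    qed
    moreover have "(monom m :: 'k xypoly) - monom m2 \<in> edge_ideal n T R"
    proof -
      have "(monom m :: 'k xypoly) - monom m2 = monom u * minor i j"
        unfolding m m2_def minor_def by (simp add: mono_add pvar_def right_diff_distrib)
      moreover have "(minor i j :: 'k xypoly) \<in> edge_ideal n T R"
        using cluster_gens i(2) j(2) root_eq_iff[OF cluster_equiv, of i j]
        unfolding gens_subset_iff by fastforce
      moreover have "Poly_Mapping.keys u \<subseteq> vars n"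
      proof
        fix v assume "v \<in> Poly_Mapping.keys u"
        then have "v \<in> Poly_Mapping.keys m" by (simp add: m in_keys_iff lookup_add)
        then show "v \<in> vars n" using less.prems(1) by (auto simp: vars_def)
      qed
      ultimately show ?thesis
        using ideal_mult[OF cluster_ideal, of "minor i j" "monom u"] by simp
    qed
    ultimately have "(monom m - monom m2) + (monom m2 - monom m' :: 'k xypoly) \<in> edge_ideal n T R"
      using ideal_add[OF cluster_ideal] by blast
    then show ?thesis by simp
  qed
qed

text \<open>For a variable that is not killed, its image under the substitution is a monomial with
  this exponent; \<open>cluster_expo\<close> extends it additively to monomials.\<close>

definition img_expo :: "xyvar \<Rightarrow> (xyvar \<Rightarrow>\<^sub>0 nat)" where
  "img_expo v = (case v of
     X b \<Rightarrow> if root R b = b then Poly_Mapping.single (X b) 1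
       else Poly_Mapping.single (X b) 1 + Poly_Mapping.single (X (root R b)) 1
   | Y b \<Rightarrow> if root R b = b then Poly_Mapping.single (Y b) 1
       else Poly_Mapping.single (X b) 1 + Poly_Mapping.single (Y (root R b)) 1)"

definition cluster_expo :: "(xyvar \<Rightarrow>\<^sub>0 nat) \<Rightarrow> (xyvar \<Rightarrow>\<^sub>0 nat)" where
  "cluster_expo m = (\<Sum>v\<in>Poly_Mapping.keys m. \<Sum>i<Poly_Mapping.lookup m v. img_expo v)"

lemma subst_mono_cluster_map:
  "subst_mono (cluster_map R (nonroots R) (X ` T \<union> Y ` T)) m = (
     if Poly_Mapping.keys m \<inter> (X ` T \<union> Y ` T) = {} then monom (cluster_expo m) else 0 :: 'k::field xypoly)"
proof (cases "Poly_Mapping.keys m \<inter> (X ` T \<union> Y ` T) = {}")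
  case True
  have "cluster_map R (nonroots R) (X ` T \<union> Y ` T) v ^ k = (monom (\<Sum>i<k. img_expo v) :: 'k xypoly)"
    if "v \<in> Poly_Mapping.keys m" for v k
  proof -
    have "cluster_map R (nonroots R) (X ` T \<union> Y ` T) v = (monom (img_expo v) :: 'k xypoly)"
      using that True by (cases v) (auto simp: cluster_map_simps img_expo_def pvar_def mult_single)
    then show ?thesis
      using prod_monom[of "\<lambda>_. img_expo v" "{..<k}"] by simp
  qed
  then show ?thesis
    using True by (simp add: subst_mono_def cluster_expo_def prod_monom)
next
  case False
  then obtain v where v: "v \<in> Poly_Mapping.keys m" "v \<in> X ` T \<union> Y ` T" by blast
  then have "cluster_map R (nonroots R) (X ` T \<union> Y ` T) v ^ Poly_Mapping.lookup m v = (0 :: 'k xypoly)"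
    by (auto simp: cluster_map_simps in_keys_iff)
  then show ?thesis
    using False v(1) by (auto simp: subst_mono_def intro!: prod_zero)
qed

lemma lookup_cluster_expo:
  assumes "Poly_Mapping.keys m \<subseteq> X ` ({1..n} - T) \<union> Y ` ({1..n} - T)"
  shows "Poly_Mapping.lookup (cluster_expo m) w =
    (\<Sum>b\<in>{1..n} - T. Poly_Mapping.lookup m (X b) * Poly_Mapping.lookup (img_expo (X b)) w
      + Poly_Mapping.lookup m (Y b) * Poly_Mapping.lookup (img_expo (Y b)) w)"
proof -
  let ?W = "{1..n} - T"
  let ?h = "\<lambda>v. Poly_Mapping.lookup m v * Poly_Mapping.lookup (img_expo v) w"
  have "Poly_Mapping.lookup (cluster_expo m) w = (\<Sum>v\<in>Poly_Mapping.keys m. ?h v)"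
    by (simp add: cluster_expo_def lookup_sum)
  also have "\<dots> = (\<Sum>v\<in>X ` ?W \<union> Y ` ?W. ?h v)"
    using assms by (intro sum.mono_neutral_left) (auto simp: in_keys_iff)
  also have "\<dots> = (\<Sum>v\<in>X ` ?W. ?h v) + (\<Sum>v\<in>Y ` ?W. ?h v)"
    by (rule sum.union_disjoint) auto
  also have "\<dots> = (\<Sum>b\<in>?W. ?h (X b)) + (\<Sum>b\<in>?W. ?h (Y b))"
    by (subst (1 2) sum.reindex) (auto simp: inj_on_def)
  finally show ?thesis by (simp add: sum.distrib)
qed

text \<open>The image exponent determines all that the swaps preserve: at \<open>X b\<close> for a
  non-root it is the degree of column \<open>b\<close>, at \<open>X r\<close> and \<open>Y r\<close>
  for a root it is the total x-degree and y-degree of the class.\<close>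

lemma cluster_expo_eq_imp_cong:
  assumes m: "Poly_Mapping.keys m \<subseteq> X ` ({1..n} - T) \<union> Y ` ({1..n} - T)"
    and m': "Poly_Mapping.keys m' \<subseteq> X ` ({1..n} - T) \<union> Y ` ({1..n} - T)"
    and eq: "cluster_expo m = cluster_expo m'"
  shows "(monom m :: 'k::field xypoly) - monom m' \<in> edge_ideal n T R"
proof -
  let ?W = "{1..n} - T"
  have nonroot: "Poly_Mapping.lookup (cluster_expo m) (X b) = Poly_Mapping.lookup m (X b) + Poly_Mapping.lookup m (Y b)"
    if "Poly_Mapping.keys m \<subseteq> X ` ?W \<union> Y ` ?W" "b \<in> ?W" "root R b \<noteq> b" for b m
  proof -
    have "root R b' \<noteq> b" for b'
      using that(3) root_idem[OF cluster_equiv] by metis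
    then have "Poly_Mapping.lookup (img_expo (X b')) (X b) = (if b' = b then 1 else 0)"
      "Poly_Mapping.lookup (img_expo (Y b')) (X b) = (if b' = b then 1 else 0)" for b'
      using that(3) by (auto simp: img_expo_def lookup_add lookup_single when_def)
    then show ?thesis
      unfolding lookup_cluster_expo[OF that(1)] using that(2)
      by (simp add: sum.distrib if_distrib[of "\<lambda>x. _ * x"] cong: if_cong)
  qed
  have X_sum: "Poly_Mapping.lookup (cluster_expo m) (X r) = (\<Sum>b | b \<in> ?W \<and> root R b = r. Poly_Mapping.lookup m (X b))"
    and Y_sum: "Poly_Mapping.lookup (cluster_expo m) (Y r) = (\<Sum>b | b \<in> ?W \<and> root R b = r. Poly_Mapping.lookup m (Y b))"
    if "Poly_Mapping.keys m \<subseteq> X ` ?W \<union> Y ` ?W" "root R r = r" for r m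
  proof -
    have X: "Poly_Mapping.lookup (img_expo (X b)) (X r) = (if root R b = r then 1 else 0)"
      "Poly_Mapping.lookup (img_expo (Y b)) (X r) = 0"
      "Poly_Mapping.lookup (img_expo (X b)) (Y r) = 0"
      "Poly_Mapping.lookup (img_expo (Y b)) (Y r) = (if root R b = r then 1 else 0)" for b
      using that(2) by (auto simp: img_expo_def lookup_add lookup_single when_def)
    have filter: "(\<Sum>b\<in>?W. f b * (if root R b = r then 1 else 0)) = (\<Sum>b | b \<in> ?W \<and> root R b = r. f b)"
      for f :: "nat \<Rightarrow> nat"
      by (simp add: if_distrib[of "\<lambda>x. _ * x"] sum.inter_filter[symmetric] cong: if_cong)
    show "Poly_Mapping.lookup (cluster_expo m) (X r) = (\<Sum>b | b \<in> ?W \<and> root R b = r. Poly_Mapping.lookup m (X b))"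
      "Poly_Mapping.lookup (cluster_expo m) (Y r) = (\<Sum>b | b \<in> ?W \<and> root R b = r. Poly_Mapping.lookup m (Y b))"
      unfolding lookup_cluster_expo[OF that(1)] X by (simp_all only: filter mult_0_right add_0_right add_0_left)
  qed
  have sums: "(\<Sum>b | b \<in> ?W \<and> root R b = r. Poly_Mapping.lookup m (X b))
      = (\<Sum>b | b \<in> ?W \<and> root R b = r. Poly_Mapping.lookup m' (X b))"
    "(\<Sum>b | b \<in> ?W \<and> root R b = r. Poly_Mapping.lookup m (Y b))
      = (\<Sum>b | b \<in> ?W \<and> root R b = r. Poly_Mapping.lookup m' (Y b))" for r
  proof -
    have empty: "{b. b \<in> ?W \<and> root R b = r} = {}" if "root R r \<noteq> r"
      using that root_idem[OF cluster_equiv] by auto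
    show "(\<Sum>b | b \<in> ?W \<and> root R b = r. Poly_Mapping.lookup m (X b))
      = (\<Sum>b | b \<in> ?W \<and> root R b = r. Poly_Mapping.lookup m' (X b))"
      using X_sum[OF m, of r] X_sum[OF m', of r] eq
      by (cases "root R r = r") (simp, simp only: empty sum.empty not_False_eq_True)
    show "(\<Sum>b | b \<in> ?W \<and> root R b = r. Poly_Mapping.lookup m (Y b))
      = (\<Sum>b | b \<in> ?W \<and> root R b = r. Poly_Mapping.lookup m' (Y b))"
      using Y_sum[OF m, of r] Y_sum[OF m', of r] eq
      by (cases "root R r = r") (simp, simp only: empty sum.empty not_False_eq_True)
  qed
  show ?thesis
  proof (rule mono_cong_edge_ideal[OF m m' _ sums(1)])
    fix b assume b: "b \<in> ?W"
    let ?deg = "\<lambda>m b. Poly_Mapping.lookup m (X b) + Poly_Mapping.lookup m (Y b)"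
    show "?deg m b = ?deg m' b"
    proof (cases "root R b = b")
      case False
      then show ?thesis using nonroot[OF m b] nonroot[OF m' b] eq by simp
    next
      case True
      let ?C = "{b'. b' \<in> ?W \<and> root R b' = b}"
      \<comment> \<open>The column degree of a root is not read off directly; it is the degree of
        the class minus those of its non-roots.\<close>
      have all: "sum (?deg m) ?C = sum (?deg m') ?C"
        using sums[of b] by (simp add: sum.distrib)
      have rest: "sum (?deg m) (?C - {b}) = sum (?deg m') (?C - {b})"
        using nonroot[OF m] nonroot[OF m'] eq by (intro sum.cong) auto
      have "sum f ?C = f b + sum f (?C - {b})" for f :: "nat \<Rightarrow> nat"
        using b True by (intro sum.remove) auto
      from this[of "?deg m"] this[of "?deg m'"] show ?thesis
        using all rest by linarith
    qed
  qed
qed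

text \<open>The number of terms is lowered by subtracting ideal elements. A term with a killed
  variable lies in the ideal; any other needs a second term with the same image to cancel against,
  and the two monomials are congruent.\<close>

lemma cluster_prime_subset_edge_ideal:
  "p \<in> cluster_prime n T R \<Longrightarrow> (p :: 'k::field xypoly) \<in> edge_ideal n T R"
proof (induction "card (Poly_Mapping.keys p)" arbitrary: p rule: less_induct)
  case less
  let ?I = "edge_ideal n T R :: 'k xypoly set" and ?D = "X ` T \<union> Y ` T"
  let ?Phi = "cluster_map R (nonroots R) ?D :: xyvar \<Rightarrow> 'k xypoly"
  have poly: "p \<in> polys n" and ker: "subst ?Phi p = 0"
    using less.prems by (auto simp: cluster_prime_def subst_ker_def)
  show ?case
  proof (cases "p = 0")
    case True
    then show ?thesis using ideal_zero[OF cluster_ideal] by simp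
  next
    case False
    then obtain m where m: "m \<in> Poly_Mapping.keys p" by fastforce
    let ?c = "Poly_Mapping.lookup p m"
    \<comment> \<open>Subtracting such a \<open>q\<close> removes the term \<open>m\<close>, creates
      no new one and stays in the kernel.\<close>
    have reduce: ?thesis
      if q: "q \<in> ?I" and lm: "Poly_Mapping.lookup q m = ?c" and kq: "Poly_Mapping.keys q \<subseteq> Poly_Mapping.keys p" for q
    proof -
      have "q \<in> cluster_prime n T R"
        using q edge_ideal_subset_cluster_prime by blast
      moreover have "ideal (cluster_prime n T R :: 'k xypoly set) (xy_ring n)"
        using primeideal_cluster_prime by (auto simp: primeideal_xy_ring_iff)
      ultimately have "p - q \<in> cluster_prime n T R"
        using less.prems ideal_diff by blast
      moreover have "Poly_Mapping.keys (p - q) \<subseteq> Poly_Mapping.keys p - {m}"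
        using lm kq by (auto simp: in_keys_iff lookup_minus subset_iff)
      then have "card (Poly_Mapping.keys (p - q)) < card (Poly_Mapping.keys p)"
        using m by (intro psubset_card_mono) auto
      ultimately have "p - q \<in> ?I" by (intro less.hyps)
      then show ?thesis using ideal_add[OF cluster_ideal _ q] by fastforce
    qed
    have keys_m: "Poly_Mapping.keys m \<subseteq> vars n"
      using poly m by (auto simp: in_polys_iff)
    show ?thesis
    proof (cases "Poly_Mapping.keys m \<inter> ?D = {}")
      case False
      then obtain v where v: "v \<in> Poly_Mapping.keys m" "v \<in> ?D" by blast
      define u where "u = m - Poly_Mapping.single v 1"
      have u: "m = u + Poly_Mapping.single v 1"
        by (rule poly_mapping_eqI) (use v(1) in \<open>auto simp: u_def lookup_add lookup_minus lookup_single when_def in_keys_iff\<close>)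
      have "pvar v \<in> ?I"
        using v(2) cluster_gens unfolding gens_subset_iff by auto
      moreover have "Poly_Mapping.single u ?c \<in> polys n"
        using keys_m by (auto simp: in_polys_iff u in_keys_iff lookup_add subset_iff)
      ultimately have "Poly_Mapping.single u ?c * pvar v \<in> ?I"
        using ideal_mult[OF cluster_ideal] by blast
      then have "Poly_Mapping.single m ?c \<in> ?I"
        by (simp add: pvar_def mult_single u)
      then show ?thesis by (rule reduce) (use m in auto)
    next
      case True
      have "\<exists>m'\<in>Poly_Mapping.keys p. m' \<noteq> m \<and> Poly_Mapping.keys m' \<inter> ?D = {} \<and> cluster_expo m' = cluster_expo m"
      proof (rule ccontr)
        assume *: "\<not> ?thesis"
        have "0 = Poly_Mapping.lookup (subst ?Phi p) (cluster_expo m)"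
          by (simp add: ker)
        also have "\<dots> = (\<Sum>m'\<in>Poly_Mapping.keys p. if m' = m then ?c else 0)"
          unfolding subst_def lookup_sum subst_mono_cluster_map
          using * True by (intro sum.cong) (auto simp: mult_single lookup_single when_def)
        also have "\<dots> = ?c" using m by simp
        finally show False using m by (simp add: in_keys_iff)
      qed
      then obtain m' where m': "m' \<in> Poly_Mapping.keys p" "m' \<noteq> m" "Poly_Mapping.keys m' \<inter> ?D = {}"
        "cluster_expo m' = cluster_expo m" by blast
      have W: "Poly_Mapping.keys m \<subseteq> X ` ({1..n} - T) \<union> Y ` ({1..n} - T)"
        if "m \<in> Poly_Mapping.keys p" "Poly_Mapping.keys m \<inter> ?D = {}" for m
      proof -
        have "Poly_Mapping.keys m \<subseteq> vars n" using poly that by (auto simp: in_polys_iff)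
        then show ?thesis using that(2) unfolding vars_def by blast
      qed
      have "(monom m :: 'k xypoly) - monom m' \<in> ?I"
        using cluster_expo_eq_imp_cong[OF W[OF m True] W[OF m'(1,3)]] m'(4) by simp
      then have "const ?c * (monom m - monom m') \<in> ?I"
        using ideal_mult[OF cluster_ideal] polys_const by blast
      then show ?thesis
        by (rule reduce) (use m m'(1,2) in \<open>auto simp: right_diff_distrib mult_single lookup_minus lookup_single when_def in_keys_iff split: if_splits\<close>)
    qed
  qed
qed

lemma cluster_prime_eq: "cluster_prime n T R = edge_ideal n T R"
  using cluster_prime_subset_edge_ideal edge_ideal_subset_cluster_prime by blast

lemma X_in_cluster_prime: "i \<in> {1..n} \<Longrightarrow> pvar (X i) \<in> cluster_prime n T R \<longleftrightarrow> i \<in> T"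
  by (auto simp: cluster_prime_def subst_ker_def cluster_map_simps)

end

section \<open>Heights of the primes of cluster graphs\<close>

lemma subst_ker_mono:
  assumes "\<And>v. F' v = subst H (F v)"
  shows "subst_ker n F \<subseteq> subst_ker n F'"
proof -
  have "F' = (\<lambda>v. subst H (F v))" using assms by blast
  then have "subst F' p = subst H (subst F p)" for p
    by (simp add: subst_subst)
  then show ?thesis by (auto simp: subst_ker_def)
qed

lemma minor_eq_0_iff: "(minor i j :: 'k::field xypoly) = 0 \<longleftrightarrow> i = j"
proof
  assume 0: "(minor i j :: 'k xypoly) = 0"
  show "i = j"
  proof (rule ccontr)
    assume "i \<noteq> j"
    then have "subst (\<lambda>v. if v \<in> {X i, Y j} then 1 else 0) (minor i j) = (1 :: 'k xypoly)"
      by (simp add: minor_def subst_hom)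
    then show False by (simp add: 0)
  qed
qed simp

context
  fixes n :: nat and T :: "nat set" and R :: "nat rel"
  assumes cl: "cluster n T R"
begin

abbreviation K :: "nat set \<Rightarrow> xyvar set \<Rightarrow> 'k::field xypoly set" where
  "K M D \<equiv> subst_ker n (cluster_map R M D)"

lemma nonroots_subset: "nonroots R \<subseteq> {1..n} - T"
proof
  fix b assume "b \<in> nonroots R"
  then show "b \<in> {1..n} - T"
    using cluster_rel[OF cl root_rel[OF cluster_equiv[OF cl]], of b] by (simp add: nonroots_def)
qed

lemma finite_nonroots: "finite (nonroots R)"
  using nonroots_subset finite_subset by blast

lemma root_not_nonroot: "root R b \<notin> nonroots R"
  by (simp add: nonroots_def root_idem[OF cluster_equiv[OF cl]])

lemma kill_empty: "cluster_map R M {} = (merge R M :: xyvar \<Rightarrow> 'k::field xypoly)"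
proof -
  have "kill {} = (pvar :: xyvar \<Rightarrow> 'k xypoly)" by (auto simp: kill_def)
  then show ?thesis
    unfolding cluster_map_def by (simp only: subst_pvar_id)
qed

text \<open>Strictness is witnessed by the minor of \<open>b\<close> and its root: the old
  substitution fixes it, the new one makes its columns proportional.\<close>

lemma merge_step:
  assumes "insert b M \<subseteq> nonroots R" "b \<notin> M"
  shows "(K M {} :: 'k::field xypoly set) \<subset> K (insert b M) {}"
proof
  have root: "root R c \<notin> insert b M" for c
    using assms(1) root_not_nonroot by blast
  show "(K M {} :: 'k xypoly set) \<subseteq> K (insert b M) {}"
  proof (rule subst_ker_mono)
    fix v
    show "cluster_map R (insert b M) {} v = (subst (merge R {b}) (cluster_map R M {} v) :: 'k xypoly)"
      using root assms(2) by (cases v) (auto simp: kill_empty merge_def subst_hom)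
  qed
  have b: "b \<noteq> root R b" using root[of b] by auto
  have "b \<in> {1..n} - T" using assms(1) nonroots_subset by blast
  then have in_polys: "(minor b (root R b) :: 'k xypoly) \<in> polys n"
    using minor_in_polys root_in[OF cl] by (metis DiffD1)
  have "(minor b (root R b) :: 'k xypoly) \<in> K (insert b M) {}"
    using in_polys root by (auto simp: subst_ker_def kill_empty merge_def minor_def subst_hom)
  moreover have "(minor b (root R b) :: 'k xypoly) \<notin> K M {}"
  proof -
    have "subst (merge R M) (minor b (root R b)) = (minor b (root R b) :: 'k xypoly)"
      using root assms(2) by (auto simp: merge_def minor_def subst_hom)
    then show ?thesis using b by (simp add: subst_ker_def kill_empty minor_eq_0_iff)
  qed
  ultimately show "(K M {} :: 'k xypoly set) \<noteq> K (insert b M) {}" by blast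
qed

lemma merge_steps:
  assumes "finite M" "M \<subseteq> nonroots R"
  shows "prime_steps (xy_ring n) (card M) (K {} {} :: 'k::field xypoly set) (K M {})"
  using assms
proof (induction M rule: finite_induct)
  case empty
  show ?case by (auto intro: prime_steps_refl primeideal_subst_ker)
next
  case (insert b M)
  then show ?case
    using merge_step[of b M] by (auto intro!: prime_steps_step[where Q = "K M {}"] primeideal_subst_ker)
qed

text \<open>The killed variable itself witnesses strictness. Hence the conditions:
  \<open>Y b\<close> of a non-root does not occur in the images, and \<open>X b\<close> maps to
  \<open>x_b\<close> times the root's variable, which must still be alive.\<close>

lemma kill_steps:
  assumes "finite D" "D \<subseteq> vars n" "D \<inter> D0 = {}" "Y ` nonroots R \<inter> D = {}"
    and "\<And>b. b \<in> nonroots R \<Longrightarrow> X b \<in> D \<Longrightarrow> X (root R b) \<notin> D0 \<union> D"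
  shows "prime_steps (xy_ring n) (card D) (K (nonroots R) D0 :: 'k::field xypoly set) (K (nonroots R) (D0 \<union> D))"
  using assms
proof (induction D rule: finite_induct)
  case empty
  show ?case by (auto intro: prime_steps_refl primeideal_subst_ker)
next
  case (insert v D)
  let ?N = "nonroots R"
  have "(K ?N (D0 \<union> D) :: 'k xypoly set) \<subset> K ?N (D0 \<union> insert v D)"
  proof
    show "(K ?N (D0 \<union> D) :: 'k xypoly set) \<subseteq> K ?N (D0 \<union> insert v D)"
    proof (rule subst_ker_mono)
      have "kill (D0 \<union> insert v D) = (\<lambda>w. subst (kill (D0 \<union> insert v D)) (kill (D0 \<union> D) w :: 'k xypoly))"
        by (auto simp: kill_def)
      then show "cluster_map R ?N (D0 \<union> insert v D) w =
          (subst (kill (D0 \<union> insert v D)) (cluster_map R ?N (D0 \<union> D) w) :: 'k xypoly)" for w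
        unfolding cluster_map_def subst_subst by metis
    qed
    have "(pvar v :: 'k xypoly) \<in> K ?N (D0 \<union> insert v D)"
      using insert.prems by (cases v) (auto simp: subst_ker_def cluster_map_def merge_def kill_def subst_hom)
    moreover have "(pvar v :: 'k xypoly) \<notin> K ?N (D0 \<union> D)"
      using insert.prems insert.hyps
      by (cases v) (auto simp: subst_ker_def cluster_map_def merge_def kill_def subst_hom)
    ultimately show "(K ?N (D0 \<union> D) :: 'k xypoly set) \<noteq> K ?N (D0 \<union> insert v D)" by blast
  qed
  moreover have "prime_steps (xy_ring n) (card D) (K ?N D0 :: 'k xypoly set) (K ?N (D0 \<union> D))"
    using insert.prems by (intro insert.IH) auto
  ultimately show ?case
    using insert.hyps by (auto intro!: prime_steps_step[where Q = "K ?N (D0 \<union> D)"] primeideal_subst_ker)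
qed

definition roots :: "nat set" where
  "roots = {b \<in> {1..n} - T. root R b = b}"

lemma card_roots: "card roots + card (nonroots R) + card T = n"
proof -
  have "{1..n} - T = roots \<union> nonroots R"
    using nonroots_subset by (auto simp: roots_def nonroots_def)
  then have "card ({1..n} - T) = card roots + card (nonroots R)"
    using finite_nonroots by (metis (no_types, lifting) card_Un_disjoint disjoint_iff finite_Diff
      finite_Un finite_atLeastAtMost mem_Collect_eq nonroots_def roots_def)
  moreover have "card ({1..n} - T) = n - card T" "card T \<le> n"
    using cluster_T[OF cl] card_mono[of "{1..n}" T] by (auto simp: card_Diff_subset finite_subset)
  ultimately show ?thesis by simp
qed

text \<open>
  Merging the non-roots one at a time and then killing the variables of \<open>T\<close>, of the non-roots
  and of the roots yields a chain of kernels of the maximal length \<open>2 n\<close> through the prime.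
\<close>

lemma height_cluster_prime:
  "ideal_height (xy_ring n) (cluster_prime n T R :: 'k::field xypoly set) = enat (card (nonroots R) + 2 * card T)"
proof -
  let ?N = "nonroots R" and ?DT = "X ` T \<union> Y ` T"
  let ?DR = "X ` roots \<union> Y ` roots"
  have card_XY: "card (X ` S \<union> Y ` S) = 2 * card S" if "finite S" for S :: "nat set"
  proof -
    have "card (X ` S \<union> Y ` S) = card (X ` S) + card (Y ` S)"
      using that by (intro card_Un_disjoint) auto
    then show ?thesis by (simp add: card_image inj_on_def)
  qed
  have fin: "finite T" "finite roots"
    using cluster_T[OF cl] finite_subset by (auto simp: roots_def)
  have N: "?N \<subseteq> {1..n} - T" by (rule nonroots_subset)
  have s0: "prime_steps (xy_ring n) (card ?N) (K {} {} :: 'k xypoly set) (K ?N {})"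
    by (rule merge_steps[OF finite_nonroots]) simp
  have s1: "prime_steps (xy_ring n) (card ?DT) (K ?N {} :: 'k xypoly set) (K ?N ({} \<union> ?DT))"
    using fin N cluster_T[OF cl] by (intro kill_steps) auto
  \<comment> \<open>Non-roots go before roots: with \<open>x\<close> of the root killed first,
    \<open>X b\<close> would already be in the kernel and give no strict step.\<close>
  have s2: "prime_steps (xy_ring n) (card (X ` ?N)) (K ?N ({} \<union> ?DT) :: 'k xypoly set) (K ?N (({} \<union> ?DT) \<union> X ` ?N))"
  proof (rule kill_steps)
    show "X (root R b) \<notin> ({} \<union> ?DT) \<union> X ` ?N" if "b \<in> ?N" for b
    proof -
      have "root R b \<in> {1..n} - T" using that N root_in[OF cl] by blast
      then show ?thesis using root_not_nonroot by auto
    qed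
  qed (use finite_nonroots N in auto)
  have s3: "prime_steps (xy_ring n) (card ?DR) (K ?N (({} \<union> ?DT) \<union> X ` ?N) :: 'k xypoly set)
      (K ?N ((({} \<union> ?DT) \<union> X ` ?N) \<union> ?DR))"
    using fin by (intro kill_steps) (auto simp: roots_def nonroots_def)
  have lower: "prime_steps (xy_ring n) (card ?N + 2 * card T) (K {} {} :: 'k xypoly set) (cluster_prime n T R)"
    using prime_steps_trans[OF s1 s0] card_XY[OF fin(1)] by (simp add: cluster_prime_def)
  have upper: "prime_steps (xy_ring n) (card ?N + 2 * card roots) (cluster_prime n T R :: 'k xypoly set)
      (K ?N ((({} \<union> ?DT) \<union> X ` ?N) \<union> ?DR))"
    using prime_steps_trans[OF s3 s2] card_XY[OF fin(2)]
    by (simp add: cluster_prime_def card_image inj_on_def)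
  show ?thesis
    using card_roots by (intro ideal_height_eqI[OF lower upper]) simp
qed

lemma minor_in_cluster_prime:
  assumes ij: "i \<in> {1..n}" "j \<in> {1..n}"
  shows "(minor i j :: 'k::field xypoly) \<in> cluster_prime n T R \<longleftrightarrow> i \<in> T \<or> j \<in> T \<or> (i, j) \<in> R"
proof -
  let ?Phi = "cluster_map R (nonroots R) (X ` T \<union> Y ` T) :: xyvar \<Rightarrow> 'k xypoly"
  \<comment> \<open>The column of \<open>b\<close> becomes \<open>s b\<close> times that of its
    root, so a minor becomes a nonzero multiple of the minor of the two roots.\<close>
  define s :: "nat \<Rightarrow> 'k xypoly" where "s b = (if root R b = b then 1 else pvar (X b))" for b
  have s: "s b \<noteq> 0" for b by (simp add: s_def)
  have Phi: "?Phi (X b) = s b * pvar (X (root R b))" "?Phi (Y b) = s b * pvar (Y (root R b))"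
    if "b \<notin> T" for b
    using that by (simp_all add: cluster_map_simps[OF cl] s_def)
  have "subst ?Phi (minor i j) = s i * s j * minor (root R i) (root R j)" if "i \<notin> T" "j \<notin> T"
    using that by (simp add: minor_def subst_hom Phi algebra_simps)
  moreover have "subst ?Phi (minor i j) = (0 :: 'k xypoly)" if "i \<in> T \<or> j \<in> T"
    using that by (auto simp: minor_def subst_hom cluster_map_simps[OF cl])
  ultimately have "subst ?Phi (minor i j) = 0 \<longleftrightarrow> i \<in> T \<or> j \<in> T \<or> root R i = root R j"
    using s by (cases "i \<in> T"; cases "j \<in> T") (simp_all add: minor_eq_0_iff)
  moreover have "(minor i j :: 'k xypoly) \<in> polys n"
    by (rule minor_in_polys[OF ij])
  ultimately show ?thesis
    using root_eq_iff[OF cluster_equiv[OF cl]]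
    by (simp add: cluster_prime_def subst_ker_def)
qed

lemma Y_in_cluster_prime: "i \<in> T \<Longrightarrow> pvar (Y i) \<in> cluster_prime n T R"
  using cluster_T[OF cl] by (auto simp: cluster_prime_def subst_ker_def cluster_map_simps[OF cl])

end

text \<open>It suffices to test generators of the smaller prime; a minor touching \<open>T\<close>
  is absorbed because one of its columns is killed.\<close>

lemma cluster_prime_mono:
  assumes cl: "cluster n T R" "cluster n T' R'" and "T' \<subseteq> T"
    and R': "\<And>i j. (i, j) \<in> R' \<Longrightarrow> i \<notin> T \<Longrightarrow> j \<notin> T \<Longrightarrow> (i, j) \<in> R"
  shows "(cluster_prime n T' R' :: 'k::field xypoly set) \<subseteq> cluster_prime n T R"
  unfolding cluster_prime_eq[OF cl(2)]
proof (rule edge_ideal_minimal)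
  show I: "ideal (cluster_prime n T R :: 'k xypoly set) (xy_ring n)"
    using primeideal_cluster_prime by (auto simp: primeideal_xy_ring_iff)
  show "gens T' R' \<subseteq> (cluster_prime n T R :: 'k xypoly set)"
    unfolding gens_subset_iff
  proof (intro conjI ballI, goal_cases)
    case (1 i)
    then show ?case
      using assms(3) cluster_T[OF cl(1)] X_in_cluster_prime[OF cl(1), of i] by blast
  next
    case (2 i)
    then show ?case
      using assms(3) Y_in_cluster_prime[OF cl(1)] by blast
  next
    case (3 e)
    obtain i j where e: "e = (i, j)" by force
    show ?case
    proof (cases "i = j")
      case True
      then show ?thesis using ideal_zero[OF I] by (simp add: e)
    next
      case False
      then have "i \<in> {1..n}" "j \<in> {1..n}"
        using cluster_rel[OF cl(2), of i j] 3 by (auto simp: e)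
      then show ?thesis
        using minor_in_cluster_prime[OF cl(1)] R' 3 by (auto simp: e)
    qed
  qed
qed

section \<open>Connectivity after deleting vertices\<close>

text \<open>Reflexive everywhere, so deleted vertices are singleton classes, as
  \<open>cluster\<close> requires.\<close>

definition conn :: "'a set \<Rightarrow> 'a rel \<Rightarrow> 'a rel" where
  "conn T E = (E \<inter> (- T) \<times> (- T))\<^sup>*"

lemma conn_refl [simp]: "(v, v) \<in> conn T E"
  by (simp add: conn_def)

lemma conn_edge: "(v, w) \<in> E \<Longrightarrow> v \<notin> T \<Longrightarrow> w \<notin> T \<Longrightarrow> (v, w) \<in> conn T E"
  unfolding conn_def by blast

lemma conn_trans: "(u, v) \<in> conn T E \<Longrightarrow> (v, w) \<in> conn T E \<Longrightarrow> (u, w) \<in> conn T E"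
  unfolding conn_def by (rule rtrancl_trans)

lemma conn_sym: "sym E \<Longrightarrow> (v, w) \<in> conn T E \<Longrightarrow> (w, v) \<in> conn T E"
  unfolding conn_def by (rule symD[OF sym_rtrancl]) (auto simp: sym_def)

lemma conn_mono: "T' \<subseteq> T \<Longrightarrow> E \<subseteq> E' \<Longrightarrow> conn T E \<subseteq> conn T' E'"
  unfolding conn_def by (rule rtrancl_mono) blast

lemma conn_induct [consumes 1, case_names refl step]:
  assumes "(v, w) \<in> conn T E" "P v"
    and "\<And>x y. (v, x) \<in> conn T E \<Longrightarrow> (x, y) \<in> E \<Longrightarrow> x \<notin> T \<Longrightarrow> y \<notin> T \<Longrightarrow> P x \<Longrightarrow> P y"
  shows "P w"
  using assms(1) unfolding conn_def
  by (induction rule: rtrancl_induct) (use assms(2,3) in \<open>auto simp: conn_def\<close>)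

lemma equiv_conn: "sym E \<Longrightarrow> equiv UNIV (conn T E)"
  by (rule equivI) (auto simp: refl_on_def sym_def trans_def intro: conn_sym conn_trans)

lemma conn_delete_simplicial:
  assumes "(i, j) \<in> conn (T - {v}) E" "i \<notin> T" "j \<notin> T" "sym E"
    and clique: "\<And>x y. (v, x) \<in> E \<Longrightarrow> (v, y) \<in> E \<Longrightarrow> x \<notin> T \<Longrightarrow> y \<notin> T \<Longrightarrow> (x, y) \<in> conn T E"
  shows "(i, j) \<in> conn T E"
proof -
  \<comment> \<open>Invariant of a walk that may pass through \<open>v\<close>: while it stands on
    \<open>v\<close>, the only vertex of \<open>T\<close> it can visit, every surviving neighbour of
    \<open>v\<close> is already reached.\<close>
  have "if j \<in> T then \<forall>y. (v, y) \<in> E \<and> y \<notin> T \<longrightarrow> (i, y) \<in> conn T E else (i, j) \<in> conn T E"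
    using assms(1)
  proof (induction rule: conn_induct)
    case refl
    then show ?case using assms(2) by simp
  next
    case (step x y)
    show ?case
    proof (cases "x \<in> T")
      case True
      then have "x = v" using step by blast
      then show ?thesis using step True by (cases "y = v") auto
    next
      case False
      then have ix: "(i, x) \<in> conn T E" using step by simp
      show ?thesis
      proof (cases "y \<in> T")
        case True
        then have "(v, x) \<in> E" using step assms(4) by (auto dest: symD)
        then show ?thesis using True False clique conn_trans[OF ix] by auto
      next
        case y: False
        then show ?thesis using conn_trans[OF ix conn_edge] step.hyps False by auto
      qed
    qed
  qed
  then show ?thesis using assms(3) by simp
qed

section \<open>Associated primes of intersections of primes\<close>

lemma prod_in_primeideal:
  fixes P :: "'k::field xypoly set"
  assumes P: "primeideal P (xy_ring n)" and f: "\<And>x. x \<in> A \<Longrightarrow> f x \<in> polys n"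
    and A: "finite A" and prod: "prod f A \<in> P"
  shows "\<exists>x\<in>A. f x \<in> P"
proof -
  have "(\<forall>x\<in>A. f x \<in> polys n) \<longrightarrow> prod f A \<in> polys n \<and> (prod f A \<in> P \<longrightarrow> (\<exists>x\<in>A. f x \<in> P))"
    using A P by (induction A rule: finite_induct) (auto simp: primeideal_xy_ring_iff)
  then show ?thesis using f prod by blast
qed

lemma prod_in_polys: "(\<And>x. x \<in> A \<Longrightarrow> f x \<in> polys n) \<Longrightarrow> prod f A \<in> polys n"
  by (induction A rule: infinite_finite_induct) auto

lemma prod_in_ideal:
  fixes I :: "'k::field xypoly set"
  assumes I: "ideal I (xy_ring n)" and f: "\<And>x. x \<in> A \<Longrightarrow> f x \<in> polys n"
    and A: "finite A" "x \<in> A" "f x \<in> I"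
  shows "prod f A \<in> I"
proof -
  have "prod f A = prod f (A - {x}) * f x"
    using A by (simp add: prod.remove[of A x] mult.commute)
  moreover have "prod f (A - {x}) \<in> polys n"
    using f by (intro prod_in_polys) auto
  ultimately show ?thesis
    using ideal_mult[OF I A(3)] by simp
qed

text \<open>The colon of the intersection by \<open>a\<close> is the intersection of the members not
  containing \<open>a\<close>, and a prime equal to a finite intersection of primes is one of
  them.\<close>

lemma associated_prime_Inter_iff:
  fixes \<P> :: "'k::field xypoly set set"
  assumes fin: "finite \<P>" and ne: "\<P> \<noteq> {}"
    and pr: "\<And>Q. Q \<in> \<P> \<Longrightarrow> primeideal Q (xy_ring n)"
  shows "associated_prime (xy_ring n) (\<Inter>\<P>) P \<longleftrightarrow> P \<in> \<P> \<and> (\<forall>Q\<in>\<P>. Q \<subseteq> P \<longrightarrow> Q = P)"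
proof
  have ideal: "ideal Q (xy_ring n)" if "Q \<in> \<P>" for Q
    using pr[OF that] by (simp add: primeideal_xy_ring_iff)
  have prime: "b \<in> Q" if "Q \<in> \<P>" "b * a \<in> Q" "a \<notin> Q" "a \<in> polys n" "b \<in> polys n" for Q a b
    using pr[OF that(1)] that(2-) by (auto simp: primeideal_xy_ring_iff)
  {
    assume "associated_prime (xy_ring n) (\<Inter>\<P>) P"
    then obtain a where P: "primeideal P (xy_ring n)" and a: "a \<in> polys n"
      and eq: "P = {r \<in> polys n. r * a \<in> \<Inter>\<P>}"
      by (auto simp: associated_prime_def)
    \<comment> \<open>Otherwise each \<open>Q\<close> without \<open>a\<close> has an element
      outside \<open>P\<close>; their product multiplies \<open>a\<close> into every member, so it
      lies in \<open>P\<close>, against primality.\<close>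
    have "\<exists>Q\<in>\<P>. a \<notin> Q \<and> Q \<subseteq> P"
    proof (rule ccontr)
      assume "\<not> ?thesis"
      then have "\<forall>Q\<in>{Q\<in>\<P>. a \<notin> Q}. \<exists>q. q \<in> Q \<and> q \<notin> P" by blast
      then obtain q where q: "\<And>Q. Q \<in> \<P> \<Longrightarrow> a \<notin> Q \<Longrightarrow> q Q \<in> Q \<and> q Q \<notin> P"
        by (metis (mono_tags, lifting) mem_Collect_eq)
      define b where "b = prod q {Q\<in>\<P>. a \<notin> Q}"
      have q_polys: "q Q \<in> polys n" if "Q \<in> {Q\<in>\<P>. a \<notin> Q}" for Q
        using q[of Q] that ideal[of Q] ideal_subset by blast
      have b: "b \<in> polys n" unfolding b_def by (intro prod_in_polys q_polys)
      have "b * a \<in> Q" if Q: "Q \<in> \<P>" for Q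
      proof (cases "a \<in> Q")
        case True
        then show ?thesis using ideal_mult[OF ideal[OF Q]] b by blast
      next
        case False
        have "b \<in> Q"
          unfolding b_def
          by (rule prod_in_ideal[OF ideal[OF Q] q_polys, where x = Q]) (use fin Q False q in auto)
        then show ?thesis
          using ideal_mult[OF ideal[OF Q] _ a, of b] by (simp add: mult.commute)
      qed
      then have "b \<in> P" unfolding eq using b by blast
      then have "\<exists>Q\<in>{Q\<in>\<P>. a \<notin> Q}. q Q \<in> P"
        using fin P q_polys unfolding b_def by (intro prod_in_primeideal[of P n]) auto
      then show False using q by blast
    qed
    then obtain Q where Q: "Q \<in> \<P>" "a \<notin> Q" "Q \<subseteq> P" by blast
    have sub: "P \<subseteq> Q'" if "Q' \<in> \<P>" "a \<notin> Q'" for Q'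
      using that prime[of Q' _ a] a unfolding eq by auto
    have "P = Q" using sub[OF Q(1,2)] Q(3) by blast
    moreover have "Q' = P" if "Q' \<in> \<P>" "Q' \<subseteq> P" for Q'
      using sub[of Q'] that Q \<open>P = Q\<close> by blast
    ultimately show "P \<in> \<P> \<and> (\<forall>Q\<in>\<P>. Q \<subseteq> P \<longrightarrow> Q = P)" using Q(1) by blast
  }
  {
    assume P: "P \<in> \<P> \<and> (\<forall>Q\<in>\<P>. Q \<subseteq> P \<longrightarrow> Q = P)"
    then have "\<forall>Q\<in>\<P> - {P}. \<exists>q. q \<in> Q \<and> q \<notin> P" by blast
    then obtain q where q: "\<And>Q. Q \<in> \<P> - {P} \<Longrightarrow> q Q \<in> Q \<and> q Q \<notin> P"
      by metis
    \<comment> \<open>This \<open>a\<close> lies in every member except \<open>P\<close>, so its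
      colon ideal is \<open>P\<close>.\<close>
    define a where "a = prod q (\<P> - {P})"
    have q_polys: "q Q \<in> polys n" if "Q \<in> \<P> - {P}" for Q
      using q[of Q] that ideal[of Q] ideal_subset by blast
    have a: "a \<in> polys n" unfolding a_def by (intro prod_in_polys q_polys)
    have aP: "a \<notin> P"
    proof
      assume "a \<in> P"
      then have "\<exists>Q\<in>\<P> - {P}. q Q \<in> P"
        using P pr fin q_polys unfolding a_def by (intro prod_in_primeideal[of P n]) auto
      then show False using q by blast
    qed
    have aQ: "a \<in> Q" if "Q \<in> \<P>" "Q \<noteq> P" for Q
      unfolding a_def
      by (rule prod_in_ideal[OF ideal[OF that(1)] q_polys, where x = Q]) (use fin that q in auto)
    have "P = {r \<in> polys n. r * a \<in> \<Inter>\<P>}"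
    proof (intro equalityI subsetI)
      fix r assume r: "r \<in> P"
      then have rp: "r \<in> polys n" using P ideal ideal_subset by blast
      have "r * a \<in> Q" if "Q \<in> \<P>" for Q
      proof (cases "Q = P")
        case True
        then show ?thesis
          using ideal_mult[OF ideal[OF that] _ a, of r] r by (simp add: mult.commute)
      next
        case False
        then show ?thesis using ideal_mult[OF ideal[OF that] aQ[OF that]] rp by blast
      qed
      then show "r \<in> {r \<in> polys n. r * a \<in> \<Inter>\<P>}" using rp by blast
    next
      fix r assume "r \<in> {r \<in> polys n. r * a \<in> \<Inter>\<P>}"
      then show "r \<in> P" using prime[of P r a] P aP a by blast
    qed
    then show "associated_prime (xy_ring n) (\<Inter>\<P>) P"
      using P pr a by (auto simp: associated_prime_def)
  }
qed

section \<open>The prime decomposition of a binomial edge ideal\<close>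

lemma cluster_conn:
  assumes "sym E" "E \<subseteq> {1..n} \<times> {1..n}" "T \<subseteq> {1..n}"
  shows "cluster n T (conn T E)"
proof -
  have "v = w \<or> v \<in> {1..n} - T \<and> w \<in> {1..n} - T" if "(v, w) \<in> conn T E" for v w
    using that assms(2) by (induction rule: conn_induct) auto
  then have "conn T E \<subseteq> Id \<union> ({1..n} - T) \<times> ({1..n} - T)"
    by (intro subrelI) (metis IdI SigmaI UnI1 UnI2 pair_in_Id_conv)
  then show ?thesis
    unfolding cluster_def using assms(1,3) equiv_conn by blast
qed

text \<open>The difference between \<open>s\<close> and its value at \<open>x_v = y_v = 0\<close>
  belongs to the ideal generated by \<open>x_v\<close> and \<open>y_v\<close>.\<close>

lemma diff_kill_mult_in_ideal:
  fixes I :: "'k::field xypoly set"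
  assumes I: "ideal I (xy_ring n)" and v: "v \<in> {1..n}"
    and w: "pvar (X v) * w \<in> I" "pvar (Y v) * w \<in> I"
    and s: "s \<in> polys n"
  shows "(s - subst (kill {X v, Y v}) s) * w \<in> I"
proof -
  let ?k = "subst (kill {X v, Y v}) :: 'k xypoly \<Rightarrow> _"
  have "(s - ?k s) * w \<in> I \<and> s \<in> polys n"
    using s
  proof (induction rule: polys_carrier_induct)
    case (const c)
    then show ?case using ideal_zero[OF I] by simp
  next
    case (pvar u)
    then show ?case using ideal_zero[OF I] w by (auto simp: kill_def)
  next
    case (add p q)
    then show ?case using ideal_add[OF I, of "(p - ?k p) * w" "(q - ?k q) * w"]
      by (auto simp: subst_hom algebra_simps)
  next
    case (mult p q)
    have "?k q \<in> polys n"
      using mult by (intro subst_in_polys) (auto simp: kill_def)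
    then have "p * ((q - ?k q) * w) + ?k q * ((p - ?k p) * w) \<in> I"
      using mult ideal_add[OF I] ideal_mult[OF I] by blast
    then show ?case using mult by (auto simp: subst_hom algebra_simps)
  qed
  then show ?thesis by blast
qed

definition fill :: "nat \<Rightarrow> nat rel \<Rightarrow> nat rel" where
  "fill v E = E \<union> {(i, j). i \<noteq> j \<and> (v, i) \<in> E \<and> (v, j) \<in> E}"

text \<open>
  Ohtani's lemma. An element of the ideal of the filled graph is changed by setting
  \<open>x\<^sub>v = y\<^sub>v = 0\<close> only by an element of the original ideal, because \<open>x\<^sub>v\<close> and \<open>y\<^sub>v\<close> multiply
  every new generator into the original ideal.
\<close>

lemma edge_ideal_fill_Int:
  fixes g :: "'k::field xypoly"
  assumes T: "T \<subseteq> {1..n}" and E: "E \<subseteq> {1..n} \<times> {1..n}" "sym E" and v: "v \<in> {1..n}"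
    and g1: "g \<in> edge_ideal n T (fill v E)" and g2: "g \<in> edge_ideal n (insert v T) E"
  shows "g \<in> edge_ideal n T E"
proof -
  let ?I = "edge_ideal n T E :: 'k xypoly set"
  let ?k = "subst (kill {X v, Y v}) :: 'k xypoly \<Rightarrow> _"
  have I: "ideal ?I (xy_ring n)" and gens: "gens T E \<subseteq> ?I"
    using T E(1) ideal_edge_ideal[of T n E] gens_in_edge_ideal[of T n E] by blast+
  have X: "pvar (X i) \<in> ?I" and Y: "pvar (Y i) \<in> ?I" if "i \<in> T" for i
    using gens that by (auto simp: gens_subset_iff)
  have m: "minor i j \<in> ?I" if "(i, j) \<in> E" for i j
    using gens that by (auto simp: gens_subset_iff)
  have k_polys: "?k p \<in> polys n" if "p \<in> polys n" for p
    using that by (intro subst_in_polys) (auto simp: kill_def)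
  have I_polys: "p \<in> polys n" if "p \<in> ?I" for p
    using ideal_subset[OF I that] .
  have k_minor: "?k (minor i j) = (if i = v \<or> j = v then 0 else minor i j)" for i j
    by (auto simp: minor_def subst_hom kill_def)
  \<comment> \<open>Setting \<open>x_v = y_v = 0\<close> sends the generators of the ideal with
    \<open>v\<close> deleted to 0 or leaves them unchanged, hence into \<open>?I\<close>.\<close>
  define L where "L = {p \<in> polys n. ?k p \<in> ?I}"
  have "ideal L (xy_ring n)"
    unfolding ideal_xy_ring_iff L_def
    using ideal_zero[OF I] ideal_add[OF I] ideal_mult[OF I] k_polys by (auto simp: subst_hom)
  moreover have "gens (insert v T) E \<subseteq> L"
  proof -
    have "minor i j \<in> L" if "(i, j) \<in> E" for i j
      unfolding L_def using m[OF that] I_polys k_minor ideal_zero[OF I] by simp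
    then show ?thesis
      using X Y I_polys[OF X] I_polys[OF Y] ideal_zero[OF I] v
      by (auto simp: L_def gens_subset_iff kill_def)
  qed
  ultimately have "?k g \<in> ?I"
    using edge_ideal_minimal[of L n "insert v T" E] g2 by (auto simp: L_def)
  \<comment> \<open>The conditions on \<open>x_v\<close> and \<open>y_v\<close> make
    \<open>M\<close> an ideal: \<open>s p - k(s) k(p) = (s - k(s)) p + k(s) (p - k(p))\<close>,
    where \<open>k\<close> is the evaluation.\<close>
  define M where "M = {p \<in> polys n. p - ?k p \<in> ?I \<and> pvar (X v) * p \<in> ?I \<and> pvar (Y v) * p \<in> ?I}"
  have "ideal M (xy_ring n)"
    unfolding ideal_xy_ring_iff
  proof (intro conjI ballI)
    show "M \<subseteq> polys n" "0 \<in> M"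
      using ideal_zero[OF I] by (auto simp: M_def)
    fix p assume p: "p \<in> M"
    show "p + q \<in> M" if q: "q \<in> M" for q
    proof -
      have "(p - ?k p) + (q - ?k q) \<in> ?I" "pvar (X v) * p + pvar (X v) * q \<in> ?I"
        "pvar (Y v) * p + pvar (Y v) * q \<in> ?I"
        using p q ideal_add[OF I] by (auto simp: M_def)
      then show ?thesis using p q by (auto simp: M_def subst_hom algebra_simps)
    qed
    show "s * p \<in> M" if s: "s \<in> polys n" for s
    proof -
      have "(s - ?k s) * p \<in> ?I"
        using p s by (intro diff_kill_mult_in_ideal[OF I v]) (auto simp: M_def)
      moreover have "?k s * (p - ?k p) \<in> ?I"
        using p k_polys[OF s] ideal_mult[OF I] by (auto simp: M_def)
      ultimately have "(s - ?k s) * p + ?k s * (p - ?k p) \<in> ?I"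
        using ideal_add[OF I] by blast
      moreover have "s * (pvar (X v) * p) \<in> ?I" "s * (pvar (Y v) * p) \<in> ?I"
        using p s ideal_mult[OF I] by (auto simp: M_def)
      ultimately show ?thesis using p s by (auto simp: M_def subst_hom algebra_simps)
    qed
  qed
  moreover have "gens T (fill v E) \<subseteq> M"
  proof -
    have from_I: "p \<in> M" if "p \<in> ?I" "?k p \<in> ?I" for p
      using that I_polys ideal_diff[OF I] ideal_mult[OF I] v by (auto simp: M_def)
    have "minor i j \<in> M" if "(i, j) \<in> fill v E" for i j
    proof (cases "(i, j) \<in> E")
      case True
      then show ?thesis
        using m k_minor ideal_zero[OF I] by (intro from_I) auto
    next
      case False
      then have vE: "(v, i) \<in> E" "(v, j) \<in> E" using that by (auto simp: fill_def)
      then have ij: "i \<in> {1..n}" "j \<in> {1..n}" using E by auto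
      have "i \<noteq> v" "j \<noteq> v"
        using False vE E(2) by (auto dest: symD)
      then have "minor i j - ?k (minor i j) \<in> ?I"
        using ideal_zero[OF I] by (simp add: k_minor)
      moreover have "pvar (X v) * minor i j \<in> ?I" "pvar (Y v) * minor i j \<in> ?I"
        unfolding X_mult_minor[of v i j] Y_mult_minor[of v i j]
        using m[OF vE(1)] m[OF vE(2)] ij by (simp_all add: ideal_diff[OF I] ideal_mult[OF I])
      ultimately show ?thesis
        using minor_in_polys[OF ij] by (simp add: M_def)
    qed
    moreover have "pvar (X i) \<in> M" "pvar (Y i) \<in> M" if "i \<in> T" for i
      using that X Y ideal_zero[OF I] by (auto intro!: from_I simp: kill_def)
    ultimately show ?thesis by (auto simp: gens_subset_iff)
  qed
  ultimately have "g - ?k g \<in> ?I"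
    using edge_ideal_minimal[of M n T "fill v E"] g1 by (auto simp: M_def)
  then show ?thesis
    using ideal_add[OF I _ \<open>?k g \<in> ?I\<close>] by fastforce
qed

text \<open>A filled edge joins two neighbours of \<open>v\<close>, which are connected through
  \<open>v\<close> as long as \<open>v\<close> is not deleted.\<close>

lemma conn_fill:
  assumes "v \<notin> T" "sym E"
  shows "conn T (fill v E) = conn T E"
proof
  show "conn T E \<subseteq> conn T (fill v E)"
    by (rule conn_mono) (auto simp: fill_def)
  show "conn T (fill v E) \<subseteq> conn T E"
  proof (rule subrelI)
    fix i j assume "(i, j) \<in> conn T (fill v E)"
    then show "(i, j) \<in> conn T E"
    proof (induction rule: conn_induct)
      case (step x y)
      have "(x, y) \<in> conn T E"
      proof (cases "(x, y) \<in> E")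
        case True
        then show ?thesis using step by (intro conn_edge)
      next
        case False
        then have "(v, x) \<in> E" "(v, y) \<in> E" using step by (auto simp: fill_def)
        then have "(v, x) \<in> conn T E" "(v, y) \<in> conn T E"
          using step assms by (auto intro: conn_edge)
        then show ?thesis by (rule conn_trans[OF conn_sym[OF assms(2)]])
      qed
      with step.IH show ?case by (rule conn_trans)
    qed simp
  qed
qed

text \<open>A non-simplicial vertex is filled and, separately, deleted; both lower the number of
  non-edges, and Ohtani's lemma combines the results. The hypothesis on \<open>g\<close> has to be
  transferred to the filled graph.\<close>

lemma in_edge_ideal_if_in_cluster_primes:
  fixes g :: "'k::field xypoly"
  assumes "T \<subseteq> {1..n}" "E \<subseteq> {1..n} \<times> {1..n}" "sym E" "irrefl E"
    and "\<And>T'. T \<subseteq> T' \<Longrightarrow> T' \<subseteq> {1..n} \<Longrightarrow> g \<in> cluster_prime n T' (conn T' E)"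
  shows "g \<in> edge_ideal n T E"
  using assms
proof (induction "card (({1..n} - T) \<times> ({1..n} - T) - E)" arbitrary: T E rule: less_induct)
  case less
  let ?W = "{1..n} - T"
  note T = less.prems(1) and E = less.prems(2,3,4) and g = less.prems(5)
  show ?case
  proof (cases "\<exists>v i j. v \<in> ?W \<and> i \<in> ?W \<and> j \<in> ?W \<and> (v, i) \<in> E \<and> (v, j) \<in> E \<and> i \<noteq> j \<and> (i, j) \<notin> E")
    case True
    then obtain v i j where v: "v \<in> ?W" and ij: "i \<in> ?W" "j \<in> ?W" "(v, i) \<in> E" "(v, j) \<in> E" "i \<noteq> j" "(i, j) \<notin> E"
      by blast
    have fill: "fill v E \<subseteq> {1..n} \<times> {1..n}" "sym (fill v E)" "irrefl (fill v E)"
      using E by (auto simp: fill_def sym_def irrefl_def)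
    have "g \<in> edge_ideal n T (fill v E)"
    proof (rule less.hyps[OF _ T fill])
      show "card (?W \<times> ?W - fill v E) < card (?W \<times> ?W - E)"
      proof (rule psubset_card_mono)
        have "(i, j) \<in> ?W \<times> ?W - E" "(i, j) \<in> fill v E"
          using ij by (auto simp: fill_def)
        moreover have "E \<subseteq> fill v E" by (auto simp: fill_def)
        ultimately show "?W \<times> ?W - fill v E \<subset> ?W \<times> ?W - E" by blast
      qed simp
      fix T' assume T': "T \<subseteq> T'" "T' \<subseteq> {1..n}"
      \<comment> \<open>If \<open>T'\<close> contains \<open>v\<close>, filling may change its
        components. With \<open>v\<close> put back they agree, and in the filled graph
        \<open>v\<close> is simplicial, so its deletion disconnects nothing.\<close>
      have "g \<in> cluster_prime n (T' - {v}) (conn (T' - {v}) E)"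
        using T' v by (intro g) auto
      then have *: "g \<in> cluster_prime n (T' - {v}) (conn (T' - {v}) (fill v E))"
        using conn_fill[of v "T' - {v}" E] E(2) by simp
      have "cluster_prime n (T' - {v}) (conn (T' - {v}) (fill v E))
          \<subseteq> (cluster_prime n T' (conn T' (fill v E)) :: 'k xypoly set)"
      proof (rule cluster_prime_mono)
        show "cluster n T' (conn T' (fill v E))" "cluster n (T' - {v}) (conn (T' - {v}) (fill v E))"
          using fill T' by (auto intro!: cluster_conn)
        fix x y assume xy: "(x, y) \<in> conn (T' - {v}) (fill v E)" "x \<notin> T'" "y \<notin> T'"
        show "(x, y) \<in> conn T' (fill v E)"
        proof (rule conn_delete_simplicial[OF xy fill(2)])
          fix a b assume ab: "(v, a) \<in> fill v E" "(v, b) \<in> fill v E" "a \<notin> T'" "b \<notin> T'"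
          then have "(v, a) \<in> E" "(v, b) \<in> E"
            using E(3) by (auto simp: fill_def irrefl_def)
          then have "a = b \<or> (a, b) \<in> fill v E"
            by (auto simp: fill_def)
          then show "(a, b) \<in> conn T' (fill v E)"
            using conn_edge[of a b "fill v E" T'] ab by auto
        qed
      qed auto
      then show "g \<in> cluster_prime n T' (conn T' (fill v E))" using * by blast
    qed
    moreover have "g \<in> edge_ideal n (insert v T) E"
    proof (rule less.hyps[OF _ _ E])
      \<comment> \<open>The diagonal pair counts as a non-edge, so the measure drops even if
        \<open>v\<close> is adjacent to all other remaining vertices.\<close>
      have "(v, v) \<notin> E" using E(3) by (auto simp: irrefl_def)
      then show "card (({1..n} - insert v T) \<times> ({1..n} - insert v T) - E) < card (?W \<times> ?W - E)"
        using v by (intro psubset_card_mono psubsetI notI) blast+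
      show "insert v T \<subseteq> {1..n}" using v T by auto
      show "g \<in> cluster_prime n T' (conn T' E)" if "insert v T \<subseteq> T'" "T' \<subseteq> {1..n}" for T'
        using that by (intro g) auto
    qed
    ultimately show ?thesis
      using edge_ideal_fill_Int[OF T E(1,2)] v by blast
  next
    case False
    \<comment> \<open>When all remaining vertices are simplicial, the components are cliques and the
      ideal is already a cluster prime.\<close>
    have conn: "i = j \<or> (i, j) \<in> E" if "(i, j) \<in> conn T E" for i j
      using that
    proof (induction rule: conn_induct)
      case (step x y)
      then consider "i = x" | "(i, x) \<in> E" by blast
      then show ?case
      proof cases
        case 2
        show ?thesis
        proof (cases "i \<in> T")
          case True
          have "i = x" if "(i, x) \<in> conn T E" for x
            using that by (induction rule: conn_induct) (use True in auto)
          then show ?thesis using step by blast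
        next
          case i: False
          have "i \<in> ?W" "x \<in> ?W" "y \<in> ?W" using 2 i step E(1) by auto
          moreover have "(x, i) \<in> E" using 2 E(2) by (auto dest: symD)
          ultimately show ?thesis using False step by blast
        qed
      qed (use step in auto)
    qed simp
    have cl: "cluster n T (conn T E)" using cluster_conn E T by blast
    have I: "ideal (edge_ideal n T E :: 'k xypoly set) (xy_ring n)"
      and gens: "gens T E \<subseteq> (edge_ideal n T E :: 'k xypoly set)"
      using T E(1) ideal_edge_ideal[of T n E] gens_in_edge_ideal[of T n E] by blast+
    have "edge_ideal n T (conn T E) \<subseteq> (edge_ideal n T E :: 'k xypoly set)"
    proof (rule edge_ideal_minimal[OF I])
      show "gens T (conn T E) \<subseteq> (edge_ideal n T E :: 'k xypoly set)"
        using gens conn ideal_zero[OF I] unfolding gens_subset_iff by fastforce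
    qed
    moreover have "g \<in> edge_ideal n T (conn T E)"
      using g[OF subset_refl T] cluster_prime_eq[OF cl] by blast
    ultimately show ?thesis by blast
  qed
qed

lemma edge_ideal_eq_Inter:
  assumes E: "E \<subseteq> {1..n} \<times> {1..n}" "sym E" "irrefl E"
  shows "(edge_ideal n {} E :: 'k::field xypoly set) = (\<Inter>T\<in>Pow {1..n}. cluster_prime n T (conn T E))"
proof
  show "(\<Inter>T\<in>Pow {1..n}. cluster_prime n T (conn T E)) \<subseteq> (edge_ideal n {} E :: 'k xypoly set)"
    using in_edge_ideal_if_in_cluster_primes[of "{}" n E] E by auto
  show "(edge_ideal n {} E :: 'k xypoly set) \<subseteq> (\<Inter>T\<in>Pow {1..n}. cluster_prime n T (conn T E))"
  proof (rule INT_greatest, rule edge_ideal_minimal)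
    fix T assume T: "T \<in> Pow {1..n}"
    show "ideal (cluster_prime n T (conn T E) :: 'k xypoly set) (xy_ring n)"
      using primeideal_cluster_prime by (auto simp: primeideal_xy_ring_iff)
    have "(minor i j :: 'k xypoly) \<in> cluster_prime n T (conn T E)" if "(i, j) \<in> E" for i j
    proof -
      have "i \<in> {1..n}" "j \<in> {1..n}" using that E by auto
      moreover have "cluster n T (conn T E)" using T E by (intro cluster_conn) auto
      ultimately show ?thesis
        using that conn_edge[of i j E T] by (auto simp: minor_in_cluster_prime)
    qed
    then show "gens {} E \<subseteq> (cluster_prime n T (conn T E) :: 'k xypoly set)"
      by (auto simp: gens_subset_iff)
  qed
qed

definition comps :: "'a set \<Rightarrow> 'a rel \<Rightarrow> 'a set \<Rightarrow> 'a set set" where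
  "comps V E T = (\<lambda>v. conn T E `` {v}) ` (V - T)"

text \<open>The cut point property: every \<open>v\<close> in \<open>T\<close> is a cut vertex of
  the graph from which only \<open>T - {v}\<close> is deleted.\<close>

definition cut_point_set :: "'a set \<Rightarrow> 'a rel \<Rightarrow> 'a set \<Rightarrow> bool" where
  "cut_point_set V E T \<longleftrightarrow> T \<subseteq> V \<and>
     (\<forall>v\<in>T. \<exists>x y. (v, x) \<in> E \<and> (v, y) \<in> E \<and> x \<notin> T \<and> y \<notin> T \<and> (x, y) \<notin> conn T E)"

lemma finite_comps: "finite V \<Longrightarrow> finite (comps V E T)"
  by (simp add: comps_def)

lemma conn_class_eq_iff:
  assumes "sym E"
  shows "conn T E `` {v} = conn T E `` {w} \<longleftrightarrow> (v, w) \<in> conn T E"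
proof
  assume "conn T E `` {v} = conn T E `` {w}"
  then show "(v, w) \<in> conn T E" by (metis Image_singleton_iff conn_refl)
next
  assume vw: "(v, w) \<in> conn T E"
  show "conn T E `` {v} = conn T E `` {w}"
    using conn_trans[OF vw] conn_trans[OF conn_sym[OF assms vw]] by blast
qed

lemma conn_outside:
  assumes "(v, w) \<in> conn T E" "E \<subseteq> V \<times> V" "v \<in> V - T"
  shows "w \<in> V - T"
  using assms(1) by (induction rule: conn_induct) (use assms in auto)

lemma num_components_eq_card_comps:
  assumes H: "wf_digraph H" and V: "verts H = V - T" and arcs: "arcs_ends H = E \<inter> (- T) \<times> (- T)"
    and E: "E \<subseteq> V \<times> V" "sym E"
  shows "num_components H = card (comps V E T)"
proof -
  interpret wf_digraph H by (rule H)
  have reach: "u \<rightarrow>\<^sup>*\<^bsub>H\<^esub> w \<longleftrightarrow> (u, w) \<in> conn T E" if u: "u \<in> V - T" for u w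
  proof
    assume "u \<rightarrow>\<^sup>*\<^bsub>H\<^esub> w"
    then show "(u, w) \<in> conn T E"
      unfolding conn_def arcs[symmetric] by (rule reachable_rtranclI)
  next
    assume "(u, w) \<in> conn T E"
    then show "u \<rightarrow>\<^sup>*\<^bsub>H\<^esub> w"
    proof (induction rule: conn_induct)
      case refl
      then show ?case using u V by (simp add: reachable_def)
    next
      case (step x y)
      then have "(x, y) \<in> arcs_ends H" "y \<in> verts H" using arcs V E by auto
      then show ?case
        using step.IH unfolding reachable_def by (auto intro: rtrancl_on_into_rtrancl_on)
    qed
  qed
  have "scc_of v = conn T E `` {v}" if v: "v \<in> V - T" for v
    using reach v conn_outside[OF _ E(1) v] conn_sym[OF E(2)] unfolding scc_of_def by blast
  then have "sccs_verts = comps V E T"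
    unfolding sccs_verts_conv_scc_of V comps_def by (rule image_cong[OF refl])
  then show ?thesis by (simp add: num_components_def)
qed

text \<open>A path through a deleted vertex can be rerouted through a vertex that dominates it.\<close>

lemma conn_delete_dominated:
  assumes "sym E" and xy: "(x, y) \<in> conn {} E" "x \<notin> B" "y \<notin> B"
    and dom: "\<And>v. v \<in> B \<Longrightarrow> \<exists>w. w \<notin> B \<and> (\<forall>u. (v, u) \<in> E \<longrightarrow> u = w \<or> (w, u) \<in> E)"
  shows "(x, y) \<in> conn B E"
proof -
  obtain d where d: "\<And>v. v \<in> B \<Longrightarrow> d v \<notin> B"
    "\<And>v u. v \<in> B \<Longrightarrow> (v, u) \<in> E \<Longrightarrow> u = d v \<or> (d v, u) \<in> E"
    using dom by metis
  define h where "h v = (if v \<in> B then d v else v)" for v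
  have h: "h v \<notin> B" for v using d by (simp add: h_def)
  \<comment> \<open>The retraction \<open>h\<close> maps edges to edges or points; an edge inside
    \<open>B\<close> needs domination once at each end.\<close>
  have edge: "h z = h z' \<or> (h z, h z') \<in> E" if "(z, z') \<in> E" for z z'
  proof -
    have "h z = z' \<or> (h z, z') \<in> E"
      using that d(2) by (auto simp: h_def)
    moreover have "h z = d z' \<or> (d z', h z) \<in> E" if "z' \<in> B"
    proof -
      have "(h z, z') \<in> E" using that h[of z] calculation by auto
      then show ?thesis using d(2)[OF that symD[OF assms(1)]] by blast
    qed
    ultimately show ?thesis
      using symD[OF assms(1), of "h z'" "h z"] by (auto simp: h_def[of z'])
  qed
  have "(x, h y) \<in> conn B E"
    using xy(1)
  proof (induction rule: conn_induct)
    case refl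
    then show ?case using xy by (simp add: h_def)
  next
    case (step z z')
    have "(h z, h z') \<in> conn B E"
      using edge[OF step.hyps(2)] h by (metis conn_edge conn_refl)
    then show ?case using step.IH conn_trans by fastforce
  qed
  then show ?thesis using xy by (simp add: h_def)
qed

section \<open>Closed walks given by vertex lists\<close>

context pair_pre_digraph
begin

lemma cas_vwalk_arcs: "xs \<noteq> [] \<Longrightarrow> cas (hd xs) (vwalk_arcs xs) (last xs)"
  by (induction xs rule: vwalk_arcs.induct) auto

lemma awalk_verts_vwalk_arcs: "xs \<noteq> [] \<Longrightarrow> awalk_verts (hd xs) (vwalk_arcs xs) = xs"
  by (induction xs rule: vwalk_arcs.induct) auto

lemma cycle_vwalk_arcs:
  assumes "distinct (a # xs)" "xs \<noteq> []" "a \<in> pverts G"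
    and "set (vwalk_arcs (a # xs @ [a])) \<subseteq> parcs G"
  shows "cycle (vwalk_arcs (a # xs @ [a]))"
proof -
  have "awalk a (vwalk_arcs (a # xs @ [a])) a"
    using assms cas_vwalk_arcs[of "a # xs @ [a]"] by (simp add: awalk_def)
  moreover have "distinct (tl (awalk_verts a (vwalk_arcs (a # xs @ [a]))))"
    using assms awalk_verts_vwalk_arcs[of "a # xs @ [a]"] by simp
  ultimately show ?thesis
    unfolding cycle_def using assms(2) by (intro exI[of _ a]) (cases xs; simp)
qed

end

lemma set_vwalk_arcs_map_upt: "set (vwalk_arcs (map f [0..<Suc k])) = {(f i, f (Suc i)) | i. i < k}"
proof (induction k)
  case (Suc k)
  have "map f [0..<Suc (Suc k)] = map f [0..<Suc k] @ [f (Suc k)]" by simp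
  then have "vwalk_arcs (map f [0..<Suc (Suc k)]) = vwalk_arcs (map f [0..<Suc k]) @ [(f k, f (Suc k))]"
    by (subst \<open>map f _ = _\<close>, subst vwalk_arcs_append) (auto simp: last_map)
  then show ?case using Suc by (auto simp: less_Suc_eq)
qed simp

section \<open>Separators of generalized block graphs\<close>

locale gen_block_graph =
  fixes G :: "'a pair_pre_digraph"
  assumes gbg: "generalized_block_graph G"
begin

abbreviation V :: "'a set" where "V \<equiv> pverts G"
abbreviation E :: "'a rel" where "E \<equiv> parcs G"

sublocale pair_graph G
  using gbg by (simp add: generalized_block_graph_def)

lemma E_sym: "sym E"
  using pair_sym_arcs by (simp add: symmetric_def)

lemma E_commute: "(u, v) \<in> E \<Longrightarrow> (v, u) \<in> E"
  using E_sym by (rule symD)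

lemma E_subset: "E \<subseteq> V \<times> V"
  using in_arcsD1 in_arcsD2 by auto

lemma E_irrefl: "(v, v) \<notin> E"
  using pair_no_loops by fastforce

lemma finite_V: "finite V"
  by (rule pair_finite_verts)

lemma G_connected: "u \<in> V \<Longrightarrow> v \<in> V \<Longrightarrow> (u, v) \<in> conn {} E" and V_nonempty: "V \<noteq> {}"
proof -
  let ?H = "with_proj (mk_symmetric (with_proj G))"
  have "strongly_connected ?H"
    using gbg by (simp add: generalized_block_graph_def Digraph_Component.connected_def)
  moreover have "verts ?H = V" "arcs_ends ?H = E"
    using E_commute by (auto simp: mk_symmetric_def arcs_ends_def arc_to_ends_def)
  ultimately show "V \<noteq> {}" "u \<in> V \<Longrightarrow> v \<in> V \<Longrightarrow> (u, v) \<in> conn {} E"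
    using reachable_rtranclI[where G = ?H] by (auto simp: strongly_connected_def conn_def)
qed

section \<open>Maximal cliques and their intersections\<close>

definition clique :: "'a set \<Rightarrow> bool" where
  "clique C \<longleftrightarrow> C \<subseteq> V \<and> (\<forall>u\<in>C. \<forall>v\<in>C. u \<noteq> v \<longrightarrow> (u, v) \<in> E)"

abbreviation mc :: "'a set \<Rightarrow> bool" where "mc \<equiv> max_clique G"

lemma mc_iff: "mc F \<longleftrightarrow> clique F \<and> (\<forall>F'. clique F' \<and> F \<subseteq> F' \<longrightarrow> F' = F)"
  by (simp add: max_clique_def clique_def Let_def)

lemma mc_subset_V: "mc F \<Longrightarrow> F \<subseteq> V"
  by (simp add: mc_iff clique_def)

lemma mc_edge: "mc F \<Longrightarrow> u \<in> F \<Longrightarrow> v \<in> F \<Longrightarrow> u \<noteq> v \<Longrightarrow> (u, v) \<in> E"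
  by (simp add: mc_iff clique_def)

lemma mc_maximal: "mc F \<Longrightarrow> mc F' \<Longrightarrow> F \<subseteq> F' \<Longrightarrow> F = F'"
  by (auto simp: mc_iff)

lemma finite_mc: "finite {F. mc F}"
  by (rule finite_subset[of _ "Pow V"]) (auto simp: finite_V dest: mc_subset_V)

lemma clique_extends:
  assumes "clique C"
  obtains F where "mc F" "C \<subseteq> F"
proof -
  let ?S = "{F. clique F \<and> C \<subseteq> F}"
  have "finite ?S"
    by (rule finite_subset[of _ "Pow V"]) (auto simp: finite_V clique_def)
  moreover have "C \<in> ?S" using assms by simp
  ultimately obtain F where F: "F \<in> ?S" "\<forall>F'\<in>?S. F \<subseteq> F' \<longrightarrow> F = F'"
    using finite_has_maximal2[of ?S C] by blast
  then have "mc F" unfolding mc_iff by blast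
  then show ?thesis using F that by blast
qed

lemma vertex_in_mc:
  assumes "v \<in> V"
  obtains F where "mc F" "v \<in> F"
proof -
  have "clique {v}" using assms by (simp add: clique_def)
  then obtain F where "mc F" "{v} \<subseteq> F" by (rule clique_extends)
  then show ?thesis by (intro that[of F]) auto
qed

lemma edge_in_mc:
  assumes "(u, v) \<in> E"
  obtains F where "mc F" "u \<in> F" "v \<in> F"
proof -
  have "clique {u, v}" using assms E_subset E_commute[OF assms] by (auto simp: clique_def)
  then obtain F where "mc F" "{u, v} \<subseteq> F" by (rule clique_extends)
  then show ?thesis by (intro that[of F]) auto
qed

lemma mc_nonempty: "mc F \<Longrightarrow> F \<noteq> {}"
proof
  assume "mc F" "F = {}"
  moreover obtain v where "v \<in> V" using V_nonempty by blast
  moreover then obtain F' where "mc F'" "v \<in> F'" using vertex_in_mc by blast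
  ultimately show False using mc_maximal by blast
qed

lemma mc_Int_eq:
  assumes "mc F1" "mc F2" "mc F3" "F1 \<noteq> F2" "F1 \<noteq> F3" "F2 \<noteq> F3" "F1 \<inter> F2 \<inter> F3 \<noteq> {}"
  shows "F1 \<inter> F2 = F1 \<inter> F3" "F1 \<inter> F3 = F2 \<inter> F3"
  using assms gbg unfolding generalized_block_graph_def by metis+

text \<open>A clique description of the minimal cut sets (\<open>minimal_cut_set_iff\<close>); the
  parameter \<open>t\<close> is then \<open>card (over A)\<close>.\<close>

definition sep :: "'a set \<Rightarrow> bool" where
  "sep A \<longleftrightarrow> A \<noteq> {} \<and> (\<exists>F F'. mc F \<and> mc F' \<and> F \<noteq> F' \<and> A = F \<inter> F')"

definition over :: "'a set \<Rightarrow> 'a set set" where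
  "over A = {F. mc F \<and> A \<subseteq> F}"

lemma finite_over: "finite (over A)"
  using finite_mc by (simp add: over_def)

lemma sep_subset_V: "sep A \<Longrightarrow> A \<subseteq> V"
  using mc_subset_V by (auto simp: sep_def)

lemma sepI: "mc F \<Longrightarrow> mc F' \<Longrightarrow> F \<noteq> F' \<Longrightarrow> v \<in> F \<Longrightarrow> v \<in> F' \<Longrightarrow> sep (F \<inter> F')"
  by (auto simp: sep_def)

text \<open>If \<open>A\<close> is the intersection of \<open>F1\<close> and \<open>F2\<close>, a
  third clique meeting \<open>A\<close> has the same intersection with \<open>F1\<close>, by the
  generalized block condition.\<close>

lemma sep_meets_mc:
  assumes "sep A" "mc F" "F \<inter> A \<noteq> {}"
  shows "F \<in> over A"
proof -
  obtain F1 F2 where F: "mc F1" "mc F2" "F1 \<noteq> F2" "A = F1 \<inter> F2"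
    using assms by (auto simp: sep_def)
  show ?thesis
  proof (cases "F = F1 \<or> F = F2")
    case True
    then show ?thesis using F assms by (auto simp: over_def)
  next
    case False
    have "F1 \<inter> F2 \<inter> F \<noteq> {}" using F(4) assms(3) by blast
    then have "F1 \<inter> F2 = F1 \<inter> F"
      using False by (intro mc_Int_eq(1)[OF F(1,2) assms(2) F(3)]) auto
    then show ?thesis using F assms(2) by (auto simp: over_def)
  qed
qed

lemma over_Int:
  assumes A: "sep A" and FF: "F \<in> over A" "F' \<in> over A" "F \<noteq> F'"
  shows "F \<inter> F' = A"
proof -
  obtain F1 F2 where F: "mc F1" "mc F2" "F1 \<noteq> F2" "A = F1 \<inter> F2" "A \<noteq> {}"
    using A by (auto simp: sep_def)
  have with_F1: "F1 \<inter> F = A" if "F \<in> over A" "F \<noteq> F1" for F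
  proof (cases "F = F2")
    case False
    then show ?thesis using mc_Int_eq(1)[of F1 F2 F] F that by (auto simp: over_def)
  qed (use F in simp)
  show ?thesis
  proof (cases "F = F1 \<or> F' = F1")
    case True
    then show ?thesis using with_F1 FF by blast
  next
    case False
    then have "F1 \<inter> F \<inter> F' \<noteq> {}" using F FF by (auto simp: over_def)
    then have "F1 \<inter> F = F \<inter> F'"
      using mc_Int_eq[of F1 F F'] F(1) FF False by (auto simp: over_def)
    then show ?thesis using with_F1 FF(1) False by simp
  qed
qed

lemma over_two:
  assumes "sep A"
  obtains F F' where "F \<in> over A" "F' \<in> over A" "F \<noteq> F'" "F \<inter> F' = A"
  using assms by (auto simp: sep_def over_def)

lemma card_over_ge_2: "sep A \<Longrightarrow> card (over A) \<ge> 2"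
  using over_two[of A] finite_over[of A] by (metis card_le_Suc0_iff_eq not_less_eq_eq numeral_2_eq_2)

lemma over_not_subset: "sep A \<Longrightarrow> mc F \<Longrightarrow> \<not> F \<subseteq> A"
  using over_two[of A] mc_maximal unfolding over_def
  by (metis (no_types, lifting) inf.cobounded1 mem_Collect_eq order_trans subset_antisym)

text \<open>Cliques over \<open>B\<close> meet \<open>A\<close>, so they lie over \<open>A\<close>,
  and any two of them intersect in exactly \<open>A\<close>. Disjointness of separators is what lets
  sizes and component counts add up.\<close>

lemma sep_eq_if_meet:
  assumes "sep A" "sep B" "A \<inter> B \<noteq> {}"
  shows "A = B"
proof -
  obtain F F' where F: "F \<in> over B" "F' \<in> over B" "F \<noteq> F'" "F \<inter> F' = B"
    using over_two[OF assms(2)] by blast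
  then have "F \<in> over A" "F' \<in> over A"
    using assms sep_meets_mc[OF assms(1)] by (auto simp: over_def)
  then show ?thesis using over_Int[OF assms(1)] F by blast
qed

lemma over_edge:
  assumes "F \<in> over A" "a \<in> A" "x \<in> F" "x \<noteq> a"
  shows "(a, x) \<in> E"
  using assms mc_edge by (auto simp: over_def)

text \<open>
  Among all paths outside \<open>A\<close> between two different cliques over \<open>A\<close> take a shortest one.
  Together with a vertex of \<open>A\<close> it forms a cycle; a chord would shorten the path or, if it
  ends in \<open>A\<close>, yield an intermediate clique over \<open>A\<close> and again a shorter path.
\<close>

lemma over_not_conn:
  assumes A: "sep A" and "F \<in> over A" "F' \<in> over A" "F \<noteq> F'" "x \<in> F - A" "y \<in> F' - A"
  shows "(x, y) \<notin> conn A E"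
proof
  assume conn: "(x, y) \<in> conn A E"
  define R where "R = E \<inter> (- A) \<times> (- A)"
  define P where "P k \<longleftrightarrow> (\<exists>F F' x y. F \<in> over A \<and> F' \<in> over A \<and> F \<noteq> F' \<and> x \<in> F - A \<and> y \<in> F' - A
    \<and> (x, y) \<in> R ^^ k)" for k
  have "\<exists>k. P k"
    using conn assms unfolding P_def conn_def R_def rtrancl_power by blast
  define k where "k = (LEAST k. P k)"
  have "P k" unfolding k_def using \<open>\<exists>k. P k\<close> by (rule LeastI_ex)
  have least: "k \<le> l" if "P l" for l unfolding k_def using that by (rule Least_le)
  obtain F F' x y where F: "F \<in> over A" "F' \<in> over A" "F \<noteq> F'" and xy: "x \<in> F - A" "y \<in> F' - A"
    and "(x, y) \<in> R ^^ k"
    using \<open>P k\<close> unfolding P_def by blast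
  then obtain f where f: "f 0 = x" "f k = y" "\<And>i. i < k \<Longrightarrow> (f i, f (Suc i)) \<in> R"
    unfolding relpow_fun_conv by blast
  have path: "(f i, f j) \<in> R ^^ (j - i)" if "i \<le> j" "j \<le> k" for i j
    unfolding relpow_fun_conv using that f(3)
    by (intro exI[of _ "\<lambda>l. f (i + l)"]) auto
  have fA: "f i \<notin> A" if "i \<le> k" for i
  proof (cases i)
    case 0
    then show ?thesis using f xy by simp
  next
    case (Suc j)
    then show ?thesis using f(3)[of j] that by (auto simp: R_def)
  qed
  have inj: "f i \<noteq> f j" if "i < j" "j \<le> k" for i j
  proof
    assume "f i = f j"
    then have "(f 0, f k) \<in> R ^^ (i + (k - j))"
      unfolding relpow_add using path[of 0 i] path[of j k] that by (intro relcompI[of _ "f j"]) auto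
    then have "P (i + (k - j))"
      unfolding P_def using F xy f by metis
    then show False using least[of "i + (k - j)"] that by simp
  qed
  have chordless: "j = Suc i" if "i < j" "j \<le> k" "(f i, f j) \<in> E" for i j
  proof (rule ccontr)
    assume "j \<noteq> Suc i"
    have "(f i, f j) \<in> R" using that fA by (simp add: R_def)
    then have "(f 0, f k) \<in> R ^^ (Suc i + (k - j))"
      unfolding relpow_add using path[of 0 i] path[of j k] that by (intro relcompI[of _ "f j"] relpow_Suc_I) auto
    then have "P (Suc i + (k - j))"
      unfolding P_def using F xy f by metis
    then show False using least[of "Suc i + (k - j)"] that \<open>j \<noteq> Suc i\<close> by simp
  qed
  obtain a where a: "a \<in> A" using A by (auto simp: sep_def)
  have over_if_adj: "F'' \<in> over A" if "mc F''" "b \<in> F''" "b \<in> A" for F'' b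
    using sep_meets_mc[OF A that(1)] that by blast
  have "k \<noteq> 0"
  proof
    assume "k = 0"
    then have "x \<in> F \<inter> F'" using f xy by auto
    then show False using over_Int[OF A F] xy by blast
  qed
  moreover have "k \<noteq> 1"
  proof
    assume "k = 1"
    then have "(x, y) \<in> E" using f(3)[of 0] f by (auto simp: R_def)
    \<comment> \<open>A clique containing \<open>A\<close>, \<open>x\<close> and \<open>y\<close>
      shares a vertex outside \<open>A\<close> with both \<open>F\<close> and \<open>F'\<close>, so
      it would equal both.\<close>
    have "u = v \<or> (u, v) \<in> E" if "u \<in> A \<union> {x, y}" "v \<in> A \<union> {x, y}" for u v
      using that F xy \<open>(x, y) \<in> E\<close> E_commute mc_edge[of F u v] mc_edge[of F' u v]
      unfolding over_def by blast
    then have "clique (A \<union> {x, y})"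
      using F xy mc_subset_V unfolding clique_def over_def by blast
    then obtain F'' where F'': "mc F''" "A \<union> {x, y} \<subseteq> F''"
      using clique_extends by blast
    then have "F'' \<in> over A" by (auto simp: over_def)
    then have "F'' = F" "F'' = F'"
      using over_Int[OF A _ F(1), of F''] over_Int[OF A _ F(2), of F''] F'' xy by blast+
    then show False using F by simp
  qed
  ultimately have k: "k \<ge> 2" by simp
  \<comment> \<open>The clique through \<open>a\<close> and \<open>f l\<close> differs from
    \<open>F\<close> or from \<open>F'\<close>, so the first or the last piece of the path is a
    shorter example.\<close>
  have not_adj: "(a, f l) \<notin> E" if "0 < l" "l < k" for l
  proof
    assume "(a, f l) \<in> E"
    then obtain F'' where F'': "mc F''" "a \<in> F''" "f l \<in> F''" using edge_in_mc by blast
    then have over: "F'' \<in> over A" using over_if_adj a by blast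
    show False
    proof (cases "F'' = F")
      case True
      then have "P (k - l)"
        unfolding P_def using F F'' over xy f fA[of l] path[of l k] that
        by (intro exI[of _ F] exI[of _ F'] exI[of _ "f l"] exI[of _ y]) auto
      then show False using least[of "k - l"] that by simp
    next
      case False
      then have "P l"
        unfolding P_def using F F'' over xy f fA[of l] path[of 0 l] that
        by (intro exI[of _ F] exI[of _ F''] exI[of _ x] exI[of _ "f l"]) auto
      then show False using least[of l] that by simp
    qed
  qed
  define p where "p = vwalk_arcs (a # map f [0..<Suc k] @ [a])"
  have p: "p = (a, f 0) # vwalk_arcs (map f [0..<Suc k]) @ [(f k, a)]"
    unfolding p_def by (simp add: vwalk_arcs_append hd_map last_map del: upt_Suc)
  have set_p: "set p = {(a, f 0), (f k, a)} \<union> {(f i, f (Suc i)) | i. i < k}"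
    unfolding p by (auto simp: set_vwalk_arcs_map_upt simp del: upt_Suc)
  have ends: "(a, f 0) \<in> E" "(f k, a) \<in> E"
    using over_edge[OF F(1) a] over_edge[OF F(2) a] E_commute f xy a by auto
  have "cycle p"
    unfolding p_def
  proof (rule cycle_vwalk_arcs)
    have "inj_on f {0..<Suc k}"
    proof (rule inj_onI)
      fix i j assume "i \<in> {0..<Suc k}" "j \<in> {0..<Suc k}" "f i = f j"
      then show "i = j" using inj[of i j] inj[of j i] by (cases i j rule: linorder_cases) auto
    qed
    then show "distinct (a # map f [0..<Suc k])"
      using a fA by (auto simp: distinct_map simp del: upt_Suc)
    show "a \<in> V" using a sep_subset_V[OF A] by blast
    show "set (vwalk_arcs (a # map f [0..<Suc k] @ [a])) \<subseteq> E"
      using set_p ends f(3) unfolding p_def R_def by auto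
  qed simp
  \<comment> \<open>The cycle has the \<open>k\<close> arcs of the path and two arcs at
    \<open>a\<close>; this is why \<open>k = 0\<close> and \<open>k = 1\<close> were
    excluded.\<close>
  moreover have "length p \<ge> 4"
  proof -
    have "length (vwalk_arcs (map f [0..<Suc k])) = k"
      using vwalk_length_simp[of "map f [0..<Suc k]"] by (simp add: vwalk_length_def del: upt_Suc vwalk_length_simp)
    then show ?thesis using k by (simp add: p del: upt_Suc)
  qed
  moreover have "chordal G" using gbg by (simp add: generalized_block_graph_def)
  ultimately have "\<exists>u\<in>fst ` set p. \<exists>w\<in>fst ` set p. (u, w) \<in> E \<and> (u, w) \<notin> set p \<and> (w, u) \<notin> set p"
    unfolding chordal_def by simp
  then obtain u w where uw: "u \<in> fst ` set p" "w \<in> fst ` set p" "(u, w) \<in> E" "(u, w) \<notin> set p" "(w, u) \<notin> set p"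
    by blast
  have verts: "\<exists>i\<le>k. u = f i" if "u \<in> fst ` set p" "u \<noteq> a" for u
    using that unfolding set_p by (auto intro: less_imp_le)
  have no_chord_a: "False" if prem: "(a, w) \<in> E" "w \<in> fst ` set p" "(a, w) \<notin> set p" "(w, a) \<notin> set p" for w
  proof -
    have "w \<noteq> a" using prem E_irrefl by blast
    then obtain i where i: "i \<le> k" "w = f i" using verts[OF prem(2)] by blast
    have "(a, f 0) \<in> set p" "(f k, a) \<in> set p" unfolding set_p by simp_all
    then have "i \<noteq> 0" "i \<noteq> k" using prem(3,4) i(2) by metis+
    then show False using not_adj[of i] i prem(1) by simp
  qed
  show False
  proof (cases "u = a \<or> w = a")
    case True
    then show False using no_chord_a[of u] no_chord_a[of w] uw E_commute by blast
  next
    case False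
    then obtain i where i: "i \<le> k" "u = f i" using verts[OF uw(1)] by blast
    obtain j where j: "j \<le> k" "w = f j" using verts[OF uw(2)] False by blast
    note ij = i j
    have "i \<noteq> j" using ij uw E_irrefl by auto
    then consider "j = Suc i" | "i = Suc j"
      using chordless[of i j] chordless[of j i] ij uw(3) E_commute by (metis linorder_neqE_nat)
    then show False using uw ij unfolding set_p by cases auto
  qed
qed

section \<open>Cut sets and component counts\<close>

lemma card_comps_empty: "card (comps V E {}) = 1"
proof -
  obtain v where v: "v \<in> V" using V_nonempty by blast
  have "comps V E {} = (\<lambda>_. conn {} E `` {v}) ` V"
    unfolding comps_def Diff_empty
    by (rule image_cong[OF refl], unfold conn_class_eq_iff[OF E_sym]) (rule G_connected[OF _ v])
  then show ?thesis by (simp add: image_constant[OF v])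
qed

lemma num_components_delete:
  assumes "A \<subseteq> V"
  shows "num_components (with_proj G \<restriction> (V - A)) = card (comps V E A)"
proof (rule num_components_eq_card_comps[OF _ _ _ E_subset E_sym])
  show "wf_digraph (with_proj G \<restriction> (V - A))"
    by (rule wellformed_induce_subgraph)
  show "arcs_ends (with_proj G \<restriction> (V - A)) = E \<inter> (- A) \<times> (- A)"
    using E_subset by (auto simp: induce_subgraph_def arcs_ends_def arc_to_ends_def)
qed simp

lemma num_components_G: "num_components (with_proj G) = 1"
  unfolding card_comps_empty[symmetric]
  by (rule num_components_eq_card_comps[OF _ _ _ E_subset E_sym]) (auto simp: wf_digraph)

lemma cut_set_iff: "cut_set G A \<longleftrightarrow> A \<subseteq> V \<and> card (comps V E A) > 1"
  using num_components_delete[of A] num_components_G by (auto simp: cut_set_def)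

lemma two_comps_iff:
  "card (comps V E A) > 1 \<longleftrightarrow> (\<exists>x\<in>V - A. \<exists>y\<in>V - A. (x, y) \<notin> conn A E)"
proof -
  have "card (comps V E A) > 1 \<longleftrightarrow> \<not> (\<forall>K\<in>comps V E A. \<forall>L\<in>comps V E A. K = L)"
    using card_le_Suc0_iff_eq[OF finite_comps[OF finite_V], of E A] by (simp add: not_le[symmetric])
  then show ?thesis
    unfolding comps_def by (simp add: conn_class_eq_iff[OF E_sym])
qed

lemma over_diff_nonempty:
  assumes "sep A" "F \<in> over A"
  shows "F - A \<noteq> {}"
  using over_not_subset[OF assms(1), of F] assms(2) by (auto simp: over_def)

text \<open>For minimality, a vertex \<open>w\<close> of \<open>A\<close> outside \<open>B\<close>
  dominates every \<open>v\<close> in \<open>B\<close>: a clique through \<open>v\<close> meets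
  \<open>A\<close>, so it contains all of \<open>A\<close>, including \<open>w\<close>.\<close>

lemma minimal_cut_set_if_sep:
  assumes A: "sep A"
  shows "minimal_cut_set G A"
  unfolding minimal_cut_set_def
proof (intro conjI allI impI)
  obtain F F' where F: "F \<in> over A" "F' \<in> over A" "F \<noteq> F'" using over_two[OF A] by blast
  obtain x where x: "x \<in> F - A" using over_diff_nonempty[OF A F(1)] by blast
  obtain y where y: "y \<in> F' - A" using over_diff_nonempty[OF A F(2)] by blast
  have "(x, y) \<notin> conn A E" using over_not_conn[OF A F x y] .
  moreover have "x \<in> V" "y \<in> V" using F x y mc_subset_V unfolding over_def by blast+
  ultimately show "cut_set G A"
    unfolding cut_set_iff two_comps_iff using sep_subset_V[OF A] x y by blast
  fix B assume B: "B \<subset> A"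
  then obtain w where w: "w \<in> A" "w \<notin> B" by blast
  have "(x, y) \<in> conn B E" if "x \<in> V - B" "y \<in> V - B" for x y
  proof (rule conn_delete_dominated[OF E_sym])
    show "(x, y) \<in> conn {} E" "x \<notin> B" "y \<notin> B" using that G_connected by auto
    fix v assume v: "v \<in> B"
    have "u = w \<or> (w, u) \<in> E" if vu: "(v, u) \<in> E" for u
    proof -
      obtain F where F: "mc F" "v \<in> F" "u \<in> F" using edge_in_mc[OF vu] by blast
      then have "F \<in> over A" using sep_meets_mc[OF A, of F] B v by blast
      then show ?thesis using over_edge[of F A w u] w F by blast
    qed
    then show "\<exists>w. w \<notin> B \<and> (\<forall>u. (v, u) \<in> E \<longrightarrow> u = w \<or> (w, u) \<in> E)" using w by blast
  qed
  then show "\<not> cut_set G B"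
    unfolding cut_set_iff two_comps_iff by blast
qed

text \<open>If \<open>A\<close> is no separator, minimality excludes separators inside
  \<open>A\<close>. Then every vertex of \<open>A\<close> is dominated from outside, and deleting
  \<open>A\<close> separates nothing.\<close>

lemma sep_if_minimal_cut_set:
  assumes A: "minimal_cut_set G A"
  shows "sep A"
proof (rule ccontr)
  assume not_sep: "\<not> sep A"
  have cut: "cut_set G A" using A by (simp add: minimal_cut_set_def)
  have no_sep: "\<not> B \<subseteq> A" if B: "sep B" for B
  proof
    assume "B \<subseteq> A"
    then have "B \<subset> A" using B not_sep by blast
    then show False using A minimal_cut_set_if_sep[OF B] by (simp add: minimal_cut_set_def)
  qed
  have dom: "\<exists>w. w \<notin> A \<and> (\<forall>u. (v, u) \<in> E \<longrightarrow> u = w \<or> (w, u) \<in> E)" if v: "v \<in> A" for v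
  proof -
    have vV: "v \<in> V" using v cut by (auto simp: cut_set_def)
    obtain F where F: "mc F" "v \<in> F" using vertex_in_mc[OF vV] by blast
    show ?thesis
    proof (cases "\<exists>F'. mc F' \<and> v \<in> F' \<and> F' \<noteq> F")
      case True
      then obtain F' where F': "mc F'" "v \<in> F'" "F \<noteq> F'" by blast
      have sep: "sep (F \<inter> F')" using sepI F F' by blast
      obtain w where w: "w \<in> F \<inter> F'" "w \<notin> A" using no_sep[OF sep] by blast
      have "u = w \<or> (w, u) \<in> E" if vu: "(v, u) \<in> E" for u
      proof -
        obtain F'' where F'': "mc F''" "v \<in> F''" "u \<in> F''" using edge_in_mc[OF vu] by blast
        then have "F'' \<in> over (F \<inter> F')" using sep_meets_mc[OF sep, of F''] F F' by blast
        then show ?thesis using over_edge[of F'' "F \<inter> F'" w u] w F'' by blast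
      qed
      then show ?thesis using w by blast
    next
      case unique: False
      have nbr: "u \<in> F" if vu: "(v, u) \<in> E" for u
        using edge_in_mc[OF vu] unique by metis
      \<comment> \<open>A maximal clique inside \<open>A\<close> would meet no other one, since the
        intersection would be a separator in \<open>A\<close>; by connectivity it would be all of
        \<open>V\<close>, leaving no components.\<close>
      have "\<not> F \<subseteq> A"
      proof
        assume FA: "F \<subseteq> A"
        have only: "F' = F" if "mc F'" "u \<in> F'" "u \<in> F" for F' u
          using no_sep[OF sepI[OF F(1) that(1) _ that(3,2)]] FA by blast
        have "z \<in> F" if "z \<in> V" for z
          using G_connected[OF vV that]
        proof (induction rule: conn_induct)
          case refl
          then show ?case by (rule F(2))
        next
          case (step a b)
          obtain F' where "mc F'" "a \<in> F'" "b \<in> F'" using edge_in_mc[OF step.hyps(2)] by blast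
          then show ?case using only step.IH by blast
        qed
        then have "V - A = {}" using FA by blast
        then have "comps V E A = {}" by (simp only: comps_def image_empty)
        then show False using cut by (simp add: cut_set_iff)
      qed
      then obtain w where "w \<in> F" "w \<notin> A" by blast
      moreover have "u = w \<or> (w, u) \<in> E" if "(v, u) \<in> E" for u
        using nbr[OF that] \<open>w \<in> F\<close> mc_edge[OF F(1)] by blast
      ultimately show ?thesis by blast
    qed
  qed
  obtain x y where xy: "x \<in> V - A" "y \<in> V - A" "(x, y) \<notin> conn A E"
    using cut unfolding cut_set_iff two_comps_iff by blast
  have "(x, y) \<in> conn A E"
    by (rule conn_delete_dominated[OF E_sym _ _ _ dom]) (use xy G_connected in auto)
  then show False using xy by simp
qed

lemma minimal_cut_set_iff: "minimal_cut_set G A \<longleftrightarrow> sep A"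
  using minimal_cut_set_if_sep sep_if_minimal_cut_set by blast

text \<open>The family in the definition is forced: its members contain the nonempty
  \<open>A\<close>, all other maximal cliques avoid it.\<close>

lemma t_minimal_cut_set_iff: "t_minimal_cut_set G t A \<longleftrightarrow> sep A \<and> t = card (over A)"
proof
  assume "t_minimal_cut_set G t A"
  then obtain \<F> where A: "sep A" and \<F>: "\<F> \<subseteq> {F. mc F}" "card \<F> = t" "\<Inter>\<F> = A"
    "\<forall>F. mc F \<and> F \<notin> \<F> \<longrightarrow> F \<inter> A = {}"
    unfolding t_minimal_cut_set_def minimal_cut_set_iff by (elim conjE exE) (rule that; assumption)
  have "A \<noteq> {}" using A by (simp add: sep_def)
  then have "\<F> = over A"
    using \<F> unfolding over_def by blast
  then show "sep A \<and> t = card (over A)" using A \<F> by blast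
next
  assume R: "sep A \<and> t = card (over A)"
  then obtain F F' where F: "F \<in> over A" "F' \<in> over A" "F \<inter> F' = A" using over_two by blast
  then have "\<Inter>(over A) = A" unfolding over_def by blast
  then show "t_minimal_cut_set G t A"
    unfolding t_minimal_cut_set_def minimal_cut_set_iff
    using R F sep_meets_mc[of A] by (intro conjI exI[of _ "over A"]) (auto simp: over_def)
qed

text \<open>Only the component containing \<open>A\<close> changes. It splits into one piece for
  each clique over \<open>A\<close> with a surviving vertex, and \<open>over_not_conn\<close> keeps
  the pieces apart.\<close>

lemma card_comps_delete_sep:
  assumes A: "sep A" and T: "A \<inter> T = {}"
  shows "card (comps V E (T \<union> A)) + 1 = card (comps V E T) + card {F \<in> over A. \<not> F \<subseteq> T \<union> A}"
proof -
  let ?G = "{F \<in> over A. \<not> F \<subseteq> T \<union> A}"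
  obtain a where a: "a \<in> A" using A by (auto simp: sep_def)
  have aV: "a \<in> V - T" using a T sep_subset_V[OF A] by blast
  define K0 where "K0 = conn T E `` {a}"
  define Rest where "Rest = comps V E T - {K0}"
  have "\<forall>F\<in>?G. \<exists>z. z \<in> F - (T \<union> A)" by blast
  then obtain p where p: "\<And>F. F \<in> ?G \<Longrightarrow> p F \<in> F - (T \<union> A)" by metis
  define D where "D = (\<lambda>F. conn (T \<union> A) E `` {p F}) ` ?G"
  have K0: "K0 \<in> comps V E T" using aV by (auto simp: K0_def comps_def)
  have A_K0: "b \<in> K0" if "b \<in> A" for b
  proof (cases "b = a")
    case False
    obtain F where "F \<in> over A" using over_two[OF A] by blast
    then have "(a, b) \<in> E" using over_edge[of F A a b] a that False by (auto simp: over_def)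
    then show ?thesis using that a T by (auto simp: K0_def intro: conn_edge)
  qed (simp add: K0_def)
  have p_K0: "p F \<in> K0" if "F \<in> ?G" for F
    using over_edge[of F A a "p F"] p[OF that] that a T by (auto simp: K0_def intro!: conn_edge)
  have same: "conn (T \<union> A) E `` {v} = conn T E `` {v}" if v: "v \<in> V - T" "v \<notin> K0" for v
  proof (rule antisym)
    show "conn (T \<union> A) E `` {v} \<subseteq> conn T E `` {v}"
      using conn_mono[of T "T \<union> A" E E] by blast
    have not_A: "z \<notin> A" if "(v, z) \<in> conn T E" for z
    proof
      assume "z \<in> A"
      then have "(a, z) \<in> conn T E" using A_K0 by (simp add: K0_def)
      then have "(a, v) \<in> conn T E" using conn_trans conn_sym[OF E_sym that] by metis
      then show False using v by (simp add: K0_def)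
    qed
    have "(v, z) \<in> conn (T \<union> A) E" if "(v, z) \<in> conn T E" for z
      using that
    proof (induction rule: conn_induct)
      case (step x y)
      have "(v, y) \<in> conn T E"
        using step.hyps conn_edge conn_trans by metis
      then have "(x, y) \<in> conn (T \<union> A) E"
        using step.hyps not_A by (intro conn_edge) auto
      with step.IH show ?case by (rule conn_trans)
    qed simp
    then show "conn T E `` {v} \<subseteq> conn (T \<union> A) E `` {v}" by blast
  qed
  \<comment> \<open>A walk from \<open>a\<close> leaves \<open>A\<close> for the last time along an
    edge in some clique over \<open>A\<close>, which ties the rest of the walk to that clique's
    representative.\<close>
  have in_K0: "z \<in> A \<or> (\<exists>F\<in>?G. (p F, z) \<in> conn (T \<union> A) E)" if "z \<in> K0" for z
  proof -
    have "(a, z) \<in> conn T E" using that by (simp add: K0_def)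
    then show ?thesis
    proof (induction rule: conn_induct)
      case refl
      then show ?case using a by simp
    next
      case (step x y)
      show ?case
      proof (cases "y \<in> A")
        case y: False
        show ?thesis
        proof (cases "x \<in> A")
          case True
          obtain F where F: "mc F" "x \<in> F" "y \<in> F" using edge_in_mc[OF step.hyps(2)] by blast
          then have over: "F \<in> over A" using sep_meets_mc[OF A, of F] True by blast
          then have FG: "F \<in> ?G" using F y step.hyps by blast
          have "(p F, y) \<in> conn (T \<union> A) E"
          proof (cases "p F = y")
            case False
            then have "(p F, y) \<in> E" using mc_edge[OF F(1)] p[OF FG] F by blast
            then show ?thesis using p[OF FG] y step.hyps by (intro conn_edge) auto
          qed simp
          then show ?thesis using FG by blast
        next
          case False
          then obtain F where F: "F \<in> ?G" "(p F, x) \<in> conn (T \<union> A) E" using step.IH by blast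
          have "(x, y) \<in> conn (T \<union> A) E" using step.hyps False y by (intro conn_edge) auto
          with F(2) have "(p F, y) \<in> conn (T \<union> A) E" by (rule conn_trans)
          then show ?thesis using F(1) by blast
        qed
      qed simp
    qed
  qed
  have comps_eq: "comps V E (T \<union> A) = Rest \<union> D"
  proof (intro equalityI subsetI)
    fix K assume "K \<in> comps V E (T \<union> A)"
    then obtain v where v: "v \<in> V - (T \<union> A)" "K = conn (T \<union> A) E `` {v}" by (auto simp: comps_def)
    show "K \<in> Rest \<union> D"
    proof (cases "v \<in> K0")
      case True
      then obtain F where F: "F \<in> ?G" "(p F, v) \<in> conn (T \<union> A) E" using in_K0 v by blast
      then have "K = conn (T \<union> A) E `` {p F}"
        using v conn_class_eq_iff[OF E_sym, of "T \<union> A" "p F" v] by simp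
      then show ?thesis using F(1) by (auto simp: D_def)
    next
      case False
      then have "K = conn T E `` {v}" using same v by simp
      moreover have "v \<in> conn T E `` {v}" by simp
      then have "conn T E `` {v} \<noteq> K0" using False by metis
      moreover have "conn T E `` {v} \<in> comps V E T" using v(1) by (auto simp: comps_def)
      ultimately have "K \<in> Rest" by (simp add: Rest_def)
      then show ?thesis by blast
    qed
  next
    fix K assume "K \<in> Rest \<union> D"
    then show "K \<in> comps V E (T \<union> A)"
    proof
      assume "K \<in> Rest"
      then obtain v where v: "v \<in> V - T" "K = conn T E `` {v}" "K \<noteq> K0"
        by (auto simp: Rest_def comps_def)
      then have "v \<notin> K0"
        using conn_class_eq_iff[OF E_sym, of T a v] by (auto simp: K0_def)
      then have "K = conn (T \<union> A) E `` {v}" "v \<notin> A" using same v A_K0 by auto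
      then show ?thesis using v by (auto simp: comps_def)
    next
      assume "K \<in> D"
      then obtain F where F: "F \<in> ?G" "K = conn (T \<union> A) E `` {p F}" by (auto simp: D_def)
      have "p F \<in> V" using F(1) p[OF F(1)] mc_subset_V by (auto simp: over_def)
      then show ?thesis using F p[OF F(1)] by (auto simp: comps_def)
    qed
  qed
  have disj: "Rest \<inter> D = {}"
  proof (rule ccontr)
    assume "Rest \<inter> D \<noteq> {}"
    then obtain K F where K: "K \<in> Rest" "F \<in> ?G" "K = conn (T \<union> A) E `` {p F}" by (auto simp: D_def)
    then obtain v where v: "K = conn T E `` {v}" "K \<noteq> K0" by (auto simp: Rest_def comps_def)
    have "p F \<in> K" using K(3) by simp
    then have "(v, p F) \<in> conn T E" using v by simp
    moreover have "(a, p F) \<in> conn T E" using p_K0[OF K(2)] by (simp add: K0_def)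
    ultimately have "(a, v) \<in> conn T E" using conn_trans conn_sym[OF E_sym] by metis
    then show False using v conn_class_eq_iff[OF E_sym, of T a v] by (simp add: K0_def)
  qed
  have "inj_on (\<lambda>F. conn (T \<union> A) E `` {p F}) ?G"
  proof (rule inj_onI, rule ccontr)
    fix F F' assume F: "F \<in> ?G" "F' \<in> ?G" "conn (T \<union> A) E `` {p F} = conn (T \<union> A) E `` {p F'}" "F \<noteq> F'"
    then have "(p F, p F') \<in> conn (T \<union> A) E" using conn_class_eq_iff[OF E_sym] by metis
    then have "(p F, p F') \<in> conn A E" using conn_mono[of A "T \<union> A" E E] by blast
    then show False
      using over_not_conn[OF A, of F F' "p F" "p F'"] F p[OF F(1)] p[OF F(2)] by blast
  qed
  then have "card D = card ?G" by (simp add: D_def card_image)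
  moreover have "card (comps V E (T \<union> A)) = card Rest + card D"
    unfolding comps_eq
    by (rule card_Un_disjoint) (use disj finite_over finite_comps[OF finite_V] in \<open>auto simp: Rest_def D_def\<close>)
  moreover have "card (comps V E T) = card Rest + 1"
    unfolding Rest_def using K0 finite_comps[OF finite_V, of E T] by (metis Suc_eq_plus1 card.remove)
  ultimately show ?thesis by simp
qed

text \<open>Adding \<open>A\<close> changes the count by the surviving cliques over \<open>A\<close>
  minus one. The non-surviving ones are exactly the maximal cliques newly contained in the union,
  since a clique not meeting \<open>A\<close> was contained before.\<close>

lemma card_comps_Union_seps:
  assumes "finite \<A>" "\<And>A. A \<in> \<A> \<Longrightarrow> sep A"
  shows "card (comps V E (\<Union>\<A>)) + card {F. mc F \<and> F \<subseteq> \<Union>\<A>} = 1 + (\<Sum>A\<in>\<A>. card (over A) - 1)"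
  using assms
proof (induction \<A> rule: finite_induct)
  case empty
  have "{F. mc F \<and> F \<subseteq> {}} = {}" using mc_nonempty by blast
  then show ?case by (simp add: card_comps_empty)
next
  case (insert A \<A>)
  let ?T = "\<Union>\<A>"
  have A: "sep A" using insert.prems by simp
  have T: "A \<inter> ?T = {}"
    using sep_eq_if_meet[OF A] insert.prems insert.hyps(2) by blast
  have A_ne: "A \<noteq> {}" using A by (simp add: sep_def)
  have split: "{F. mc F \<and> F \<subseteq> ?T \<union> A} = {F. mc F \<and> F \<subseteq> ?T} \<union> {F \<in> over A. F \<subseteq> ?T \<union> A}"
    using sep_meets_mc[OF A] by (auto simp: over_def)
  have "card {F. mc F \<and> F \<subseteq> ?T \<union> A} = card {F. mc F \<and> F \<subseteq> ?T} + card {F \<in> over A. F \<subseteq> ?T \<union> A}"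
    unfolding split
  proof (rule card_Un_disjoint)
    show "{F. mc F \<and> F \<subseteq> ?T} \<inter> {F \<in> over A. F \<subseteq> ?T \<union> A} = {}"
      using A_ne T unfolding over_def by blast
    show "finite {F. mc F \<and> F \<subseteq> ?T}" by (rule finite_subset[OF _ finite_mc]) blast
  qed (simp add: finite_over)
  moreover have "card (over A) = card {F \<in> over A. F \<subseteq> ?T \<union> A} + card {F \<in> over A. \<not> F \<subseteq> ?T \<union> A}"
    by (subst card_Un_disjoint[symmetric]) (auto simp: finite_over intro: arg_cong[of _ _ card])
  moreover have "card (comps V E (?T \<union> A)) + 1 = card (comps V E ?T) + card {F \<in> over A. \<not> F \<subseteq> ?T \<union> A}"
    by (rule card_comps_delete_sep[OF A T])
  moreover have "card (comps V E ?T) + card {F. mc F \<and> F \<subseteq> ?T} = 1 + (\<Sum>A\<in>\<A>. card (over A) - 1)"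
    using insert.IH insert.prems by simp
  moreover have "card (over A) \<ge> 2" by (rule card_over_ge_2[OF A])
  ultimately show ?case
    using insert.hyps by (simp add: Un_commute)
qed

text \<open>The cliques are taken through the edges from \<open>v\<close> to neighbours in different
  components; a common vertex outside \<open>T\<close> would join these components.\<close>

lemma cut_point_setD:
  assumes T: "cut_point_set V E T" and v: "v \<in> T"
  obtains F F' where "mc F" "mc F'" "F \<noteq> F'" "v \<in> F" "v \<in> F'" "F \<inter> F' \<subseteq> T" "\<not> F \<subseteq> T" "\<not> F' \<subseteq> T"
proof -
  obtain x y where xy: "(v, x) \<in> E" "(v, y) \<in> E" "x \<notin> T" "y \<notin> T" "(x, y) \<notin> conn T E"
    using T v by (auto simp: cut_point_set_def)
  obtain F where F: "mc F" "v \<in> F" "x \<in> F" using edge_in_mc[OF xy(1)] by blast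
  obtain F' where F': "mc F'" "v \<in> F'" "y \<in> F'" using edge_in_mc[OF xy(2)] by blast
  have link: "(w, z) \<in> conn T E" if "mc F" "w \<in> F" "z \<in> F" "w \<notin> T" "z \<notin> T" for F w z
    using that mc_edge[of F w z] conn_edge[of w z E T] by (cases "w = z") auto
  have "F \<inter> F' \<subseteq> T"
  proof
    fix w assume "w \<in> F \<inter> F'"
    then show "w \<in> T"
      using link[OF F(1,3), of w] link[OF F'(1), of w y] F' xy conn_trans[of x w T E y] by blast
  qed
  moreover have "F \<noteq> F'" using link[OF F(1,3), of y] F' xy by blast
  ultimately show ?thesis using that F F' xy by blast
qed

lemma cut_point_set_sep:
  assumes "cut_point_set V E T" "v \<in> T"
  obtains A where "sep A" "v \<in> A" "A \<subseteq> T"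
proof -
  obtain F F' where F: "mc F" "mc F'" "F \<noteq> F'" "v \<in> F" "v \<in> F'" "F \<inter> F' \<subseteq> T"
    using cut_point_setD[OF assms] by metis
  then show ?thesis using that[OF sepI[OF F(1-5)]] by blast
qed

lemma sum_card_seps:
  assumes "finite \<A>" "\<And>A. A \<in> \<A> \<Longrightarrow> sep A"
  shows "card (\<Union>\<A>) = (\<Sum>A\<in>\<A>. card A)"
proof (rule card_Union_disjoint)
  show "pairwise disjnt \<A>"
    using sep_eq_if_meet assms(2) unfolding pairwise_def disjnt_def by blast
  show "finite A" if "A \<in> \<A>" for A
    using sep_subset_V[OF assms(2)[OF that]] finite_V finite_subset by blast
qed

text \<open>A single separator is a cut point set containing no maximal clique, which gives (a).
  Given (a), equality fails exactly for cut point sets that contain a maximal clique, and (b)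
  decides whether these exist.\<close>

lemma comps_condition_iff:
  "(\<forall>T. cut_point_set V E T \<longrightarrow> card (comps V E T) = card T + 1) \<longleftrightarrow>
   (\<forall>A. sep A \<longrightarrow> card (over A) = card A + 1) \<and>
   (\<forall>\<A>. (\<forall>A\<in>\<A>. sep A) \<and> mc (\<Union>\<A>) \<longrightarrow> (\<exists>A\<in>\<A>. card A = 1))" (is "?L \<longleftrightarrow> ?a \<and> ?b")
proof
  have adj: "(v, x) \<in> E" if "F \<in> over A" "v \<in> A" "x \<in> F - A" for F A v x
    using that over_edge[of F A v x] by blast
  have finite_seps: "finite \<A>" if "\<forall>A\<in>\<A>. sep A" for \<A>
    by (rule finite_subset[of _ "Pow V"]) (use that sep_subset_V finite_V in auto)
  {
    assume L: ?L
    show "?a \<and> ?b"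
    proof
      show a: ?a
      proof (intro allI impI)
        fix A assume A: "sep A"
        have "cut_point_set V E A"
          unfolding cut_point_set_def
        proof (intro conjI ballI)
          show "A \<subseteq> V" by (rule sep_subset_V[OF A])
          fix v assume v: "v \<in> A"
          obtain F F' where F: "F \<in> over A" "F' \<in> over A" "F \<noteq> F'" using over_two[OF A] by blast
          obtain x where x: "x \<in> F - A" using over_diff_nonempty[OF A F(1)] by blast
          obtain y where y: "y \<in> F' - A" using over_diff_nonempty[OF A F(2)] by blast
          show "\<exists>x y. (v, x) \<in> E \<and> (v, y) \<in> E \<and> x \<notin> A \<and> y \<notin> A \<and> (x, y) \<notin> conn A E"
            using adj[OF F(1) v x] adj[OF F(2) v y] over_not_conn[OF A F x y] x y by blast
        qed
        moreover have "card (comps V E A) + card {F. mc F \<and> F \<subseteq> A} = 1 + (card (over A) - 1)"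
          using card_comps_Union_seps[of "{A}"] A by simp
        moreover have "{F. mc F \<and> F \<subseteq> A} = {}" using over_not_subset[OF A] by blast
        ultimately show "card (over A) = card A + 1"
          using L card_over_ge_2[OF A] by simp
      qed
      show ?b
      proof (intro allI impI, rule ccontr)
        fix \<A> assume \<A>: "(\<forall>A\<in>\<A>. sep A) \<and> mc (\<Union>\<A>)" and no_one: "\<not> (\<exists>A\<in>\<A>. card A = 1)"
        let ?F = "\<Union>\<A>"
        have three: "card (over A) \<ge> 3" if "A \<in> \<A>" for A
        proof -
          have "A \<noteq> {}" "A \<subseteq> V" using \<A> that sep_subset_V by (auto simp: sep_def)
          then have "card A \<noteq> 0" using finite_V finite_subset by fastforce
          moreover have "card A \<noteq> 1" using that no_one by blast
          moreover have "card (over A) = card A + 1" using a \<A> that by blast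
          ultimately show ?thesis by linarith
        qed
        have "cut_point_set V E ?F"
          unfolding cut_point_set_def
        proof (intro conjI ballI)
          show "?F \<subseteq> V" using \<A> mc_subset_V by blast
          fix v assume "v \<in> ?F"
          then obtain A where A: "A \<in> \<A>" "v \<in> A" by blast
          then have sepA: "sep A" using \<A> by blast
          \<comment> \<open>Two cliques over \<open>A\<close> besides the covered one provide
            neighbours of \<open>v\<close> in different components.\<close>
          have "card (over A - {?F}) \<ge> 2"
            using three[OF A(1)] diff_card_le_card_Diff[of "{?F}" "over A"] by simp
          then obtain F1 F2 where F: "F1 \<in> over A - {?F}" "F2 \<in> over A - {?F}" "F1 \<noteq> F2"
            using finite_over[of A]
            by (metis card_le_Suc0_iff_eq finite_Diff not_less_eq_eq numeral_2_eq_2)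
          have over_F: "?F \<in> over A" using \<A> A by (auto simp: over_def)
          have meet: "F' \<inter> ?F = A" if "F' \<in> over A - {?F}" for F'
            using over_Int[OF sepA _ over_F, of F'] that by blast
          obtain x where x: "x \<in> F1 - A" using over_diff_nonempty[OF sepA, of F1] F by blast
          obtain y where y: "y \<in> F2 - A" using over_diff_nonempty[OF sepA, of F2] F by blast
          have "(x, y) \<notin> conn A E" using over_not_conn[OF sepA _ _ F(3) x y] F by blast
          then have "(x, y) \<notin> conn ?F E" using conn_mono[of A ?F E E] A by blast
          moreover have "x \<notin> ?F" "y \<notin> ?F" using meet[OF F(1)] meet[OF F(2)] x y by blast+
          moreover have "(v, x) \<in> E" "(v, y) \<in> E" using adj[of F1 A v x] adj[of F2 A v y] F A x y by blast+
          ultimately show "\<exists>x y. (v, x) \<in> E \<and> (v, y) \<in> E \<and> x \<notin> ?F \<and> y \<notin> ?F \<and> (x, y) \<notin> conn ?F E"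
            by blast
        qed
        moreover have "{F. mc F \<and> F \<subseteq> ?F} = {?F}" using \<A> mc_maximal by blast
        moreover have "card (comps V E ?F) + card {F. mc F \<and> F \<subseteq> ?F} = 1 + (\<Sum>A\<in>\<A>. card (over A) - 1)"
          using \<A> finite_seps by (intro card_comps_Union_seps) auto
        moreover have "(\<Sum>A\<in>\<A>. card (over A) - 1) = card ?F"
          using a \<A> sum_card_seps[of \<A>] finite_seps by simp
        ultimately show False using L by simp
      qed
    qed
  }
  {
    assume ab: "?a \<and> ?b"
    show ?L
    proof (intro allI impI)
      fix T assume T: "cut_point_set V E T"
      define \<A> where "\<A> = {A. sep A \<and> A \<subseteq> T}"
      have fin: "finite \<A>" by (rule finite_seps) (simp add: \<A>_def)
      have T_eq: "\<Union>\<A> = T"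
        using cut_point_set_sep[OF T] unfolding \<A>_def by blast
      have none: "{F. mc F \<and> F \<subseteq> T} = {}"
      proof (rule ccontr)
        assume "{F. mc F \<and> F \<subseteq> T} \<noteq> {}"
        then obtain F where F: "mc F" "F \<subseteq> T" by blast
        \<comment> \<open>Each vertex of \<open>F\<close> is in a separator because it is in
          \<open>T\<close>, and a separator meeting \<open>F\<close> is contained in it; so (b)
          applies to \<open>F\<close>.\<close>
        have "\<Union>{A. sep A \<and> A \<subseteq> F} = F"
        proof
          show "F \<subseteq> \<Union>{A. sep A \<and> A \<subseteq> F}"
          proof
            fix v assume v: "v \<in> F"
            then obtain A where A: "sep A" "v \<in> A" using cut_point_set_sep[OF T] F by blast
            then have "A \<subseteq> F" using sep_meets_mc[OF A(1) F(1)] v by (auto simp: over_def)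
            then show "v \<in> \<Union>{A. sep A \<and> A \<subseteq> F}" using A by blast
          qed
        qed blast
        then obtain A where A: "sep A" "A \<subseteq> F" "card A = 1"
          using ab F(1) by (metis (mono_tags, lifting) mem_Collect_eq)
        then have card: "card (over A) = 2" using ab by simp
        obtain v where v: "A = {v}" using A(3) by (rule card_1_singletonE)
        then have "v \<in> T" using A F by blast
        then obtain F1 F2 where F12: "mc F1" "mc F2" "F1 \<noteq> F2" "v \<in> F1" "v \<in> F2" "\<not> F1 \<subseteq> T" "\<not> F2 \<subseteq> T"
          using cut_point_setD[OF T] by metis
        \<comment> \<open>\<open>F\<close> lies inside \<open>T\<close>, \<open>F1\<close> and
          \<open>F2\<close> do not: three cliques over a separator that has only two.\<close>
        then have "{F, F1, F2} \<subseteq> over A" using F A v by (auto simp: over_def)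
        then have "card {F, F1, F2} \<le> 2" using card_mono[OF finite_over, of "{F, F1, F2}" A] card by simp
        moreover have "F \<noteq> F1" "F \<noteq> F2" using F F12 by blast+
        ultimately show False using F12(3) by simp
      qed
      have "card (comps V E T) + card {F. mc F \<and> F \<subseteq> T} = 1 + (\<Sum>A\<in>\<A>. card (over A) - 1)"
        using card_comps_Union_seps[OF fin] unfolding T_eq by (simp add: \<A>_def)
      then have "card (comps V E T) = 1 + (\<Sum>A\<in>\<A>. card (over A) - 1)"
        unfolding none by simp
      also have "(\<Sum>A\<in>\<A>. card (over A) - 1) = (\<Sum>A\<in>\<A>. card A)"
        using ab by (intro sum.cong) (auto simp: \<A>_def)
      also have "\<dots> = card T"
        using sum_card_seps[OF fin] unfolding T_eq by (simp add: \<A>_def)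
      finally show "card (comps V E T) = card T + 1" by simp
    qed
  }
qed

end

section \<open>Unmixedness in terms of component counts\<close>

lemma binomial_edge_ideal_eq:
  assumes "pverts G = {1..n}" "parcs G \<subseteq> {1..n} \<times> {1..n}" "sym (parcs G)"
  shows "(binomial_edge_ideal n G :: 'k::field xypoly set) = edge_ideal n {} (parcs G)"
proof -
  let ?E = "parcs G"
  define B :: "'k xypoly set" where "B = {minor i j | i j. i < j \<and> (i, j) \<in> ?E}"
  interpret ring "xy_ring n :: 'k xypoly ring" by (rule cring.axioms(1)[OF cring_xy_ring])
  have BG: "B \<subseteq> gens {} ?E" by (auto simp: B_def gens_def)
  have gens: "gens {} ?E \<subseteq> (polys n :: 'k xypoly set)"
    using assms(2) by (intro gens_subset_polys) auto
  have B: "B \<subseteq> polys n" using BG gens by blast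
  have I: "ideal (Idl\<^bsub>xy_ring n\<^esub> B) (xy_ring n)" by (rule genideal_ideal[OF B])
  have "(minor i j :: 'k xypoly) \<in> Idl\<^bsub>xy_ring n\<^esub> B" if ij: "(i, j) \<in> ?E" for i j
  proof (cases i j rule: linorder_cases)
    case less
    then have "minor i j \<in> B" using ij by (auto simp: B_def)
    then show ?thesis using genideal_self[OF B] by blast
  next
    case equal
    then show ?thesis using ideal_zero[OF I] by simp
  next
    case greater
    then have "minor j i \<in> B" using symD[OF assms(3) ij] by (auto simp: B_def)
    then have "minor j i \<in> Idl\<^bsub>xy_ring n\<^esub> B" using genideal_self[OF B] by blast
    then have "- minor j i \<in> Idl\<^bsub>xy_ring n\<^esub> B" by (rule ideal_uminus[OF I])
    moreover have "minor i j = (- minor j i :: 'k xypoly)" by (rule minor_swap)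
    ultimately show ?thesis by simp
  qed
  then have "gens {} ?E \<subseteq> Idl\<^bsub>xy_ring n\<^esub> B" by (auto simp: gens_subset_iff)
  then have "edge_ideal n {} ?E \<subseteq> Idl\<^bsub>xy_ring n\<^esub> B" by (rule edge_ideal_minimal[OF I])
  moreover have "Idl\<^bsub>xy_ring n\<^esub> B \<subseteq> edge_ideal n {} ?E"
    using BG assms(2) gens_in_edge_ideal[of "{}" n ?E]
    by (intro genideal_minimal ideal_edge_ideal) auto
  moreover have "binomial_edge_ideal n G = Idl\<^bsub>xy_ring n\<^esub> B"
    by (simp add: binomial_edge_ideal_def B_def minor_def)
  ultimately show ?thesis by blast
qed

lemma card_comps_eq_card_roots:
  assumes cl: "cluster n T (conn T E)" and E: "sym E"
  shows "card (comps {1..n} E T) = card (roots n T (conn T E))"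
proof -
  let ?R = "conn T E"
  have "comps {1..n} E T = (\<lambda>v. ?R `` {v}) ` roots n T ?R"
  proof (intro equalityI subsetI)
    fix K assume "K \<in> comps {1..n} E T"
    then obtain v where v: "v \<in> {1..n} - T" "K = ?R `` {v}" by (auto simp: comps_def)
    have "root ?R v \<in> roots n T ?R"
      using root_in[OF cl v(1)] root_idem[OF cluster_equiv[OF cl]] by (simp add: roots_def[OF cl])
    moreover have "?R `` {v} = ?R `` {root ?R v}"
      using conn_class_eq_iff[OF E] root_rel[OF cluster_equiv[OF cl]] by metis
    ultimately show "K \<in> (\<lambda>v. ?R `` {v}) ` roots n T ?R" using v(2) by blast
  qed (auto simp: comps_def roots_def[OF cl])
  moreover have "inj_on (\<lambda>v. ?R `` {v}) (roots n T ?R)"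
  proof (rule inj_onI)
    fix v w assume "v \<in> roots n T ?R" "w \<in> roots n T ?R" "?R `` {v} = ?R `` {w}"
    then show "v = w"
      using conn_class_eq_iff[OF E, of T v w] root_eq_iff[OF cluster_equiv[OF cl], of v w]
      by (simp add: roots_def[OF cl])
  qed
  ultimately show ?thesis by (simp add: card_image)
qed

text \<open>One root per component leaves \<open>n - |T| - c(T)\<close> non-roots.\<close>

lemma height_cluster_prime_conn:
  assumes cl: "cluster n T (conn T E)" and E: "sym E"
  shows "ideal_height (xy_ring n) (cluster_prime n T (conn T E) :: 'k::field xypoly set)
    = enat (n + card T - card (comps {1..n} E T))"
proof -
  have "card (nonroots (conn T E)) + 2 * card T = n + card T - card (roots n T (conn T E))"
    using card_roots[OF cl] by linarith
  then show ?thesis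
    using height_cluster_prime[OF cl] card_comps_eq_card_roots[OF assms] by simp
qed

section \<open>Associated primes and their heights for a fixed graph\<close>

context
  fixes n :: nat and E :: "nat rel"
  assumes E: "E \<subseteq> {1..n} \<times> {1..n}" "sym E" "irrefl E"
begin

abbreviation CP :: "nat set \<Rightarrow> 'k::field xypoly set" where
  "CP T \<equiv> cluster_prime n T (conn T E)"

lemma cluster_conn_E: "T \<subseteq> {1..n} \<Longrightarrow> cluster n T (conn T E)"
  by (rule cluster_conn[OF E(2,1)])

lemma cluster_prime_subset_imp:
  assumes "T \<subseteq> {1..n}" "T' \<subseteq> {1..n}" and sub: "(CP T' :: 'k::field xypoly set) \<subseteq> CP T"
  shows "T' \<subseteq> T"
proof
  fix v assume v: "v \<in> T'"
  then have "pvar (X v) \<in> (CP T' :: 'k xypoly set)"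
    using X_in_cluster_prime[OF cluster_conn_E[OF assms(2)], of v] assms(2) by blast
  then show "v \<in> T"
    using X_in_cluster_prime[OF cluster_conn_E[OF assms(1)], of v] sub v assms(2) by blast
qed

text \<open>If the neighbours of \<open>v\<close> outside \<open>T\<close> lie in one component,
  putting \<open>v\<close> back gives a smaller prime, and a different one because it no longer
  contains \<open>x_v\<close>.\<close>

lemma cut_point_set_if_minimal:
  assumes T: "T \<subseteq> {1..n}"
    and min: "\<And>T'. T' \<subseteq> {1..n} \<Longrightarrow> (CP T' :: 'k::field xypoly set) \<subseteq> CP T \<Longrightarrow> (CP T' :: 'k xypoly set) = CP T"
  shows "cut_point_set {1..n} E T"
proof (rule ccontr)
  assume "\<not> ?thesis"
  then obtain v where v: "v \<in> T"
    and nbrs: "\<And>x y. (v, x) \<in> E \<Longrightarrow> (v, y) \<in> E \<Longrightarrow> x \<notin> T \<Longrightarrow> y \<notin> T \<Longrightarrow> (x, y) \<in> conn T E"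
    using T unfolding cut_point_set_def by blast
  have T': "T - {v} \<subseteq> {1..n}" using T by blast
  have "(CP (T - {v}) :: 'k xypoly set) \<subseteq> CP T"
  proof (rule cluster_prime_mono[OF cluster_conn_E[OF T] cluster_conn_E[OF T']])
    show "T - {v} \<subseteq> T" by blast
    fix i j assume "(i, j) \<in> conn (T - {v}) E" "i \<notin> T" "j \<notin> T"
    then show "(i, j) \<in> conn T E"
      by (rule conn_delete_simplicial[OF _ _ _ E(2) nbrs])
  qed
  then have "(CP T :: 'k xypoly set) \<subseteq> CP (T - {v})"
    using min[OF T'] by simp
  then have "T \<subseteq> T - {v}" by (rule cluster_prime_subset_imp[OF T' T])
  then show False using v by blast
qed

text \<open>A vertex \<open>v\<close> of \<open>T\<close> missing from \<open>T'\<close> links two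
  components of the complement of \<open>T\<close>; the minor of its neighbours there lies in the
  prime of \<open>T'\<close> but not in that of \<open>T\<close>.\<close>

lemma minimal_if_cut_point_set:
  assumes T: "cut_point_set {1..n} E T" and T': "T' \<subseteq> {1..n}"
    and sub: "(CP T' :: 'k::field xypoly set) \<subseteq> CP T"
  shows "T' = T"
proof (rule ccontr)
  assume "T' \<noteq> T"
  have TV: "T \<subseteq> {1..n}" using T by (simp add: cut_point_set_def)
  then obtain v where v: "v \<in> T" "v \<notin> T'"
    using cluster_prime_subset_imp[OF _ T' sub] \<open>T' \<noteq> T\<close> by blast
  obtain x y where xy: "(v, x) \<in> E" "(v, y) \<in> E" "x \<notin> T" "y \<notin> T" "(x, y) \<notin> conn T E"
    using T v by (auto simp: cut_point_set_def)
  have T'T: "T' \<subseteq> T" by (rule cluster_prime_subset_imp[OF TV T' sub])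
  have V: "x \<in> {1..n}" "y \<in> {1..n}" using xy E(1) by auto
  have "(x, v) \<in> conn T' E"
    using xy v T'T symD[OF E(2) xy(1)] by (intro conn_edge) auto
  moreover have "(v, y) \<in> conn T' E"
    using xy v T'T by (intro conn_edge) auto
  ultimately have "(x, y) \<in> conn T' E" by (rule conn_trans)
  then have "(minor x y :: 'k xypoly) \<in> CP T'"
    using minor_in_cluster_prime[OF cluster_conn_E[OF T'] V] by blast
  then have "(minor x y :: 'k xypoly) \<in> CP T" using sub by blast
  then show False
    using minor_in_cluster_prime[OF cluster_conn_E[OF TV] V] xy by blast
qed

lemma associated_prime_edge_ideal_iff:
  "associated_prime (xy_ring n) (edge_ideal n {} E :: 'k::field xypoly set) P \<longleftrightarrow>
    (\<exists>T. cut_point_set {1..n} E T \<and> P = CP T)"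
proof -
  let ?P = "CP ` Pow {1..n} :: 'k xypoly set set"
  have "associated_prime (xy_ring n) (\<Inter>?P) P \<longleftrightarrow> P \<in> ?P \<and> (\<forall>Q\<in>?P. Q \<subseteq> P \<longrightarrow> Q = P)"
    by (rule associated_prime_Inter_iff) (auto simp: primeideal_cluster_prime)
  also have "\<dots> \<longleftrightarrow> (\<exists>T. cut_point_set {1..n} E T \<and> P = CP T)"
  proof
    assume "P \<in> ?P \<and> (\<forall>Q\<in>?P. Q \<subseteq> P \<longrightarrow> Q = P)"
    then have "P \<in> ?P" and min: "\<forall>Q\<in>?P. Q \<subseteq> P \<longrightarrow> Q = P" by simp_all
    then obtain T where T: "T \<subseteq> {1..n}" "P = CP T" by blast
    have "cut_point_set {1..n} E T"
    proof (rule cut_point_set_if_minimal[OF T(1)])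
      fix T' assume "T' \<subseteq> {1..n}" "(CP T' :: 'k xypoly set) \<subseteq> CP T"
      then show "(CP T' :: 'k xypoly set) = CP T" using min T(2) by simp
    qed
    then show "\<exists>T. cut_point_set {1..n} E T \<and> P = CP T" using T(2) by blast
  next
    assume "\<exists>T. cut_point_set {1..n} E T \<and> P = CP T"
    then obtain T where T: "cut_point_set {1..n} E T" "P = CP T" by blast
    have "T \<subseteq> {1..n}" using T(1) by (simp add: cut_point_set_def)
    moreover have "Q = P" if "Q \<in> ?P" "Q \<subseteq> P" for Q
      using that minimal_if_cut_point_set[OF T(1)] T(2) by blast
    ultimately show "P \<in> ?P \<and> (\<forall>Q\<in>?P. Q \<subseteq> P \<longrightarrow> Q = P)" using T(2) by blast
  qed
  finally show ?thesis by (simp add: edge_ideal_eq_Inter[OF E])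
qed

lemma unmixed_edge_ideal_iff:
  assumes conn: "card (comps {1..n} E {}) = 1"
  shows "unmixed (xy_ring n) (edge_ideal n {} E :: 'k::field xypoly set) \<longleftrightarrow>
    (\<forall>T. cut_point_set {1..n} E T \<longrightarrow> card (comps {1..n} E T) = card T + 1)"
proof -
  have height: "ideal_height (xy_ring n) (CP T :: 'k xypoly set) = enat (n + card T - card (comps {1..n} E T))"
    if "T \<subseteq> {1..n}" for T
    by (rule height_cluster_prime_conn[OF cluster_conn_E[OF that] E(2)])
  \<comment> \<open>Keeps the natural-number subtractions in the heights from truncating.\<close>
  have bound: "card (comps {1..n} E T) + card T \<le> n" if "T \<subseteq> {1..n}" for T
    using card_roots[OF cluster_conn_E[OF that]] card_comps_eq_card_roots[OF cluster_conn_E[OF that] E(2)]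
    by simp
  \<comment> \<open>The empty set supplies the reference height \<open>n - 1\<close> with which all
    others are compared.\<close>
  have empty: "cut_point_set {1..n} E {}" by (simp add: cut_point_set_def)
  have sub: "T \<subseteq> {1..n}" if "cut_point_set {1..n} E T" for T
    using that by (simp add: cut_point_set_def)
  have "unmixed (xy_ring n) (edge_ideal n {} E :: 'k xypoly set) \<longleftrightarrow>
    (\<forall>T T'. cut_point_set {1..n} E T \<longrightarrow> cut_point_set {1..n} E T' \<longrightarrow>
      n + card T - card (comps {1..n} E T) = n + card T' - card (comps {1..n} E T'))"
    unfolding unmixed_def associated_prime_edge_ideal_iff using height sub by (metis enat.inject)
  also have "\<dots> \<longleftrightarrow> (\<forall>T. cut_point_set {1..n} E T \<longrightarrow> n + card T - card (comps {1..n} E T) = n - 1)"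
    using empty conn by (metis add_0_right card.empty)
  also have "\<dots> \<longleftrightarrow> (\<forall>T. cut_point_set {1..n} E T \<longrightarrow> card (comps {1..n} E T) = card T + 1)"
  proof -
    have "n + card T - card (comps {1..n} E T) = n - 1 \<longleftrightarrow> card (comps {1..n} E T) = card T + 1"
      if "T \<subseteq> {1..n}" for T
      using bound[OF that] bound[of "{}"] conn by auto
    then show ?thesis using sub by blast
  qed
  finally show ?thesis .
qed

end

theorem theorem3p4:
  fixes G :: "nat pair_pre_digraph" and n :: nat
  assumes "generalized_block_graph G" and "pverts G = {1..n}"
  shows "unmixed (xy_ring n) (binomial_edge_ideal n G :: 'k::field xypoly set) \<longleftrightarrow>
     (\<forall>t A. t_minimal_cut_set G t A \<longrightarrow> int (card A) = int t - 1) \<and>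
     (\<forall>\<A>. (\<forall>A\<in>\<A>. minimal_cut_set G A) \<and> max_clique G (\<Union>\<A>) \<longrightarrow> (\<exists>A\<in>\<A>. card A = 1))"
proof -
  interpret gen_block_graph G by unfold_locales (rule assms(1))
  note V = assms(2)
  have E: "E \<subseteq> {1..n} \<times> {1..n}" "sym E" "irrefl E"
    using E_subset E_sym E_irrefl unfolding V by (auto simp: irrefl_def)
  have "unmixed (xy_ring n) (binomial_edge_ideal n G :: 'k xypoly set) \<longleftrightarrow>
    (\<forall>T. cut_point_set V E T \<longrightarrow> card (comps V E T) = card T + 1)"
    unfolding binomial_edge_ideal_eq[OF V E(1,2)] V
    by (rule unmixed_edge_ideal_iff[OF E]) (use card_comps_empty in \<open>simp add: V\<close>)
  also have "\<dots> \<longleftrightarrow> (\<forall>A. sep A \<longrightarrow> card (over A) = card A + 1) \<and>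
      (\<forall>\<A>. (\<forall>A\<in>\<A>. sep A) \<and> max_clique G (\<Union>\<A>) \<longrightarrow> (\<exists>A\<in>\<A>. card A = 1))"
    by (rule comps_condition_iff)
  also have "(\<forall>A. sep A \<longrightarrow> card (over A) = card A + 1) \<longleftrightarrow>
      (\<forall>t A. t_minimal_cut_set G t A \<longrightarrow> int (card A) = int t - 1)"
    unfolding t_minimal_cut_set_iff by auto
  finally show ?thesis unfolding minimal_cut_set_iff .
qed

end
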